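(* In the bond market described in the context, suppose that the support of the Lévy measure $\nu$ consists of infinitely many discrete points $\{x_i\}_{i=1}^\infty$ with $\lim_{i\to\infty}|x_i|=\infty$. Assume that $\gamma(t,x,T)=\gamma(t,T)x$, so that $G(t,x,T)=G(t,T)x$ with $G(t,T)=-\int_t^T\gamma(t,s)ds$. If there exists a constant $\tilde G>0$ such that the set $$A=\Big\{(\omega,t)\in\Omega\times[0,T^\ast]:\ \sup_{T\in J}|G(t,T)|\le\tilde G\Big\}$$ is of positive $P\otimes\lambda$ measure and the Lévy measure has exponential moment of order $2(\tilde G+\varepsilon)$ for some $\varepsilon>0$, i.e. $$\sum_{i=1}^\infty e^{2(\tilde G+\varepsilon)|x_i|}\,\nu(\{x_i\})<\infty,$$ then the market is not $L^2$-complete.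
   Context: **Noise.** Fix $T^\ast>0$. Let $Z=(Z(t))_{t\in[0,T^\ast]}$ be a càdlàg Lévy process on a probability space $(\Omega,\mathcal{F},P)$, with jump measure $N(t,A)=\#\{s\in[0,t]:\Delta Z(s)\in A\}$, $\Delta Z(s)=Z(s)-Z(s-)$, Lévy measure $\nu$ ($\mathbf{E}N(t,A)=t\,\nu(A)$ when $0\notin\bar A$; $\nu(\{0\})=0$; $\int_{\mathbb{R}}(|x|^2\wedge 1)\,\nu(dx)<\infty$), compensated jump measure $\tilde N(t,A)=N(t,A)-t\,\nu(A)$, and Lévy–Itô decomposition $Z(t)=at+bW(t)+\int_0^t\int_{|x|<1}x\,\tilde N(ds,dx)+\int_0^t\int_{|x|\ge1}x\,N(ds,dx)$ with $a\in\mathbb{R}$, $b\ge0$ and $W$ a standard Wiener process adapted to $\mathcal{F}_t=\sigma\{Z(s):0\le s\le t\}$. $\lambda$ is Lebesgue measure on $[0,T^\ast]$. Dependence on $\omega$ is suppressed in the notation. In the situation of the claim, $\nu$ is given by the sequence of positive numbers $\nu(\{x_i\})$, and $\sum_i\nu(\{x_i\})<\infty$. **Integrands.** $\Phi$ is the class of predictable $\phi$ with $\int_0^{T^\ast}|\phi(s)|^2ds<\infty$ $P$-a.s. $\Psi_{1,2}$ is the class of predictable (i.e. $\mathcal{P}\otimes\mathcal{B}(\mathbb{R})$-measurable, $\mathcal{P}$ the predictable $\sigma$-field) $\psi(\omega,s,x)$ with $\int_0^{T^\ast}\int_{\mathbb{R}}(|\psi(s,x)|^2\wedge|\psi(s,x)|)\,\nu(dx)ds<\infty$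 $P$-a.s. For such integrands $\int_0^\cdot\phi\,dW$ and $\int_0^\cdot\int_{\mathbb{R}}\psi\,d\tilde N$ are well-defined local martingales. **Bond market.** The forward rate satisfies $df(t,T)=\alpha(t,T)dt+\sigma(t,T)dW(t)+\int_{\mathbb{R}}\gamma(t,x,T)N(dt,dx)$, $t,T\in[0,T^\ast]$, with predictable coefficients such that $P$-a.s. $\int_0^{T^\ast}\int_0^{T^\ast}|\alpha(t,T)|\,dTdt<\infty$, $\int_0^{T^\ast}\int_0^{T^\ast}|\sigma(t,T)|^2dTdt<\infty$, $\int_0^{T^\ast}\int_0^{T^\ast}\int_{\mathbb{R}}|\gamma(t,x,T)|\,\nu(dx)dTdt<\infty$, and $\alpha(t,T)=\sigma(t,T)=\gamma(t,x,T)=0$ for $t>T$ and all $x$. Bond prices are $P(t,T)=e^{-\int_t^Tf(t,s)ds}$; the bank account satisfies $dB(t)=f(t,t)B(t)dt$; discounted bond prices are $\hat P(t,T)=B(t)^{-1}P(t,T)$. Put $S(t,T)=-\int_t^T\sigma(t,s)ds$, $G(t,x,T)=-\int_t^T\gamma(t,x,s)ds$. Standing assumption: $P$ is a martingale measure, i.e. $\hat P(\cdot,T)$ is a $P$-local martingale for each $T\in[0,T^\ast]$; then $d\hat P(t,T)=\hat P(t-,T)\big(S(t,T)dW(t)+\int_{\mathbb{R}}(e^{G(t,x,T)}-1)\tilde N(dt,dx)\big)$. **Portfolios.** $J=\{T_i:i\in\mathbb{N}\}$ is a fixed countable dense subset of $[0,T^\ast]$; only bonds with maturities in $J$ are traded.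 $B$ also denotes the Banach space of bounded real sequences $z=(z_i)$ with $\|z\|_B=\sup_i|z_i|$. Restricting functions of $T$ to $J$, the objects $\hat P(t-)$, $S(t)=(S(t,T_i))_i$, $e^{G(t,x)}-1=(e^{G(t,x,T_i)}-1)_i$ and their componentwise products are treated as elements of $B$. A trading strategy is a predictable $l^1$-valued process $\varphi(t)=(\varphi(t,T_j))_j$, and $\langle\varphi,z\rangle_{B^\ast,B}=\sum_j\varphi(T_j)z_j$ for $\varphi\in l^1$, $z\in B$. It is $\hat P$-integrable if $\langle\varphi(s),\hat P(s-)S(s)\rangle_{B^\ast,B}\in\Phi$ and $\langle\varphi(s),\hat P(s-)(e^{G(s,x)}-1)\rangle_{B^\ast,B}\in\Psi_{1,2}$, and then $$\int_0^t\langle\varphi(s),d\hat P(s)\rangle_{B^\ast,B}:=\int_0^t\langle\varphi(s),\hat P(s-)S(s)\rangle_{B^\ast,B}\,dW(s)+\int_0^t\int_{\mathbb{R}}\langle\varphi(s),\hat P(s-)(e^{G(s,x)}-1)\rangle_{B^\ast,B}\,\tilde N(ds,dx).$$ A $\hat P$-integrable $\varphi$ is admissible ($\varphi\in\mathcal{A}$) if $\int_0^\cdot\langle\varphi(s),d\hat P(s)\rangle_{B^\ast,B}$ is a martingale. **Completeness.** An $\mathcal{F}_{T^\ast}$-measurable random variable $X$ can be replicated if $X=x+\int_0^{T^\ast}\langle\varphi(t),d\hat P(t)\rangle_{B^\ast,B}$ for some $x\in\mathbb{R}$ and $\varphi\in\mathcal{A}$. The market is $L^2$-complete if every $X\in L^2(\Omega,\mathcal{F}_{T^\ast},P)$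 can be replicated; it is not $L^2$-complete if some such $X$ cannot be replicated. *)

theory Defs
  imports "HOL-Probability.Probability"
begin

text \<open>Processes are curried with the sample point as last argument: \<open>X t \<omega>\<close>, \<open>\<psi> s x \<omega>\<close>, \<open>f t T \<omega>\<close>.
  Only times in \<open>{0..Tm}\<close> matter, where \<open>Tm\<close> is the horizon.\<close>

definition cadlag_on :: "real \<Rightarrow> (real \<Rightarrow> real) \<Rightarrow> bool" where
  "cadlag_on Tm h \<longleftrightarrow>
     (\<forall>t\<in>{0..<Tm}. (h \<longlongrightarrow> h t) (at_right t)) \<and>
     (\<forall>t\<in>{0<..Tm}. \<exists>l. (h \<longlongrightarrow> l) (at_left t))"

definition left_lim :: "(real \<Rightarrow> real) \<Rightarrow> real \<Rightarrow> real" where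
  "left_lim h t = (if t \<le> 0 then h t else Lim (at_left t) h)"

definition measure_support :: "real measure \<Rightarrow> real set" where
  "measure_support \<mu> = {y. \<forall>U. open U \<and> y \<in> U \<longrightarrow> emeasure \<mu> U > 0}"

text \<open>Convergence in probability, uniformly on \<open>{0..Tm}\<close>, and of nonnegative variables to 0.
  Exceptional events are quantified explicitly because the sets \<open>{\<exists>t. \<bar>X n t - Y t\<bar> > \<epsilon>}\<close> need
  not be measurable.\<close>

definition ucp_tendsto ::
  "'a measure \<Rightarrow> real \<Rightarrow> (nat \<Rightarrow> real \<Rightarrow> 'a \<Rightarrow> real) \<Rightarrow> (real \<Rightarrow> 'a \<Rightarrow> real) \<Rightarrow> bool" where
  "ucp_tendsto M Tm X Y \<longleftrightarrow>
     (\<forall>\<epsilon>>0. \<exists>E. (\<forall>n. E n \<in> sets M) \<and> (\<lambda>n. measure M (E n)) \<longlonglongrightarrow> 0 \<and>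
        (\<forall>n. \<forall>\<omega>\<in>space M - E n. \<forall>t\<in>{0..Tm}. \<bar>X n t \<omega> - Y t \<omega>\<bar> \<le> \<epsilon>))"

definition tendsto_0_in_prob :: "'a measure \<Rightarrow> (nat \<Rightarrow> 'a \<Rightarrow> ennreal) \<Rightarrow> bool" where
  "tendsto_0_in_prob M D \<longleftrightarrow>
     (\<forall>\<epsilon>::real. \<epsilon> > 0 \<longrightarrow> (\<exists>E. (\<forall>n. E n \<in> sets M) \<and> (\<lambda>n. measure M (E n)) \<longlonglongrightarrow> 0 \<and>
        (\<forall>n. \<forall>\<omega>\<in>space M - E n. D n \<omega> \<le> ennreal \<epsilon>)))"

text \<open>The generators of the natural filtration \<open>\<sigma>{X(s) : 0 \<le> s \<le> t}\<close>.\<close>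

definition past_events :: "'a measure \<Rightarrow> (real \<Rightarrow> 'a \<Rightarrow> real) \<Rightarrow> real \<Rightarrow> 'a set set" where
  "past_events M X t = {X s -` A \<inter> space M | s A. s \<in> {0..t} \<and> A \<in> sets borel}"

definition indep_increments :: "'a measure \<Rightarrow> real \<Rightarrow> (real \<Rightarrow> 'a \<Rightarrow> real) \<Rightarrow> bool" where
  "indep_increments M Tm X \<longleftrightarrow>
     (\<forall>s t. 0 \<le> s \<and> s \<le> t \<and> t \<le> Tm \<longrightarrow>
        prob_space.indep_set M (sigma_sets (space M) (past_events M X s))
          {(\<lambda>\<omega>. X t \<omega> - X s \<omega>) -` A \<inter> space M | A. A \<in> sets borel})"

definition levy_process :: "'a measure \<Rightarrow> real \<Rightarrow> (real \<Rightarrow> 'a \<Rightarrow> real) \<Rightarrow> bool" where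
  "levy_process M Tm Z \<longleftrightarrow>
     (\<forall>t\<in>{0..Tm}. Z t \<in> borel_measurable M) \<and>
     (AE \<omega> in M. Z 0 \<omega> = 0) \<and>
     indep_increments M Tm Z \<and>
     (\<forall>s t. 0 \<le> s \<and> s \<le> t \<and> t \<le> Tm \<longrightarrow>
        distr M borel (\<lambda>\<omega>. Z t \<omega> - Z s \<omega>) = distr M borel (Z (t - s))) \<and>
     (\<forall>t\<in>{0..Tm}. \<forall>\<epsilon>>0.
        ((\<lambda>s. measure M {\<omega>\<in>space M. \<bar>Z s \<omega> - Z t \<omega>\<bar> > \<epsilon>}) \<longlongrightarrow> 0) (at t within {0..Tm})) \<and>
     (\<forall>\<omega>\<in>space M. cadlag_on Tm (\<lambda>t. Z t \<omega>))"

definition wiener_process :: "'a measure \<Rightarrow> real \<Rightarrow> (real \<Rightarrow> 'a \<Rightarrow> real) \<Rightarrow> bool" where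
  "wiener_process M Tm W \<longleftrightarrow>
     (\<forall>t\<in>{0..Tm}. W t \<in> borel_measurable M) \<and>
     (AE \<omega> in M. W 0 \<omega> = 0) \<and>
     indep_increments M Tm W \<and>
     (\<forall>s t. 0 \<le> s \<and> s < t \<and> t \<le> Tm \<longrightarrow>
        distributed M lborel (\<lambda>\<omega>. W t \<omega> - W s \<omega>) (normal_density 0 (sqrt (t - s)))) \<and>
     (AE \<omega> in M. continuous_on {0..Tm} (\<lambda>t. W t \<omega>))"


locale levy_setting = prob_space M
  for M :: "'a measure" +
  fixes Tm :: real and Z :: "real \<Rightarrow> 'a \<Rightarrow> real" and \<nu> :: "real measure"
  assumes Tm_pos: "Tm > 0"
    and levy: "levy_process M Tm Z"
begin

text \<open>The filtration generated by \<open>Z\<close>, augmented by the null events (stochastic integrals are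
  determined up to null events only); it is constant from \<open>Tm\<close> on.\<close>

definition Filt :: "real \<Rightarrow> 'a measure" where
  "Filt t = sigma (space M) (past_events M Z (min t Tm) \<union> null_sets M)"

definition jump :: "'a \<Rightarrow> real \<Rightarrow> real" where
  "jump \<omega> s = Z s \<omega> - left_lim (\<lambda>r. Z r \<omega>) s"

text \<open>The random measure \<open>N\<close> on time \<open>\<times>\<close> jump size:
  \<open>emeasure (N \<omega>) ({0..t} \<times> A)\<close> counts the \<open>s \<le> t\<close> with \<open>0 \<noteq> \<Delta>Z(s) \<in> A\<close>.\<close>

definition N :: "'a \<Rightarrow> (real \<times> real) measure" where
  "N \<omega> = distr (count_space {s\<in>{0..Tm}. jump \<omega> s \<noteq> 0}) borel (\<lambda>s. (s, jump \<omega> s))"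

definition levy_measure :: bool where
  "levy_measure \<longleftrightarrow>
     sets \<nu> = sets borel \<and> emeasure \<nu> {0} = 0 \<and>
     (\<integral>\<^sup>+x. ennreal (min (x\<^sup>2) 1) \<partial>\<nu>) < \<infinity> \<and>
     (\<forall>t\<in>{0..Tm}. \<forall>A\<in>sets borel. 0 \<notin> closure A \<longrightarrow>
        (\<integral>\<^sup>+\<omega>. emeasure (N \<omega>) ({0..t} \<times> A) \<partial>M) = ennreal t * emeasure \<nu> A)"

definition predictable_sigma :: "('a \<times> real) measure" where
  "predictable_sigma = sigma (space M \<times> {0..Tm})
     ({A \<times> {0} | A. A \<in> sets (Filt 0)} \<union>
      {A \<times> {s<..t} | A s t. 0 \<le> s \<and> s \<le> t \<and> t \<le> Tm \<and> A \<in> sets (Filt s)})"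

text \<open>Integrands are predictable up to indistinguishability; this matters only where an integrand
  involves left limits of paths that are cadlag merely almost surely.\<close>

definition Phi :: "(real \<Rightarrow> 'a \<Rightarrow> real) set" where
  "Phi = {\<phi>. (\<exists>\<phi>'. (\<lambda>(\<omega>, s). \<phi>' s \<omega>) \<in> borel_measurable predictable_sigma \<and>
                  (AE \<omega> in M. \<forall>s\<in>{0..Tm}. \<phi> s \<omega> = \<phi>' s \<omega>)) \<and>
             (AE \<omega> in M. (\<integral>\<^sup>+s\<in>{0..Tm}. ennreal ((\<phi> s \<omega>)\<^sup>2) \<partial>lborel) < \<infinity>)}"

definition Psi12 :: "(real \<Rightarrow> real \<Rightarrow> 'a \<Rightarrow> real) set" where
  "Psi12 = {\<psi>. (\<exists>\<psi>'. (\<lambda>((\<omega>, s), x). \<psi>' s x \<omega>) \<in> borel_measurable (predictable_sigma \<Otimes>\<^sub>M borel) \<and>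
                   (AE \<omega> in M. \<forall>s\<in>{0..Tm}. \<forall>x. \<psi> s x \<omega> = \<psi>' s x \<omega>)) \<and>
             (AE \<omega> in M. (\<integral>\<^sup>+s\<in>{0..Tm}.
                (\<integral>\<^sup>+x. ennreal (min ((\<psi> s x \<omega>)\<^sup>2) \<bar>\<psi> s x \<omega>\<bar>) \<partial>\<nu>) \<partial>lborel) < \<infinity>)}"

text \<open>The stochastic integrals are given as relations, the integral process being determined up to
  indistinguishability.  Against the compensated jump measure it is the limit, as jumps of size
  less than \<open>1/n\<close> are included, of the pathwise integrals (whose jump part is a finite sum);
  for \<open>\<psi> \<in> \<Psi>\<^sub>1\<^sub>,\<^sub>2\<close> this limit exists in the ucp sense.\<close>

definition compensated_trunc :: "(real \<Rightarrow> real \<Rightarrow> 'a \<Rightarrow> real) \<Rightarrow> nat \<Rightarrow> real \<Rightarrow> 'a \<Rightarrow> real" where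
  "compensated_trunc \<psi> n t \<omega> =
     (LINT p:{0..t} \<times> {x. \<bar>x\<bar> \<ge> 1 / real (Suc n)}|N \<omega>. \<psi> (fst p) (snd p) \<omega>)
     - (LINT s:{0..t}|lborel. (LINT x:{x. \<bar>x\<bar> \<ge> 1 / real (Suc n)}|\<nu>. \<psi> s x \<omega>))"

definition is_compensated_integral ::
  "(real \<Rightarrow> real \<Rightarrow> 'a \<Rightarrow> real) \<Rightarrow> (real \<Rightarrow> 'a \<Rightarrow> real) \<Rightarrow> bool" where
  "is_compensated_integral \<psi> I \<longleftrightarrow> \<psi> \<in> Psi12 \<and> ucp_tendsto M Tm (compensated_trunc \<psi>) I"

text \<open>Simple integrands \<open>\<Sum>i<n. \<xi>\<^sub>i 1\<^bsub>(\<tau>\<^sub>i, \<tau>\<^sub>i\<^sub>+\<^sub>1]\<^esub>\<close> and the Ito integral as the ucp limit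
  of their integrals.\<close>

definition simple_integrand :: "nat \<Rightarrow> (nat \<Rightarrow> real) \<Rightarrow> (nat \<Rightarrow> 'a \<Rightarrow> real) \<Rightarrow> bool" where
  "simple_integrand n \<tau> \<xi> \<longleftrightarrow>
     (\<forall>i\<le>n. \<tau> i \<in> {0..Tm}) \<and> (\<forall>i<n. \<tau> i \<le> \<tau> (Suc i)) \<and>
     (\<forall>i<n. \<xi> i \<in> borel_measurable (Filt (\<tau> i)) \<and> bounded (\<xi> i ` space M))"

definition simple_value ::
  "nat \<Rightarrow> (nat \<Rightarrow> real) \<Rightarrow> (nat \<Rightarrow> 'a \<Rightarrow> real) \<Rightarrow> real \<Rightarrow> 'a \<Rightarrow> real" where
  "simple_value n \<tau> \<xi> s \<omega> = (\<Sum>i<n. \<xi> i \<omega> * indicator {\<tau> i<..\<tau> (Suc i)} s)"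

definition simple_integral ::
  "(real \<Rightarrow> 'a \<Rightarrow> real) \<Rightarrow> nat \<Rightarrow> (nat \<Rightarrow> real) \<Rightarrow> (nat \<Rightarrow> 'a \<Rightarrow> real) \<Rightarrow> real \<Rightarrow> 'a \<Rightarrow> real" where
  "simple_integral W n \<tau> \<xi> t \<omega> =
     (\<Sum>i<n. \<xi> i \<omega> * (W (min t (\<tau> (Suc i))) \<omega> - W (min t (\<tau> i)) \<omega>))"

definition is_wiener_integral ::
  "(real \<Rightarrow> 'a \<Rightarrow> real) \<Rightarrow> (real \<Rightarrow> 'a \<Rightarrow> real) \<Rightarrow> (real \<Rightarrow> 'a \<Rightarrow> real) \<Rightarrow> bool" where
  "is_wiener_integral W \<phi> I \<longleftrightarrow> \<phi> \<in> Phi \<and>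
     (\<exists>n \<tau> \<xi>. (\<forall>k. simple_integrand (n k) (\<tau> k) (\<xi> k)) \<and>
        tendsto_0_in_prob M (\<lambda>k \<omega>. \<integral>\<^sup>+s\<in>{0..Tm}.
           ennreal ((simple_value (n k) (\<tau> k) (\<xi> k) s \<omega> - \<phi> s \<omega>)\<^sup>2) \<partial>lborel) \<and>
        ucp_tendsto M Tm (\<lambda>k. simple_integral W (n k) (\<tau> k) (\<xi> k)) I)"

text \<open>The case \<open>s = t\<close> says that \<open>X t\<close> is \<open>Filt t\<close>-measurable up to a null event.\<close>

definition is_martingale :: "(real \<Rightarrow> 'a \<Rightarrow> real) \<Rightarrow> bool" where
  "is_martingale X \<longleftrightarrow>
     (\<forall>t\<in>{0..Tm}. integrable M (X t)) \<and>
     (\<forall>s t. 0 \<le> s \<and> s \<le> t \<and> t \<le> Tm \<longrightarrow>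
        (AE \<omega> in M. real_cond_exp M (Filt s) (X t) \<omega> = X s \<omega>))"

definition is_local_martingale :: "(real \<Rightarrow> 'a \<Rightarrow> real) \<Rightarrow> bool" where
  "is_local_martingale X \<longleftrightarrow>
     (AE \<omega> in M. cadlag_on Tm (\<lambda>t. X t \<omega>)) \<and>
     (\<exists>\<tau> :: nat \<Rightarrow> 'a \<Rightarrow> real.
        (\<forall>n. stopping_time Filt (\<tau> n) \<and> (\<forall>\<omega>\<in>space M. \<tau> n \<omega> \<in> {0..Tm})) \<and>
        (AE \<omega> in M. incseq (\<lambda>n. \<tau> n \<omega>) \<and> (\<exists>n. \<tau> n \<omega> = Tm)) \<and>
        (\<forall>n. is_martingale (\<lambda>t \<omega>. X (min t (\<tau> n \<omega>)) \<omega>)))"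

end


text \<open>For \<open>b = 0\<close> the filtration generated by \<open>Z\<close> need not carry a Wiener process; the Wiener part
  is then absent, which is expressed by \<open>W = 0\<close>.\<close>

locale levy_noise = levy_setting M Tm Z \<nu>
  for M :: "'a measure" and Tm Z \<nu> +
  fixes a b :: real and W :: "real \<Rightarrow> 'a \<Rightarrow> real"
  assumes levy_measure: "levy_measure"
    and b_nonneg: "b \<ge> 0"
    and wiener: "(wiener_process M Tm W \<and> (\<forall>t\<in>{0..Tm}. W t \<in> borel_measurable (Filt t))) \<or>
                 (b = 0 \<and> (\<forall>t \<omega>. W t \<omega> = 0))"
    and levy_ito: "\<exists>I. is_compensated_integral (\<lambda>s x \<omega>. if \<bar>x\<bar> < 1 then x else 0) I \<and>
       (AE \<omega> in M. \<forall>t\<in>{0..Tm}.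
          Z t \<omega> = a * t + b * W t \<omega> + I t \<omega> + (LINT p:{0..t} \<times> {x. \<bar>x\<bar> \<ge> 1}|N \<omega>. snd p))"


text \<open>Forward rates \<open>f\<close>, bank account \<open>bank\<close>, enumeration \<open>mat\<close> of the set \<open>J\<close> of traded
  maturities.\<close>

locale bond_market_data = levy_noise M Tm Z \<nu> a b W
  for M :: "'a measure" and Tm Z \<nu> a b W +
  fixes mat :: "nat \<Rightarrow> real"
    and f \<alpha> \<sigma> :: "real \<Rightarrow> real \<Rightarrow> 'a \<Rightarrow> real"
    and \<gamma> :: "real \<Rightarrow> real \<Rightarrow> real \<Rightarrow> 'a \<Rightarrow> real"
    and bank :: "real \<Rightarrow> 'a \<Rightarrow> real"
begin

definition bond_price :: "real \<Rightarrow> real \<Rightarrow> 'a \<Rightarrow> real" where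
  "bond_price t T \<omega> = exp (- (LBINT s=ereal t..ereal T. f t s \<omega>))"

definition disc_price :: "real \<Rightarrow> real \<Rightarrow> 'a \<Rightarrow> real" where
  "disc_price t T \<omega> = bond_price t T \<omega> / bank t \<omega>"

definition disc_price_left :: "real \<Rightarrow> real \<Rightarrow> 'a \<Rightarrow> real" where
  "disc_price_left t T \<omega> = left_lim (\<lambda>s. disc_price s T \<omega>) t"

definition S :: "real \<Rightarrow> real \<Rightarrow> 'a \<Rightarrow> real" where
  "S t T \<omega> = - (LBINT s=ereal t..ereal T. \<sigma> t s \<omega>)"

definition G :: "real \<Rightarrow> real \<Rightarrow> real \<Rightarrow> 'a \<Rightarrow> real" where
  "G t x T \<omega> = - (LBINT s=ereal t..ereal T. \<gamma> t x s \<omega>)"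

text \<open>A strategy \<open>\<phi>\<close> has values \<open>\<phi> t \<omega> :: nat \<Rightarrow> real\<close> in \<open>l\<^sup>1\<close>, the \<open>j\<close>-th entry being the position
  in the bond with maturity \<open>mat j\<close>.  As \<open>l\<^sup>1\<close> is separable, predictability is componentwise.\<close>

definition strategy :: "(real \<Rightarrow> 'a \<Rightarrow> nat \<Rightarrow> real) \<Rightarrow> bool" where
  "strategy \<phi> \<longleftrightarrow>
     (\<forall>j. (\<lambda>(\<omega>, t). \<phi> t \<omega> j) \<in> borel_measurable predictable_sigma) \<and>
     (\<forall>\<omega>\<in>space M. \<forall>t\<in>{0..Tm}. summable (\<lambda>j. \<bar>\<phi> t \<omega> j\<bar>))"

definition pairing :: "(nat \<Rightarrow> real) \<Rightarrow> (nat \<Rightarrow> real) \<Rightarrow> real" where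
  "pairing u z = (\<Sum>j. u j * z j)"

definition wiener_integrand :: "(real \<Rightarrow> 'a \<Rightarrow> nat \<Rightarrow> real) \<Rightarrow> real \<Rightarrow> 'a \<Rightarrow> real" where
  "wiener_integrand \<phi> s \<omega> =
     pairing (\<phi> s \<omega>) (\<lambda>j. disc_price_left s (mat j) \<omega> * S s (mat j) \<omega>)"

definition jump_integrand :: "(real \<Rightarrow> 'a \<Rightarrow> nat \<Rightarrow> real) \<Rightarrow> real \<Rightarrow> real \<Rightarrow> 'a \<Rightarrow> real" where
  "jump_integrand \<phi> s x \<omega> =
     pairing (\<phi> s \<omega>) (\<lambda>j. disc_price_left s (mat j) \<omega> * (exp (G s x (mat j) \<omega>) - 1))"

definition price_integrable :: "(real \<Rightarrow> 'a \<Rightarrow> nat \<Rightarrow> real) \<Rightarrow> bool" where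
  "price_integrable \<phi> \<longleftrightarrow>
     strategy \<phi> \<and> wiener_integrand \<phi> \<in> Phi \<and> jump_integrand \<phi> \<in> Psi12"

definition is_price_integral :: "(real \<Rightarrow> 'a \<Rightarrow> nat \<Rightarrow> real) \<Rightarrow> (real \<Rightarrow> 'a \<Rightarrow> real) \<Rightarrow> bool" where
  "is_price_integral \<phi> V \<longleftrightarrow> price_integrable \<phi> \<and>
     (\<exists>I K. is_wiener_integral W (wiener_integrand \<phi>) I \<and>
            is_compensated_integral (jump_integrand \<phi>) K \<and>
            (AE \<omega> in M. \<forall>t\<in>{0..Tm}. V t \<omega> = I t \<omega> + K t \<omega>))"

text \<open>\<open>\<phi>\<close> is admissible if its integral process, i.e. a version \<open>V\<close> of it, is a martingale.\<close>

definition replicable :: "('a \<Rightarrow> real) \<Rightarrow> bool" where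
  "replicable X \<longleftrightarrow>
     (\<exists>x \<phi> V. is_price_integral \<phi> V \<and> is_martingale V \<and> (AE \<omega> in M. X \<omega> = x + V Tm \<omega>))"

definition L2_complete :: bool where
  "L2_complete \<longleftrightarrow>
     (\<forall>X. X \<in> borel_measurable (Filt Tm) \<and> integrable M (\<lambda>\<omega>. (X \<omega>)\<^sup>2) \<longrightarrow> replicable X)"

end


locale bond_market = bond_market_data M Tm Z \<nu> a b W mat f \<alpha> \<sigma> \<gamma> bank
  for M :: "'a measure" and Tm Z \<nu> a b W mat f \<alpha> \<sigma> \<gamma> bank +
  assumes mat: "range mat \<subseteq> {0..Tm}" "{0..Tm} \<subseteq> closure (range mat)"
    and predictable_coeffs:
      "(\<lambda>((\<omega>, t), T). \<alpha> t T \<omega>) \<in> borel_measurable (predictable_sigma \<Otimes>\<^sub>M restrict_space borel {0..Tm})"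
      "(\<lambda>((\<omega>, t), T). \<sigma> t T \<omega>) \<in> borel_measurable (predictable_sigma \<Otimes>\<^sub>M restrict_space borel {0..Tm})"
      "(\<lambda>(((\<omega>, t), x), T). \<gamma> t x T \<omega>) \<in>
         borel_measurable ((predictable_sigma \<Otimes>\<^sub>M borel) \<Otimes>\<^sub>M restrict_space borel {0..Tm})"
    and integrable_coeffs:
      "AE \<omega> in M. (\<integral>\<^sup>+t\<in>{0..Tm}. (\<integral>\<^sup>+T\<in>{0..Tm}. ennreal \<bar>\<alpha> t T \<omega>\<bar> \<partial>lborel) \<partial>lborel) < \<infinity>"
      "AE \<omega> in M. (\<integral>\<^sup>+t\<in>{0..Tm}. (\<integral>\<^sup>+T\<in>{0..Tm}. ennreal ((\<sigma> t T \<omega>)\<^sup>2) \<partial>lborel) \<partial>lborel) < \<infinity>"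
      "AE \<omega> in M. (\<integral>\<^sup>+t\<in>{0..Tm}. (\<integral>\<^sup>+T\<in>{0..Tm}.
          (\<integral>\<^sup>+x. ennreal \<bar>\<gamma> t x T \<omega>\<bar> \<partial>\<nu>) \<partial>lborel) \<partial>lborel) < \<infinity>"
    and coeffs_after_maturity:
      "\<And>t T x \<omega>. \<omega> \<in> space M \<Longrightarrow> 0 \<le> T \<Longrightarrow> T < t \<Longrightarrow> t \<le> Tm \<Longrightarrow>
         \<alpha> t T \<omega> = 0 \<and> \<sigma> t T \<omega> = 0 \<and> \<gamma> t x T \<omega> = 0"
    and forward_rate_adapted:
      "\<And>t T. t \<in> {0..Tm} \<Longrightarrow> T \<in> {0..Tm} \<Longrightarrow> f t T \<in> borel_measurable (Filt t)"
    and forward_rate: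
      "\<And>T. T \<in> {0..Tm} \<Longrightarrow> \<exists>I. is_wiener_integral W (\<lambda>s. \<sigma> s T) I \<and>
         (AE \<omega> in M. set_integrable lborel {0..Tm} (\<lambda>s. \<alpha> s T \<omega>) \<and>
            set_integrable (N \<omega>) ({0..Tm} \<times> UNIV) (\<lambda>p. \<gamma> (fst p) (snd p) T \<omega>) \<and>
            (\<forall>t\<in>{0..Tm}. f t T \<omega> = f 0 T \<omega> + (LINT s:{0..t}|lborel. \<alpha> s T \<omega>) + I t \<omega>
               + (LINT p:{0..t} \<times> UNIV|N \<omega>. \<gamma> (fst p) (snd p) T \<omega>)))"
    and forward_curve_integrable:
      "AE \<omega> in M. \<forall>t\<in>{0..Tm}. set_integrable lborel {0..Tm} (\<lambda>s. f t s \<omega>)"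
    and bank_adapted: "\<And>t. t \<in> {0..Tm} \<Longrightarrow> bank t \<in> borel_measurable (Filt t)"
    and bank_account:
      "AE \<omega> in M. bank 0 \<omega> > 0 \<and>
         set_integrable lborel {0..Tm} (\<lambda>s. f s s \<omega> * bank s \<omega>) \<and>
         (\<forall>t\<in>{0..Tm}. bank t \<omega> = bank 0 \<omega> + (LINT s:{0..t}|lborel. f s s \<omega> * bank s \<omega>))"
    and martingale_measure:
      "\<And>T. T \<in> {0..Tm} \<Longrightarrow> is_local_martingale (\<lambda>t. disc_price t T)"
    \<comment> \<open>the sequences paired with strategies are elements of the Banach space of bounded sequences\<close>
    and bounded_sequences:
      "AE \<omega> in M. AE t in lborel. t \<in> {0..Tm} \<longrightarrow>
         bounded (range (\<lambda>i. disc_price_left t (mat i) \<omega>)) \<and>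
         bounded (range (\<lambda>i. S t (mat i) \<omega>)) \<and>
         (AE x in \<nu>. bounded (range (\<lambda>i. exp (G t x (mat i) \<omega>) - 1)))"

end

(*
  Take h(y) = exp ((Gtilde + eps) |y|) and let X be the sum of h over all jump sizes of Z.  The
  exponential moment makes X square integrable, and E(X | F_t) is the sum of h over the jumps up
  to time t plus a deterministic linear function of t.  If a strategy replicated X, its integral
  would be this martingale; its Wiener part and its compensator are continuous, so comparing jumps
  shows that the jump integrand equals h(jump size) at every jump time.  By the compensation
  formula it then equals h(x_i) for every i and almost every (omega, t).  On the set A, however, a
  pairing of an l1 strategy with bounded prices grows at most like exp (Gtilde |x_i|), a
  contradiction as |x_i| tends to infinity.
*)

theory Submission
  imports Defs
begin

section \<open>Jumps of cadlag paths\<close>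

text \<open>The process is given only through its increments and the mean of \<open>N\<close>, so
  facts about jumps are drawn from one pathwise limit: for a continuous function vanishing near 0,
  its sums over the increments along fine grids converge to its sum over the jumps. Measurability of
  jump sums and their independence of the past follow from this limit, without Poisson theory. For
  its sake the exponential is cut off near 0. This changes no value at an atom: the atoms differ
  from 0 and tend to infinity in absolute value, hence stay away from 0. For the same reason
  \<open>\<nu>\<close> is finite and almost every path has finitely many jumps, so small jumps never
  enter the compensated integrals. The exponent of the test function meets two demands: it exceeds
  \<open>Gtilde\<close>, to outgrow the pairing, and twice it is the order of the given moment. A
  martingale is determined only almost surely at each fixed time; the comparison of jumps is
  therefore made at countably many times, which suffices because the difference to be tested is a
  continuous function plus finitely many steps.\<close>

abbreviation path_jump :: "(real \<Rightarrow> real) \<Rightarrow> real \<Rightarrow> real" where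
  "path_jump h r \<equiv> h r - left_lim h r"

lemma cadlag_left_lim:
  assumes "cadlag_on Tm h" "0 < r" "r \<le> Tm"
  shows "(h \<longlongrightarrow> left_lim h r) (at_left r)"
proof -
  obtain l where l: "(h \<longlongrightarrow> l) (at_left r)"
    using assms unfolding cadlag_on_def by (meson greaterThanAtMost_iff)
  then have "Lim (at_left r) h = l"
    by (intro tendsto_Lim) (auto simp: trivial_limit_at_left_real)
  then show ?thesis using l assms by (simp add: left_lim_def)
qed

lemma path_jump_bound:
  assumes "cadlag_on Tm h" "0 \<le> u" "u < q" "q \<le> Tm" "\<And>p. p \<in> {u<..q} \<Longrightarrow> \<bar>h p - c\<bar> < \<kappa>"
  shows "\<bar>path_jump h q\<bar> \<le> 2 * \<kappa>"
proof -
  have "(h \<longlongrightarrow> left_lim h q) (at_left q)" using assms by (intro cadlag_left_lim) auto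
  then have l: "((\<lambda>p. \<bar>h p - c\<bar>) \<longlongrightarrow> \<bar>left_lim h q - c\<bar>) (at_left q)"
    by (intro tendsto_intros)
  have ev: "eventually (\<lambda>p. \<bar>h p - c\<bar> \<le> \<kappa>) (at_left q)"
    unfolding eventually_at_left_field using assms by (intro exI[of _ u]) (auto intro: less_imp_le)
  have "\<bar>left_lim h q - c\<bar> \<le> \<kappa>"
    by (rule tendsto_upperbound[OF l ev]) (auto simp: trivial_limit_at_left_real)
  moreover have "\<bar>h q - c\<bar> < \<kappa>" using assms by auto
  ultimately show ?thesis by linarith
qed

text \<open>On a short enough interval at most one jump matters, and it accounts for the whole
  increment up to \<open>\<eta>\<close>. Every time has a neighbourhood in which the path is close
  to its value on the right and to its left limit on the left; compactness yields one length
  \<open>\<rho>\<close> such that any shorter interval fits into one of these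
  neighbourhoods.\<close>

lemma cadlag_modulus:
  assumes cad: "cadlag_on Tm h" and "\<eta> > 0" and "Tm > 0"
  obtains \<rho> where "\<rho> > 0"
    "\<And>u v. 0 \<le> u \<Longrightarrow> u < v \<Longrightarrow> v \<le> Tm \<Longrightarrow> v - u < \<rho> \<Longrightarrow>
      \<exists>r\<in>{u<..v}. \<bar>h v - h u - path_jump h r\<bar> < \<eta> \<and> (\<forall>q\<in>{u<..v}. q \<noteq> r \<longrightarrow> \<bar>path_jump h q\<bar> < \<eta>)"
proof -
  \<comment> \<open>Two endpoint errors below \<open>\<kappa>\<close> and one jump of at most
    \<open>2 * \<kappa>\<close> give less than \<open>4 * \<kappa>\<close>; a fifth leaves
    slack.\<close>
  define \<kappa> where "\<kappa> = \<eta> / 5"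
  have \<kappa>: "\<kappa> > 0" using assms by (simp add: \<kappa>_def)
  have "\<exists>e>0. (\<forall>q\<in>{0..Tm}. r \<le> q \<and> q < r + e \<longrightarrow> \<bar>h q - h r\<bar> < \<kappa>) \<and>
              (\<forall>q\<in>{0..Tm}. r - e < q \<and> q < r \<longrightarrow> \<bar>h q - left_lim h r\<bar> < \<kappa>)" if r: "r \<in> {0..Tm}" for r
  proof -
    have "\<exists>e>0. \<forall>q\<in>{0..Tm}. r \<le> q \<and> q < r + e \<longrightarrow> \<bar>h q - h r\<bar> < \<kappa>"
    proof (cases "r < Tm")
      case True
      then have "(h \<longlongrightarrow> h r) (at_right r)" using cad r by (auto simp: cadlag_on_def)
      then have "eventually (\<lambda>q. dist (h q) (h r) < \<kappa>) (at_right r)" using \<kappa> by (rule tendstoD)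
      then obtain b where "b > r" "\<And>q. r < q \<Longrightarrow> q < b \<Longrightarrow> dist (h q) (h r) < \<kappa>"
        unfolding eventually_at_right_field by auto
      then show ?thesis using \<kappa>
        by (intro exI[of _ "b - r"]) (auto simp: dist_real_def le_less)
    next
      case False
      then show ?thesis using \<kappa> r by (intro exI[of _ 1]) auto
    qed
    then obtain e1 where e1: "e1 > 0" "\<forall>q\<in>{0..Tm}. r \<le> q \<and> q < r + e1 \<longrightarrow> \<bar>h q - h r\<bar> < \<kappa>" by blast
    have "\<exists>e>0. \<forall>q\<in>{0..Tm}. r - e < q \<and> q < r \<longrightarrow> \<bar>h q - left_lim h r\<bar> < \<kappa>"
    proof (cases "r > 0")
      case True
      then have "(h \<longlongrightarrow> left_lim h r) (at_left r)" using cad r by (intro cadlag_left_lim) auto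
      then have "eventually (\<lambda>q. dist (h q) (left_lim h r) < \<kappa>) (at_left r)" using \<kappa> by (rule tendstoD)
      then obtain b where "b < r" "\<And>q. b < q \<Longrightarrow> q < r \<Longrightarrow> dist (h q) (left_lim h r) < \<kappa>"
        unfolding eventually_at_left_field by auto
      then show ?thesis using \<kappa>
        by (intro exI[of _ "r - b"]) (auto simp: dist_real_def)
    next
      case False
      then show ?thesis using \<kappa> r by (intro exI[of _ 1]) auto
    qed
    then obtain e2 where e2: "e2 > 0" "\<forall>q\<in>{0..Tm}. r - e2 < q \<and> q < r \<longrightarrow> \<bar>h q - left_lim h r\<bar> < \<kappa>" by blast
    show ?thesis using e1 e2 by (intro exI[of _ "min e1 e2"]) auto
  qed
  then obtain e where e: "\<And>r. r \<in> {0..Tm} \<Longrightarrow> e r > 0"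
    "\<And>r q. r \<in> {0..Tm} \<Longrightarrow> q \<in> {0..Tm} \<Longrightarrow> r \<le> q \<Longrightarrow> q < r + e r \<Longrightarrow> \<bar>h q - h r\<bar> < \<kappa>"
    "\<And>r q. r \<in> {0..Tm} \<Longrightarrow> q \<in> {0..Tm} \<Longrightarrow> r - e r < q \<Longrightarrow> q < r \<Longrightarrow> \<bar>h q - left_lim h r\<bar> < \<kappa>"
    by metis
  have cov: "{0..Tm} \<subseteq> \<Union>((\<lambda>r. ball r (e r)) ` {0..Tm})"
    using e(1) by force
  obtain \<rho> where \<rho>: "\<rho> > 0" "\<And>u. u \<in> {0..Tm} \<Longrightarrow> \<exists>G\<in>(\<lambda>r. ball r (e r)) ` {0..Tm}. ball u \<rho> \<subseteq> G"
    by (rule Heine_Borel_lemma[OF compact_Icc cov]) auto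
  show ?thesis
  proof (rule that[OF \<rho>(1)])
    fix u v assume uv: "0 \<le> u" "u < v" "v \<le> Tm" "v - u < \<rho>"
    obtain r where r: "r \<in> {0..Tm}" "ball u \<rho> \<subseteq> ball r (e r)"
      using \<rho>(2)[of u] uv by auto
    have "u \<in> ball u \<rho>" "v \<in> ball u \<rho>" using uv \<rho>(1) by (auto simp: dist_real_def)
    then have ub: "\<bar>r - u\<bar> < e r" and vb: "\<bar>r - v\<bar> < e r"
      using r by (auto simp: dist_real_def subset_iff)
    \<comment> \<open>If the interval lies on one side of the centre, the path is close to a single
      constant on it. Then all jumps there are small and any point serves as \<open>r\<close>; the
      choice is \<open>v\<close>.\<close>
    have same: "\<exists>r\<in>{u<..v}. \<bar>h v - h u - path_jump h r\<bar> < \<eta> \<and> (\<forall>q\<in>{u<..v}. q \<noteq> r \<longrightarrow> \<bar>path_jump h q\<bar> < \<eta>)"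
      if c: "\<And>p. p \<in> {u..v} \<Longrightarrow> \<bar>h p - c\<bar> < \<kappa>" for c
    proof -
      have j: "\<bar>path_jump h q\<bar> \<le> 2 * \<kappa>" if "q \<in> {u<..v}" for q
        using that uv c by (intro path_jump_bound[OF cad, of u q c \<kappa>]) auto
      have "\<bar>h v - c\<bar> < \<kappa>" "\<bar>h u - c\<bar> < \<kappa>" using c uv by auto
      moreover have "\<bar>path_jump h v\<bar> \<le> 2 * \<kappa>" using uv by (intro j) auto
      ultimately have "\<bar>h v - h u - path_jump h v\<bar> < 5 * \<kappa>" using \<kappa> by linarith
      then have "\<bar>h v - h u - path_jump h v\<bar> < \<eta>" unfolding \<kappa>_def by simp
      moreover have "\<bar>path_jump h q\<bar> < \<eta>" if "q \<in> {u<..v}" for q using j[OF that] \<kappa> by (simp add: \<kappa>_def)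
      ultimately show ?thesis using uv by (intro bexI[of _ v]) auto
    qed
    consider "r \<le> u" | "v < r" | "u < r" "r \<le> v" by linarith
    then show "\<exists>r\<in>{u<..v}. \<bar>h v - h u - path_jump h r\<bar> < \<eta> \<and> (\<forall>q\<in>{u<..v}. q \<noteq> r \<longrightarrow> \<bar>path_jump h q\<bar> < \<eta>)"
    proof cases
      case 1
      show ?thesis using 1 uv r(1) vb by (intro same[of "h r"] e(2)) auto
    next
      case 2
      show ?thesis using 2 uv r(1) ub by (intro same[of "left_lim h r"] e(3)) auto
    next
      case 3
      have "\<bar>h v - h r\<bar> < \<kappa>" using 3 uv r(1) vb by (intro e(2)) auto
      moreover have "\<bar>h u - left_lim h r\<bar> < \<kappa>" using 3 uv r(1) ub by (intro e(3)) auto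
      ultimately have "\<bar>h v - h u - path_jump h r\<bar> < 5 * \<kappa>" using \<kappa> by linarith
      then have "\<bar>h v - h u - path_jump h r\<bar> < \<eta>" unfolding \<kappa>_def by simp
      moreover have "\<bar>path_jump h q\<bar> < \<eta>" if q: "q \<in> {u<..v}" "q \<noteq> r" for q
      proof (cases "q < r")
        case True
        have "\<bar>path_jump h q\<bar> \<le> 2 * \<kappa>"
          using q True uv r(1) ub
          by (intro path_jump_bound[OF cad, of u q "left_lim h r"] e(3)) auto
        then show ?thesis using \<kappa> by (simp add: \<kappa>_def)
      next
        case False
        have "\<bar>path_jump h q\<bar> \<le> 2 * \<kappa>"
          using q False uv r(1) vb
          by (intro path_jump_bound[OF cad, of r q "h r"] e(2)) auto
        then show ?thesis using \<kappa> by (simp add: \<kappa>_def)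
      qed
      ultimately show ?thesis using 3 by (intro bexI[of _ r]) auto
    qed
  qed
qed

section \<open>Uniform grids with \<open>Suc n\<close> blocks\<close>

definition grid :: "real \<Rightarrow> real \<Rightarrow> nat \<Rightarrow> nat \<Rightarrow> real" where
  "grid s t n k = s + (t - s) * real k / real (Suc n)"

lemma grid_0 [simp]: "grid s t n 0 = s"
  by (simp add: grid_def)

lemma grid_last [simp]: "grid s t n (Suc n) = t"
proof -
  have "(t - s) * real (Suc n) / real (Suc n) = t - s" by (rule nonzero_mult_div_cancel_right) simp
  then show ?thesis unfolding grid_def by (simp only: add.commute diff_add_cancel)
qed

lemma grid_diff: "grid s t n (Suc k) - grid s t n k = (t - s) / real (Suc n)"
proof -
  have "grid s t n (Suc k) - grid s t n k = (t - s) * (real (Suc k) - real k) / real (Suc n)"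
    unfolding grid_def right_diff_distrib diff_divide_distrib by linarith
  then show ?thesis by simp
qed

lemma grid_mono: "s \<le> t \<Longrightarrow> i \<le> j \<Longrightarrow> grid s t n i \<le> grid s t n j"
  by (auto simp: grid_def intro!: divide_right_mono mult_left_mono)

lemma grid_less: "s < t \<Longrightarrow> grid s t n k < grid s t n (Suc k)"
  using grid_diff[of s t n k] by (smt (verit) divide_pos_pos of_nat_0_less_iff zero_less_Suc)

lemma grid_range: "s \<le> t \<Longrightarrow> k \<le> Suc n \<Longrightarrow> s \<le> grid s t n k \<and> grid s t n k \<le> t"
  using grid_mono[of s t 0 k n] grid_mono[of s t k "Suc n" n] by simp

lemma grid_mesh_small:
  assumes "\<rho> > 0"
  shows "eventually (\<lambda>n. \<forall>k. grid s t n (Suc k) - grid s t n k < \<rho>) sequentially"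
proof -
  have "(\<lambda>n. (t - s) / real (Suc n)) \<longlonglongrightarrow> 0" by (intro LIMSEQ_Suc[OF lim_const_over_n])
  then have "eventually (\<lambda>n. (t - s) / real (Suc n) < \<rho>) sequentially"
    using assms by (rule order_tendstoD)
  then show ?thesis by (simp only: grid_diff) simp
qed

lemma sum_blocks:
  fixes p :: "nat \<Rightarrow> 'b::linorder" and f :: "'b \<Rightarrow> 'c::comm_monoid_add"
  assumes "finite E" "\<And>k. k < m \<Longrightarrow> p k \<le> p (Suc k)"
  shows "(\<Sum>k<m. \<Sum>r\<in>E \<inter> {p k<..p (Suc k)}. f r) = (\<Sum>r\<in>E \<inter> {p 0<..p m}. f r)"
  using assms(2)
proof (induction m)
  case (Suc m)
  note step = Suc.prems
  have "p 0 \<le> p j" if "j \<le> m" for j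
    using that
  proof (induction j)
    case (Suc i)
    then show ?case using step[of i] order_trans[of "p 0" "p i" "p (Suc i)"] by simp
  qed simp
  then have "p 0 \<le> p m" by simp
  then have "E \<inter> {p 0<..p (Suc m)} = (E \<inter> {p 0<..p m}) \<union> (E \<inter> {p m<..p (Suc m)})"
    using Suc.prems[of m] by auto
  moreover have "(\<Sum>r\<in>(E \<inter> {p 0<..p m}) \<union> (E \<inter> {p m<..p (Suc m)}). f r) =
      (\<Sum>r\<in>E \<inter> {p 0<..p m}. f r) + (\<Sum>r\<in>E \<inter> {p m<..p (Suc m)}. f r)"
    using assms(1) by (intro sum.union_disjoint) auto
  ultimately show ?case using Suc by simp
qed simp

text \<open>A grid finer than the modulus has finitely many blocks, and each block contains at most
  one jump of size \<open>\<eta>\<close> or more.\<close>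

lemma finite_big_jumps:
  assumes "cadlag_on Tm h" and "\<eta> > 0" and "Tm > 0"
  shows "finite {r\<in>{0<..Tm}. \<bar>path_jump h r\<bar> \<ge> \<eta>}"
proof -
  obtain \<rho> where \<rho>: "\<rho> > 0"
    "\<And>u v. 0 \<le> u \<Longrightarrow> u < v \<Longrightarrow> v \<le> Tm \<Longrightarrow> v - u < \<rho> \<Longrightarrow>
      \<exists>r\<in>{u<..v}. \<bar>h v - h u - path_jump h r\<bar> < \<eta> \<and> (\<forall>q\<in>{u<..v}. q \<noteq> r \<longrightarrow> \<bar>path_jump h q\<bar> < \<eta>)"
    using cadlag_modulus[OF assms] by blast
  obtain n where n: "\<And>k. grid 0 Tm n (Suc k) - grid 0 Tm n k < \<rho>"
    using eventually_happens'[OF sequentially_bot grid_mesh_small[OF \<rho>(1), of 0 Tm]] by auto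
  let ?p = "grid 0 Tm n" and ?E = "{r\<in>{0<..Tm}. \<bar>path_jump h r\<bar> \<ge> \<eta>}"
  have fin: "finite (?E \<inter> {0<..?p m})" if "m \<le> Suc n" for m
    using that
  proof (induction m)
    case (Suc m)
    have "0 \<le> ?p m" "?p m < ?p (Suc m)" "?p (Suc m) \<le> Tm"
      using Suc.prems grid_range[of 0 Tm m n] grid_range[of 0 Tm "Suc m" n] assms(3) grid_less[of 0 Tm n m] by simp_all
    from \<rho>(2)[OF this n] have "\<exists>r. \<forall>q\<in>{?p m<..?p (Suc m)}. q \<noteq> r \<longrightarrow> \<bar>path_jump h q\<bar> < \<eta>"
      by blast
    then obtain r where "\<forall>q\<in>{?p m<..?p (Suc m)}. q \<noteq> r \<longrightarrow> \<bar>path_jump h q\<bar> < \<eta>" by blast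
    then have "?E \<inter> {0<..?p (Suc m)} \<subseteq> insert r (?E \<inter> {0<..?p m})"
      by force
    then show ?case using Suc by (meson Suc_leD finite.insertI finite_subset)
  qed simp
  have "?E \<inter> {0<..?p (Suc n)} = ?E" by auto
  with fin[of "Suc n"] show ?thesis by simp
qed

text \<open>The filter on nonzero summands keeps the index set finite for functions vanishing near
  0; \<open>sum\<close> over the whole interval, an infinite set, would be 0 by convention.
  Half-open intervals make the sum additive in time.\<close>

definition jump_sum :: "(real \<Rightarrow> real) \<Rightarrow> (real \<Rightarrow> real) \<Rightarrow> real \<Rightarrow> real \<Rightarrow> real" where
  "jump_sum g h s t = (\<Sum>r\<in>{r\<in>{s<..t}. g (path_jump h r) \<noteq> 0}. g (path_jump h r))"

lemma jump_sum_eq: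
  assumes "finite E" "\<And>r. r \<in> {s<..t} \<Longrightarrow> g (path_jump h r) \<noteq> 0 \<Longrightarrow> r \<in> E"
  shows "jump_sum g h s t = (\<Sum>r\<in>E \<inter> {s<..t}. g (path_jump h r))"
  unfolding jump_sum_def using assms by (intro sum.mono_neutral_left) auto

text \<open>This is the bridge from increments to jumps. On a fine grid each increment is close to
  the only jump in its block that can be large. If that jump is small, \<open>g\<close> vanishes at
  the increment; the other blocks number at most \<open>card E\<close>, and continuity of
  \<open>g\<close> at finitely many points controls their errors.\<close>

lemma jump_sum_limit:
  assumes cad: "cadlag_on Tm h" and Tm: "Tm > 0" and st: "0 \<le> s" "s \<le> t" "t \<le> Tm"
    and g: "continuous_on UNIV g" and \<delta>: "\<delta> > 0" "\<And>y. \<bar>y\<bar> < \<delta> \<Longrightarrow> g y = 0"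
  shows "(\<lambda>n. \<Sum>k<Suc n. g (h (grid s t n (Suc k)) - h (grid s t n k))) \<longlonglongrightarrow> jump_sum g h s t"
proof (cases "s = t")
  case True
  then show ?thesis using \<delta> by (simp add: grid_def jump_sum_def)
next
  case False
  with st have st': "s < t" by simp
  \<comment> \<open>Half of \<open>\<delta>\<close> leaves room for the approximation error: a jump
    below \<open>\<delta> / 2\<close> and an error below \<open>\<eta> \<le> \<delta> / 2\<close>
    keep the increment where \<open>g\<close> is 0.\<close>
  define E where "E = {r\<in>{0<..Tm}. \<bar>path_jump h r\<bar> \<ge> \<delta> / 2}"
  have finE: "finite E" unfolding E_def using assms by (intro finite_big_jumps) auto
  have inE: "r \<in> E" if "r \<in> {0<..Tm}" "\<bar>path_jump h r\<bar> \<ge> \<delta> / 2" for r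
    using that by (auto simp: E_def)
  have js: "jump_sum g h s t = (\<Sum>r\<in>E \<inter> {s<..t}. g (path_jump h r))"
    using finE \<delta> st by (intro jump_sum_eq) (force simp: E_def)+
  show ?thesis
  proof (rule LIMSEQ_I)
    fix e :: real assume e: "e > 0"
    \<comment> \<open>The added 1 covers an empty \<open>E\<close> and keeps the final inequality
      strict.\<close>
    define e' where "e' = e / (real (card E) + 1)"
    have e': "e' > 0" using e by (simp add: e'_def add_nonneg_pos)
    have "\<exists>\<kappa>>0. \<forall>y. \<bar>y - path_jump h r\<bar> < \<kappa> \<longrightarrow> \<bar>g y - g (path_jump h r)\<bar> < e'" for r
      using g e' unfolding continuous_on_iff by (auto simp: dist_real_def)
    then obtain K where K: "\<And>r. K r > 0"
      "\<And>r y. \<bar>y - path_jump h r\<bar> < K r \<Longrightarrow> \<bar>g y - g (path_jump h r)\<bar> < e'" by metis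
    define \<eta> where "\<eta> = Min (insert (\<delta>/2) (K ` E))"
    have \<eta>: "\<eta> > 0" "\<eta> \<le> \<delta> / 2" "\<And>r. r \<in> E \<Longrightarrow> \<eta> \<le> K r"
    proof -
      show "\<eta> > 0" unfolding \<eta>_def using finE K(1) \<delta>(1) by simp
      show "\<eta> \<le> \<delta> / 2" unfolding \<eta>_def using finE by (intro Min_le) auto
      show "\<eta> \<le> K r" if "r \<in> E" for r unfolding \<eta>_def using finE that by (intro Min_le) auto
    qed
    obtain \<rho> where \<rho>: "\<rho> > 0"
      "\<And>u v. 0 \<le> u \<Longrightarrow> u < v \<Longrightarrow> v \<le> Tm \<Longrightarrow> v - u < \<rho> \<Longrightarrow>
      \<exists>r\<in>{u<..v}. \<bar>h v - h u - path_jump h r\<bar> < \<eta> \<and> (\<forall>q\<in>{u<..v}. q \<noteq> r \<longrightarrow> \<bar>path_jump h q\<bar> < \<eta>)"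
      using cadlag_modulus[OF cad \<eta>(1) Tm] by blast
    have "norm ((\<Sum>k<Suc n. g (h (grid s t n (Suc k)) - h (grid s t n k))) - jump_sum g h s t) < e"
      if n: "\<And>k. grid s t n (Suc k) - grid s t n k < \<rho>" for n
    proof -
      let ?p = "grid s t n"
      have one: "\<bar>g (h (?p (Suc k)) - h (?p k)) - (\<Sum>r\<in>E \<inter> {?p k<..?p (Suc k)}. g (path_jump h r))\<bar>
         \<le> (\<Sum>r\<in>E \<inter> {?p k<..?p (Suc k)}. e')" if k: "k < Suc n" for k
      proof -
        have pk: "0 \<le> ?p k" "?p k < ?p (Suc k)" "?p (Suc k) \<le> Tm"
          using grid_range[of s t k n] grid_range[of s t "Suc k" n] k st grid_less[OF st', of n k] by auto
        obtain r where r: "r\<in>{?p k<..?p (Suc k)}" "\<bar>h (?p (Suc k)) - h (?p k) - path_jump h r\<bar> < \<eta>"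
          "\<And>q. q\<in>{?p k<..?p (Suc k)} \<Longrightarrow> q \<noteq> r \<Longrightarrow> \<bar>path_jump h q\<bar> < \<eta>"
          using \<rho>(2)[OF pk n] by blast
        show ?thesis
        proof (cases "r \<in> E")
          case True
          have "q = r" if "q \<in> E \<inter> {?p k<..?p (Suc k)}" for q
            using r(3)[of q] \<eta>(2) that by (cases "q = r") (auto simp: E_def)
          then have "E \<inter> {?p k<..?p (Suc k)} = {r}" using True r(1) by blast
          then show ?thesis using K(2)[of "h (?p (Suc k)) - h (?p k)" r] \<eta>(3)[OF True] r(2) by simp
        next
          case False
          have "q = r" if "q \<in> E \<inter> {?p k<..?p (Suc k)}" for q
            using r(3)[of q] \<eta>(2) that by (cases "q = r") (auto simp: E_def)
          then have "E \<inter> {?p k<..?p (Suc k)} = {}" using False by blast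
          moreover have "\<bar>path_jump h r\<bar> < \<delta>/2" using False inE[of r] r(1) pk by force
          then have "g (h (?p (Suc k)) - h (?p k)) = 0" using r(2) \<eta>(2) by (intro \<delta>(2)) linarith
          ultimately show ?thesis by simp
        qed
      qed
      have bl: "(\<Sum>k<Suc n. \<Sum>r\<in>E \<inter> {?p k<..?p (Suc k)}. f r) = (\<Sum>r\<in>E \<inter> {s<..t}. f r)" for f :: "real \<Rightarrow> real"
        using sum_blocks[OF finE, of "Suc n" ?p f] grid_mono[of s t] st by simp
      have "\<bar>(\<Sum>k<Suc n. g (h (?p (Suc k)) - h (?p k))) - jump_sum g h s t\<bar> =
          \<bar>\<Sum>k<Suc n. g (h (?p (Suc k)) - h (?p k)) - (\<Sum>r\<in>E \<inter> {?p k<..?p (Suc k)}. g (path_jump h r))\<bar>"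
        unfolding js sum_subtractf bl ..
      also have "\<dots> \<le> (\<Sum>k<Suc n. \<Sum>r\<in>E \<inter> {?p k<..?p (Suc k)}. e')"
        by (rule order_trans[OF sum_abs]) (intro sum_mono one, simp)
      also have "\<dots> = real (card (E \<inter> {s<..t})) * e'" unfolding bl by simp
      also have "\<dots> \<le> real (card E) * e'" using e' finE by (intro mult_right_mono) (auto intro!: card_mono)
      also have "\<dots> < e" using e by (simp add: e'_def divide_simps)
      finally show ?thesis by simp
    qed
    then show "\<exists>no. \<forall>n\<ge>no. norm ((\<Sum>k<Suc n. g (h (grid s t n (Suc k)) - h (grid s t n k))) - jump_sum g h s t) < e"
      using grid_mesh_small[OF \<rho>(1), of s t] unfolding eventually_sequentially by meson
  qed
qed

text \<open>Between a time just before \<open>d\<close> and one at or just after \<open>d\<close>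
  the step part changes by exactly \<open>a d\<close>, while the continuous part hardly changes.
  Rational times are enough for this, except that a step at \<open>Tm\<close> can only be seen at
  \<open>Tm\<close> itself; hence the form of \<open>zero\<close>, which fits identities known
  almost surely at each of countably many times.\<close>

lemma continuous_part_no_jumps:
  fixes C :: "real \<Rightarrow> real"
  assumes C: "continuous_on {0..Tm} C" and D: "finite D" "D \<subseteq> {0<..Tm}"
    and zero: "\<And>t. t \<in> {0..Tm} \<Longrightarrow> t \<in> \<rat> \<or> t = Tm \<Longrightarrow> C t + (\<Sum>r\<in>D \<inter> {0<..t}. a r) = 0"
    and d: "d \<in> D"
  shows "a d = 0"
proof (rule ccontr)
  assume nz: "a d \<noteq> 0"
  have dd: "0 < d" "d \<le> Tm" using d D by auto
  obtain e where e: "e > 0" "\<And>q. q \<in> {0..Tm} \<Longrightarrow> \<bar>q - d\<bar> < e \<Longrightarrow> \<bar>C q - C d\<bar> < \<bar>a d\<bar> / 2"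
    using C dd nz unfolding continuous_on_iff dist_real_def
    by (metis atLeastAtMost_iff half_gt_zero less_imp_le zero_less_abs_iff)
  \<comment> \<open>Within distance \<open>m\<close> of \<open>d\<close> there is no other step, and
    \<open>C\<close> is still within half of the step height.\<close>
  define m where "m = Min (insert e ((\<lambda>r. \<bar>r - d\<bar>) ` (D - {d})))"
  have m: "m > 0" "m \<le> e" "\<And>r. r \<in> D \<Longrightarrow> r \<noteq> d \<Longrightarrow> m \<le> \<bar>r - d\<bar>"
    using e D by (auto simp: m_def)
  obtain u where u: "u \<in> \<rat>" "max 0 (d - m) < u" "u < d"
    using Rats_dense_in_real[of "max 0 (d - m)" d] dd m by auto
  obtain v where v: "v \<in> \<rat> \<or> v = Tm" "d \<le> v" "v < d + m" "v \<le> Tm"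
  proof (cases "d = Tm")
    case True
    then show ?thesis using that[of Tm] m by auto
  next
    case False
    then obtain v where "v \<in> \<rat>" "d < v" "v < min (d + m) Tm"
      using Rats_dense_in_real[of d "min (d + m) Tm"] dd m by auto
    then show ?thesis using that[of v] by auto
  qed
  have uv: "D \<inter> {0<..v} = insert d (D \<inter> {0<..u})"
    using u v d dd m(3) by force
  have dn: "d \<notin> D \<inter> {0<..u}" using u by auto
  have "(\<Sum>r\<in>D \<inter> {0<..v}. a r) = a d + (\<Sum>r\<in>D \<inter> {0<..u}. a r)"
    unfolding uv using dn D by (intro sum.insert) auto
  moreover have "C u + (\<Sum>r\<in>D \<inter> {0<..u}. a r) = 0" using u dd v by (intro zero) auto
  moreover have "C v + (\<Sum>r\<in>D \<inter> {0<..v}. a r) = 0" using u dd v by (intro zero) auto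
  ultimately have "a d = C u - C v" by linarith
  moreover have "\<bar>C u - C d\<bar> < \<bar>a d\<bar> / 2" using u v dd m by (intro e(2)) auto
  moreover have "\<bar>C v - C d\<bar> < \<bar>a d\<bar> / 2" using u v dd m by (intro e(2)) auto
  ultimately show False by linarith
qed

section \<open>Independence of jump sums from the past\<close>

text \<open>The functions to which \<open>jump_sum_limit\<close> applies: vanishing near 0 leaves
  finitely many summands on a cadlag path, and continuity makes the increment sums converge.\<close>

definition jump_test :: "(real \<Rightarrow> real) \<Rightarrow> bool" where
  "jump_test g \<longleftrightarrow> continuous_on UNIV g \<and> (\<exists>\<delta>>0. \<forall>y. \<bar>y\<bar> < \<delta> \<longrightarrow> g y = 0)"

lemma jump_test_scale: "jump_test g \<Longrightarrow> jump_test (\<lambda>y. c * g y)"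
  unfolding jump_test_def by (auto intro!: continuous_intros)

lemma jump_test_measurable: "jump_test g \<Longrightarrow> g \<in> borel_measurable borel"
  unfolding jump_test_def by (auto intro: borel_measurable_continuous_onI)

lemma jump_test_finite:
  assumes "jump_test g" "cadlag_on Tm h" "Tm > 0" "0 \<le> s" "t \<le> Tm"
  shows "finite {r\<in>{s<..t}. g (path_jump h r) \<noteq> 0}"
proof -
  obtain \<delta> where \<delta>: "\<delta> > 0" "\<And>y. \<bar>y\<bar> < \<delta> \<Longrightarrow> g y = 0" using assms by (auto simp: jump_test_def)
  have "finite {r\<in>{0<..Tm}. \<bar>path_jump h r\<bar> \<ge> \<delta>}" using finite_big_jumps[OF assms(2) \<delta>(1) assms(3)] .
  then show ?thesis by (rule rev_finite_subset) (use \<delta> assms in \<open>force simp: not_less[symmetric]\<close>)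
qed

text \<open>The difference quotient of \<open>exp\<close> at 0. It recovers a variable from its
  Laplace transform and thereby turns factorization of bounded exponentials into factorization of
  means.\<close>

lemma laplace_difference_limit: "(\<lambda>m. real (Suc m) * (1 - exp (- (z / real (Suc m))))) \<longlonglongrightarrow> z"
proof (cases "z = 0")
  case False
  have "((\<lambda>u. exp u) has_real_derivative 1) (at 0)" using DERIV_exp[of 0] by simp
  then have *: "((\<lambda>h. (exp h - 1) / h) \<longlongrightarrow> 1) (at (0::real))" by (simp add: DERIV_def)
  have "filterlim (\<lambda>m. - (z / real (Suc m))) (at 0) sequentially"
    unfolding filterlim_at using False
    using tendsto_minus[OF LIMSEQ_Suc[OF lim_const_over_n[of z]]] by auto
  from tendsto_mult[OF tendsto_const[of z] filterlim_compose[OF * this]]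
  have "(\<lambda>m. z * ((exp (- (z / real (Suc m))) - 1) / (- (z / real (Suc m))))) \<longlonglongrightarrow> z" by simp
  moreover have "z * ((exp (- (z / real (Suc m))) - 1) / (- (z / real (Suc m)))) = real (Suc m) * (1 - exp (- (z / real (Suc m))))" for m
  proof -
    have *: "z * ((e - 1) / (- (z / N))) = N * (1 - e)" if "N \<noteq> 0" for e N :: real
      using False that by (simp add: field_simps)
    show ?thesis by (rule *) simp
  qed
  ultimately show ?thesis by simp
qed simp

section \<open>The filtrations with and without null events\<close>

context levy_setting
begin

text \<open>Independence of increments is assumed for this natural filtration, whereas martingales
  and predictability refer to the augmented \<open>Filt\<close>; both are therefore needed.\<close>

definition Past :: "real \<Rightarrow> 'a measure" where
  "Past t = sigma (space M) (past_events M Z t)"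

lemma past_events_Pow: "past_events M Z t \<subseteq> Pow (space M)"
  by (auto simp: past_events_def)

lemma space_Past [simp]: "space (Past t) = space M"
  by (simp add: Past_def space_measure_of past_events_Pow)

lemma sets_Past: "sets (Past t) = sigma_sets (space M) (past_events M Z t)"
  by (simp add: Past_def sets_measure_of past_events_Pow)

lemma Z_measurable: "t \<in> {0..Tm} \<Longrightarrow> Z t \<in> borel_measurable M"
  using levy by (auto simp: levy_process_def)

lemma path_cadlag: "\<omega> \<in> space M \<Longrightarrow> cadlag_on Tm (\<lambda>t. Z t \<omega>)"
  using levy by (auto simp: levy_process_def)

lemma Z_Past: "r \<in> {0..t} \<Longrightarrow> Z r \<in> borel_measurable (Past t)"
  by (rule measurableI) (auto simp: sets_Past past_events_def intro!: sigma_sets.Basic)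

lemma past_events_mono: "s \<le> t \<Longrightarrow> past_events M Z s \<subseteq> past_events M Z t"
  unfolding past_events_def by fastforce

lemma Past_mono: "s \<le> t \<Longrightarrow> sets (Past s) \<subseteq> sets (Past t)"
  unfolding sets_Past by (intro sigma_sets_mono' past_events_mono)

lemma past_events_sets: "t \<le> Tm \<Longrightarrow> past_events M Z t \<subseteq> sets M"
  unfolding past_events_def using measurable_sets[OF Z_measurable] by fastforce

lemma Past_subset: "t \<le> Tm \<Longrightarrow> sets (Past t) \<subseteq> sets M"
  unfolding sets_Past by (intro sets.sigma_sets_subset past_events_sets)

lemma Past_measurable_mono: "s \<le> t \<Longrightarrow> f \<in> measurable (Past s) Q \<Longrightarrow> f \<in> measurable (Past t) Q"
  using measurable_mono[of Q Q "Past s" "Past t"] Past_mono by auto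

lemma Past_measurable_M: "t \<le> Tm \<Longrightarrow> f \<in> measurable (Past t) Q \<Longrightarrow> f \<in> measurable M Q"
  using measurable_mono[of Q Q "Past t" M] Past_subset by auto

lemma Filt_past_events_Pow: "past_events M Z t \<union> null_sets M \<subseteq> Pow (space M)"
proof (rule Un_least[OF past_events_Pow])
  show "null_sets M \<subseteq> Pow (space M)" using sets.space_closed[of M] by (auto simp: null_sets_def)
qed

lemma space_Filt [simp]: "space (Filt t) = space M"
  unfolding Filt_def by (intro space_measure_of Filt_past_events_Pow)

lemma sets_Filt: "t \<le> Tm \<Longrightarrow> sets (Filt t) = sigma_sets (space M) (past_events M Z t \<union> null_sets M)"
  unfolding Filt_def by (subst sets_measure_of[OF Filt_past_events_Pow]) (simp add: min_absorb1)

lemma Past_le_Filt: "t \<le> Tm \<Longrightarrow> sets (Past t) \<subseteq> sets (Filt t)"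
  unfolding sets_Past sets_Filt by (intro sigma_sets_mono') auto

lemma Filt_le_M: "t \<le> Tm \<Longrightarrow> sets (Filt t) \<subseteq> sets M"
  unfolding sets_Filt using past_events_sets by (intro sets.sigma_sets_subset) auto

lemma Filt_mono: "s \<le> t \<Longrightarrow> t \<le> Tm \<Longrightarrow> sets (Filt s) \<subseteq> sets (Filt t)"
  using sigma_sets_mono'[OF Un_mono[OF past_events_mono[of s t] subset_refl[of "null_sets M"]], of "space M"]
  by (simp add: sets_Filt)

lemma Past_measurable_Filt: "t \<le> Tm \<Longrightarrow> f \<in> measurable (Past t) Q \<Longrightarrow> f \<in> measurable (Filt t) Q"
  using measurable_mono[of Q Q "Past t" "Filt t"] Past_le_Filt by auto

lemma Filt_measurable_M: "t \<le> Tm \<Longrightarrow> f \<in> measurable (Filt t) Q \<Longrightarrow> f \<in> measurable M Q"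
  using measurable_mono[of Q Q "Filt t" M] Filt_le_M by auto

text \<open>Among the generators of \<open>Filt t\<close>, null events are replaced by the empty
  set; agreement up to a null event then survives complements and countable unions. Independence
  passes from \<open>Past\<close> to \<open>Filt\<close> in this way.\<close>

lemma Filt_AE_Past:
  assumes t: "0 \<le> t" "t \<le> Tm" and A: "A \<in> sets (Filt t)"
  shows "\<exists>B\<in>sets (Past t). AE \<omega> in M. \<omega> \<in> A \<longleftrightarrow> \<omega> \<in> B"
  using A unfolding sets_Filt[OF t(2)]
proof (induction rule: sigma_sets.induct)
  case (Basic a)
  then show ?case
  proof
    assume "a \<in> past_events M Z t"
    then show ?thesis by (intro bexI[of _ a]) (auto simp: sets_Past intro: sigma_sets.Basic)
  next
    assume "a \<in> null_sets M"
    then have "AE \<omega> in M. \<omega> \<notin> a" by (rule AE_not_in)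
    then show ?thesis by (intro bexI[of _ "{}"]) auto
  qed
next
  case (Compl a)
  then obtain B where "B \<in> sets (Past t)" "AE \<omega> in M. \<omega> \<in> a \<longleftrightarrow> \<omega> \<in> B" by blast
  then show ?case
    by (intro bexI[of _ "space (Past t) - B"]) (auto simp del: space_Past, auto)
next
  case (Union a)
  then obtain B where "\<And>i::nat. B i \<in> sets (Past t)" "\<And>i. AE \<omega> in M. \<omega> \<in> a i \<longleftrightarrow> \<omega> \<in> B i" by metis
  then have "AE \<omega> in M. \<forall>i. \<omega> \<in> a i \<longleftrightarrow> \<omega> \<in> B i" "(\<Union>i. B i) \<in> sets (Past t)" by (auto simp: AE_all_countable)
  then show ?case by (intro bexI[of _ "\<Union>i. B i"]) auto
qed (auto intro!: bexI[of _ "{}"])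

section \<open>Jump sums as random variables\<close>

definition JS :: "(real \<Rightarrow> real) \<Rightarrow> real \<Rightarrow> real \<Rightarrow> 'a \<Rightarrow> real" where
  "JS g s t \<omega> = jump_sum g (\<lambda>t. Z t \<omega>) s t"

lemma JS_limit:
  assumes "jump_test g" "\<omega> \<in> space M" "0 \<le> s" "s \<le> t" "t \<le> Tm"
  shows "(\<lambda>n. \<Sum>k<Suc n. g (Z (grid s t n (Suc k)) \<omega> - Z (grid s t n k) \<omega>)) \<longlonglongrightarrow> JS g s t \<omega>"
proof -
  obtain \<delta> where \<delta>: "\<delta> > 0" "\<And>y. \<bar>y\<bar> < \<delta> \<Longrightarrow> g y = 0" and "continuous_on UNIV g"
    using assms by (auto simp: jump_test_def)
  then show ?thesis unfolding JS_def
    using jump_sum_limit[OF path_cadlag Tm_pos, of \<omega> s t g \<delta>] assms by auto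
qed

text \<open>The sum runs over random jump times, but as a limit of increment sums it depends only on
  countably many values of \<open>Z\<close> up to time \<open>t\<close>.\<close>

lemma JS_Past:
  assumes "jump_test g" "0 \<le> s" "s \<le> t" "t \<le> Tm"
  shows "JS g s t \<in> borel_measurable (Past t)"
proof (rule borel_measurable_LIMSEQ_real)
  show "(\<lambda>n. \<Sum>k<Suc n. g (Z (grid s t n (Suc k)) \<omega> - Z (grid s t n k) \<omega>)) \<longlonglongrightarrow> JS g s t \<omega>"
    if "\<omega> \<in> space (Past t)" for \<omega>
    using that assms by (intro JS_limit) auto
  note [measurable] = jump_test_measurable[OF assms(1)]
  show "(\<lambda>\<omega>. \<Sum>k<Suc n. g (Z (grid s t n (Suc k)) \<omega> - Z (grid s t n k) \<omega>)) \<in> borel_measurable (Past t)" for n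
  proof (rule borel_measurable_sum)
    fix k assume k: "k \<in> {..<Suc n}"
    have [measurable]: "Z (grid s t n (Suc k)) \<in> borel_measurable (Past t)" "Z (grid s t n k) \<in> borel_measurable (Past t)"
      using grid_range[of s t k n] grid_range[of s t "Suc k" n] k assms by (auto intro!: Z_Past)
    show "(\<lambda>\<omega>. g (Z (grid s t n (Suc k)) \<omega> - Z (grid s t n k) \<omega>)) \<in> borel_measurable (Past t)"
      by measurable
  qed
qed

lemma JS_measurable:
  assumes "jump_test g" "0 \<le> s" "s \<le> t" "t \<le> Tm"
  shows "JS g s t \<in> borel_measurable M"
  using Past_measurable_M[OF assms(4) JS_Past[OF assms]] .

lemma JS_nonneg: "(\<And>y. g y \<ge> 0) \<Longrightarrow> JS g s t \<omega> \<ge> 0"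
  by (auto simp: JS_def jump_sum_def intro: sum_nonneg)

lemma JS_scale: "JS (\<lambda>y. c * g y) s t \<omega> = c * JS g s t \<omega>"
  by (cases "c = 0") (simp_all add: JS_def jump_sum_def sum_distrib_left)

lemma JS_add:
  assumes "jump_test g" "\<omega> \<in> space M" "0 \<le> s" "s \<le> t" "t \<le> u" "u \<le> Tm"
  shows "JS g s u \<omega> = JS g s t \<omega> + JS g t u \<omega>"
proof -
  let ?h = "\<lambda>t. Z t \<omega>"
  have fin: "finite {r\<in>{s<..t}. g (path_jump ?h r) \<noteq> 0}" "finite {r\<in>{t<..u}. g (path_jump ?h r) \<noteq> 0}"
    using jump_test_finite[OF assms(1) path_cadlag[OF assms(2)] Tm_pos] assms by auto
  have "{r\<in>{s<..u}. g (path_jump ?h r) \<noteq> 0} =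
    {r\<in>{s<..t}. g (path_jump ?h r) \<noteq> 0} \<union> {r\<in>{t<..u}. g (path_jump ?h r) \<noteq> 0}" using assms by auto
  then show ?thesis unfolding JS_def jump_sum_def
    by (simp only:) (rule sum.union_disjoint[OF fin], force)
qed

section \<open>Independence along a grid and its limit\<close>

lemma indep_increment:
  assumes st: "0 \<le> s" "s \<le> t" "t \<le> Tm" and \<xi>: "\<xi> \<in> borel_measurable (Past s)"
    and f: "f \<in> borel_measurable borel"
  shows "indep_var borel \<xi> borel (\<lambda>\<omega>. f (Z t \<omega> - Z s \<omega>) :: real)"
proof -
  have [measurable]: "Z t \<in> borel_measurable M" "Z s \<in> borel_measurable M" "f \<in> borel_measurable borel"
    using st f by (auto intro: Z_measurable)
  let ?D = "\<lambda>\<omega>. Z t \<omega> - Z s \<omega>"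
  have "indep_set (sets (Past s)) {?D -` A \<inter> space M | A. A \<in> sets borel}"
    using levy st unfolding levy_process_def indep_increments_def sets_Past by blast
  \<comment> \<open>Independent variables are defined through generated sigma-algebras; the events
    of the increment are closed under intersection, so independence extends to the sigma-algebra
    they generate.\<close>
  then have ind: "indep_set (sets (Past s)) (sigma_sets (space M) {?D -` A \<inter> space M | A. A \<in> sets borel})"
  proof -
    assume i: "indep_set (sets (Past s)) {?D -` A \<inter> space M | A. A \<in> sets borel}"
    have "indep_set (sigma_sets (space M) (sets (Past s))) (sigma_sets (space M) {?D -` A \<inter> space M | A. A \<in> sets borel})"
    proof (rule indep_set_sigma_sets[OF i])
      show "Int_stable (sets (Past s))" by (auto simp: Int_stable_def)
      show "Int_stable {?D -` A \<inter> space M | A. A \<in> sets borel}"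
      proof (rule Int_stableI)
        fix a b assume "a \<in> {?D -` A \<inter> space M | A. A \<in> sets borel}" "b \<in> {?D -` A \<inter> space M | A. A \<in> sets borel}"
        then obtain A B where "a = ?D -` A \<inter> space M" "A \<in> sets borel" "b = ?D -` B \<inter> space M" "B \<in> sets borel" by auto
        then show "a \<inter> b \<in> {?D -` A \<inter> space M | A. A \<in> sets borel}"
          by (intro CollectI exI[of _ "A \<inter> B"]) auto
      qed
    qed
    then show ?thesis using sets.sigma_sets_eq[of "Past s"] by simp
  qed
  show ?thesis unfolding indep_var_eq
  proof (intro conjI)
    show "random_variable borel \<xi>" using Past_measurable_M[OF _ \<xi>] st by auto
    show "random_variable borel (\<lambda>\<omega>. f (Z t \<omega> - Z s \<omega>))" by measurable
    have 1: "sigma_sets (space M) {\<xi> -` A \<inter> space M | A. A \<in> sets borel} \<subseteq> sets (Past s)"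
      using sets.sigma_sets_subset[of "{\<xi> -` A \<inter> space M | A. A \<in> sets borel}" "Past s"] measurable_sets[OF \<xi>] by auto
    have 2: "sigma_sets (space M) {(\<lambda>\<omega>. f (?D \<omega>)) -` A \<inter> space M | A. A \<in> sets borel} \<subseteq>
        sigma_sets (space M) {?D -` A \<inter> space M | A. A \<in> sets borel}"
    proof (rule sigma_sets_mono', safe)
      fix A :: "real set" assume "A \<in> sets borel"
      then have "f -` A \<in> sets borel" using measurable_sets[OF f, of A] by simp
      then show "\<exists>B. (\<lambda>\<omega>. f (?D \<omega>)) -` A \<inter> space M = ?D -` B \<inter> space M \<and> B \<in> sets borel"
        by (intro exI[of _ "f -` A"]) auto
    qed
    show "indep_set (sigma_sets (space M) {\<xi> -` A \<inter> space M | A. A \<in> sets borel})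
      (sigma_sets (space M) {(\<lambda>\<omega>. f (?D \<omega>)) -` A \<inter> space M | A. A \<in> sets borel})"
      using ind unfolding indep_set_def
    proof (rule indep_sets_mono_sets)
      fix i :: bool
      show "case_bool (sigma_sets (space M) {\<xi> -` A \<inter> space M | A. A \<in> sets borel})
          (sigma_sets (space M) {(\<lambda>\<omega>. f (?D \<omega>)) -` A \<inter> space M | A. A \<in> sets borel}) i
        \<subseteq> case_bool (sets (Past s)) (sigma_sets (space M) {?D -` A \<inter> space M | A. A \<in> sets borel}) i"
        using 1 2 by (cases i) simp_all
    qed
  qed
qed

lemma expectation_increment:
  assumes st: "0 \<le> s" "s \<le> t" "t \<le> Tm" and \<xi>: "\<xi> \<in> borel_measurable (Past s)" "\<And>\<omega>. \<omega> \<in> space M \<Longrightarrow> \<bar>\<xi> \<omega>\<bar> \<le> 1"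
    and f: "f \<in> borel_measurable borel" "\<And>y. \<bar>f y\<bar> \<le> 1"
  shows "expectation (\<lambda>\<omega>. \<xi> \<omega> * f (Z t \<omega> - Z s \<omega>)) = expectation \<xi> * expectation (\<lambda>\<omega>. f (Z t \<omega> - Z s \<omega>) :: real)"
proof (rule indep_var_lebesgue_integral[OF indep_increment[OF st \<xi>(1) f(1)]])
  have [measurable]: "Z t \<in> borel_measurable M" "Z s \<in> borel_measurable M" "f \<in> borel_measurable borel"
    using st f by (auto intro: Z_measurable)
  show "integrable M \<xi>" using Past_measurable_M[OF _ \<xi>(1)] \<xi>(2) st by (intro integrable_const_bound[of _ 1]) auto
  show "integrable M (\<lambda>\<omega>. f (Z t \<omega> - Z s \<omega>))" using f(2) by (intro integrable_const_bound[of _ 1]) auto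
qed

text \<open>The last increment is split off: all earlier factors are known at \<open>p n\<close>,
  and their product with \<open>\<xi>\<close> is still bounded by 1.\<close>

lemma expectation_prod_increments:
  fixes f :: "real \<Rightarrow> real"
  assumes p: "0 \<le> p 0" "\<And>k. k < n \<Longrightarrow> p k \<le> p (Suc k)" "p n \<le> Tm"
    and \<xi>: "\<xi> \<in> borel_measurable (Past (p 0))" "\<And>\<omega>. \<omega> \<in> space M \<Longrightarrow> \<bar>\<xi> \<omega>\<bar> \<le> 1"
    and f: "f \<in> borel_measurable borel" "\<And>y. \<bar>f y\<bar> \<le> 1"
  shows "expectation (\<lambda>\<omega>. \<xi> \<omega> * (\<Prod>k<n. f (Z (p (Suc k)) \<omega> - Z (p k) \<omega>))) =
    expectation \<xi> * (\<Prod>k<n. expectation (\<lambda>\<omega>. f (Z (p (Suc k)) \<omega> - Z (p k) \<omega>)))"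
  using p
proof (induction n)
  case (Suc n)
  note [measurable] = f(1)
  note step = Suc.prems(2)
  have le: "p i \<le> p j" if "i \<le> j" "j \<le> Suc n" for i j
    using that
  proof (induction j)
    case (Suc j)
    then show ?case using step[of j] order_trans[of "p i" "p j" "p (Suc j)"] by (cases "i = Suc j") auto
  qed simp
  let ?\<eta> = "\<lambda>\<omega>. \<xi> \<omega> * (\<Prod>k<n. f (Z (p (Suc k)) \<omega> - Z (p k) \<omega>))"
  have "expectation (\<lambda>\<omega>. \<xi> \<omega> * (\<Prod>k<Suc n. f (Z (p (Suc k)) \<omega> - Z (p k) \<omega>))) =
    expectation (\<lambda>\<omega>. ?\<eta> \<omega> * f (Z (p (Suc n)) \<omega> - Z (p n) \<omega>))" by (simp add: mult.assoc)
  also have "\<dots> = expectation ?\<eta> * expectation (\<lambda>\<omega>. f (Z (p (Suc n)) \<omega> - Z (p n) \<omega>))"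
  proof (rule expectation_increment)
    show "0 \<le> p n" using le[of 0 n] Suc.prems by auto
    show "p n \<le> p (Suc n)" "p (Suc n) \<le> Tm" using Suc.prems by auto
    have [measurable]: "\<xi> \<in> borel_measurable (Past (p n))"
      using le[of 0 n] by (intro Past_measurable_mono[OF _ \<xi>(1)]) auto
    have Zm: "Z (p k) \<in> borel_measurable (Past (p n))" if "k \<le> n" for k
      using le[of 0 k] le[of k n] that Suc.prems by (intro Z_Past) auto
    have [measurable]: "(\<lambda>\<omega>. \<Prod>k<n. f (Z (p (Suc k)) \<omega> - Z (p k) \<omega>)) \<in> borel_measurable (Past (p n))"
    proof (rule borel_measurable_prod)
      fix k assume "k \<in> {..<n}"
      then have [measurable]: "Z (p k) \<in> borel_measurable (Past (p n))" "Z (p (Suc k)) \<in> borel_measurable (Past (p n))"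
        by (auto intro: Zm)
      show "(\<lambda>\<omega>. f (Z (p (Suc k)) \<omega> - Z (p k) \<omega>)) \<in> borel_measurable (Past (p n))" by measurable
    qed
    show "?\<eta> \<in> borel_measurable (Past (p n))" by measurable
    show "\<bar>?\<eta> \<omega>\<bar> \<le> 1" if "\<omega> \<in> space M" for \<omega>
      using \<xi>(2)[OF that] f(2) by (auto simp: abs_mult abs_prod intro!: mult_le_one prod_le_1 prod_nonneg)
  qed (use f in auto)
  also have "expectation ?\<eta> = expectation \<xi> * (\<Prod>k<n. expectation (\<lambda>\<omega>. f (Z (p (Suc k)) \<omega> - Z (p k) \<omega>)))"
    proof (rule Suc.IH)
    show "p n \<le> Tm" using Suc.prems(3) le[of n "Suc n"] by linarith
  qed (use Suc.prems in auto)
  finally show ?case by simp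
qed simp

text \<open>Laplace transforms make the functionals of the Riemann sums bounded, so that independence
  passes to the limit without uniform integrability.\<close>

lemma laplace_indep:
  assumes g: "jump_test g" "\<And>y. g y \<ge> 0" and st: "0 \<le> s" "s \<le> t" "t \<le> Tm" and A: "A \<in> sets (Past s)"
  shows "expectation (\<lambda>\<omega>. indicator A \<omega> * exp (- JS g s t \<omega>)) = prob A * expectation (\<lambda>\<omega>. exp (- JS g s t \<omega>))"
proof -
  note [measurable] = jump_test_measurable[OF g(1)]
  let ?R = "\<lambda>n \<omega>. \<Sum>k<Suc n. g (Z (grid s t n (Suc k)) \<omega> - Z (grid s t n k) \<omega>)"
  have AM[measurable]: "A \<in> sets M" using A Past_subset[of s] st by auto
  have Rm: "?R n \<in> borel_measurable M" for n
  proof (rule borel_measurable_sum)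
    fix k assume k: "k \<in> {..<Suc n}"
    have [measurable]: "Z (grid s t n (Suc k)) \<in> borel_measurable M" "Z (grid s t n k) \<in> borel_measurable M"
      using grid_range[of s t k n] grid_range[of s t "Suc k" n] k st by (auto intro!: Z_measurable)
    show "(\<lambda>\<omega>. g (Z (grid s t n (Suc k)) \<omega> - Z (grid s t n k) \<omega>)) \<in> borel_measurable M" by measurable
  qed
  note [measurable] = JS_measurable[OF g(1) st]
  have lim: "(\<lambda>n. expectation (\<lambda>\<omega>. indicator B \<omega> * exp (- ?R n \<omega>))) \<longlonglongrightarrow> expectation (\<lambda>\<omega>. indicator B \<omega> * exp (- JS g s t \<omega>))"
    if [measurable]: "B \<in> sets M" for B
  proof (rule integral_dominated_convergence[where w="\<lambda>_. 1"])
    show "(\<lambda>\<omega>. indicator B \<omega> * exp (- ?R n \<omega>)) \<in> borel_measurable M" for n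
      using Rm[of n] by measurable
    show "AE \<omega> in M. (\<lambda>n. indicator B \<omega> * exp (- ?R n \<omega>)) \<longlonglongrightarrow> indicator B \<omega> * exp (- JS g s t \<omega>)"
      by (intro AE_I2 tendsto_intros JS_limit g st)
    show "AE \<omega> in M. norm (indicator B \<omega> * exp (- ?R n \<omega>)) \<le> 1" for n
      using g(2) by (intro AE_I2) (auto simp: indicator_def intro!: sum_nonneg simp del: sum.lessThan_Suc)
  qed auto
  have eq: "expectation (\<lambda>\<omega>. indicator A \<omega> * exp (- ?R n \<omega>)) = prob A * expectation (\<lambda>\<omega>. indicator (space M) \<omega> * exp (- ?R n \<omega>))" for n
  proof -
    have ex: "exp (- ?R n \<omega>) = (\<Prod>k<Suc n. exp (- g (Z (grid s t n (Suc k)) \<omega> - Z (grid s t n k) \<omega>)))" for \<omega>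
      by (simp only: sum_negf[symmetric] exp_sum[OF finite_lessThan])
    \<comment> \<open>The product on the right is the same for every \<open>B\<close>. Taking
      \<open>B\<close> to be the whole space identifies it as the mean of the exponential, which
      gives the factorization for \<open>A\<close>.\<close>
    have *: "expectation (\<lambda>\<omega>. indicator B \<omega> * exp (- ?R n \<omega>)) = expectation (indicator B) *
        (\<Prod>k<Suc n. expectation (\<lambda>\<omega>. exp (- g (Z (grid s t n (Suc k)) \<omega> - Z (grid s t n k) \<omega>))))"
      if B: "B \<in> sets (Past s)" for B
      unfolding ex
      using st g B grid_mono[of s t] by (intro expectation_prod_increments) auto
    show ?thesis using *[OF A] *[OF sets.top[of "Past s"]] by (simp add: prob_space del: sum.lessThan_Suc prod.lessThan_Suc)
  qed
  have "(\<lambda>n. prob A * expectation (\<lambda>\<omega>. indicator (space M) \<omega> * exp (- ?R n \<omega>))) \<longlonglongrightarrow>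
     prob A * expectation (\<lambda>\<omega>. indicator (space M) \<omega> * exp (- JS g s t \<omega>))"
    by (intro tendsto_mult lim tendsto_const) auto
  then have "expectation (\<lambda>\<omega>. indicator A \<omega> * exp (- JS g s t \<omega>)) = prob A * expectation (\<lambda>\<omega>. indicator (space M) \<omega> * exp (- JS g s t \<omega>))"
    using lim[OF AM] unfolding eq by (rule LIMSEQ_unique[rotated])
  also have "expectation (\<lambda>\<omega>. indicator (space M) \<omega> * exp (- JS g s t \<omega>)) = expectation (\<lambda>\<omega>. exp (- JS g s t \<omega>))"
    by (intro Bochner_Integration.integral_cong) auto
  finally show ?thesis .
qed

text \<open>Applied to \<open>g\<close> divided by \<open>Suc m\<close>, the Laplace factorization
  gives the claim for the difference quotients \<open>?L m\<close>. These increase no further than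
  the jump sum itself, so dominated convergence carries the claim to the limit.\<close>

lemma mean_indep_Past:
  assumes g: "jump_test g" "\<And>y. g y \<ge> 0" and st: "0 \<le> s" "s \<le> t" "t \<le> Tm" and A: "A \<in> sets (Past s)"
    and int: "integrable M (JS g s t)"
  shows "expectation (\<lambda>\<omega>. indicator A \<omega> * JS g s t \<omega>) = prob A * expectation (JS g s t)"
proof -
  let ?L = "\<lambda>m \<omega>. real (Suc m) * (1 - exp (- (JS g s t \<omega> / real (Suc m))))"
  have AM[measurable]: "A \<in> sets M" using A Past_subset[of s] st by auto
  note [measurable] = JS_measurable[OF g(1) st]
  have J0: "JS g s t \<omega> \<ge> 0" for \<omega> using JS_nonneg g by auto
  have lim: "(\<lambda>m. expectation (\<lambda>\<omega>. indicator B \<omega> * ?L m \<omega>)) \<longlonglongrightarrow> expectation (\<lambda>\<omega>. indicator B \<omega> * JS g s t \<omega>)"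
    if [measurable]: "B \<in> sets M" for B
  proof (rule integral_dominated_convergence[where w="JS g s t"])
    show "AE \<omega> in M. (\<lambda>m. indicator B \<omega> * ?L m \<omega>) \<longlonglongrightarrow> indicator B \<omega> * JS g s t \<omega>"
      by (intro AE_I2 tendsto_intros laplace_difference_limit)
    \<comment> \<open>The inequality \<open>1 - exp (- c) \<le> c\<close> makes the integrable jump
      sum a dominating function for all \<open>m\<close>.\<close>
    have b: "0 \<le> ?L m \<omega> \<and> ?L m \<omega> \<le> JS g s t \<omega>" for m \<omega>
    proof -
      let ?c = "JS g s t \<omega> / real (Suc m)"
      have "1 - exp (- ?c) \<le> ?c" using exp_ge_add_one_self[of "- ?c"] by linarith
      then have "?L m \<omega> \<le> real (Suc m) * ?c" by (intro mult_left_mono) auto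
      then show ?thesis using J0[of \<omega>] by (auto simp: divide_nonneg_pos)
    qed
    show "AE \<omega> in M. norm (indicator B \<omega> * ?L m \<omega>) \<le> JS g s t \<omega>" for m
    proof (rule AE_I2)
      fix \<omega>
      show "norm (indicator B \<omega> * ?L m \<omega>) \<le> JS g s t \<omega>"
        using b[of m \<omega>] J0[of \<omega>] by (cases "\<omega> \<in> B") (simp_all add: abs_of_nonneg)
    qed
  qed (use int in auto)
  have eq: "expectation (\<lambda>\<omega>. indicator A \<omega> * ?L m \<omega>) = prob A * expectation (\<lambda>\<omega>. indicator (space M) \<omega> * ?L m \<omega>)" for m
  proof -
    let ?g = "\<lambda>y. (1 / real (Suc m)) * g y"
    have gg: "jump_test ?g" "\<And>y. ?g y \<ge> 0" using jump_test_scale[OF g(1)] g(2) by (blast, simp)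
    have JSg: "JS ?g s t \<omega> = JS g s t \<omega> / real (Suc m)" for \<omega> unfolding JS_scale by simp
    have *: "expectation (\<lambda>\<omega>. indicator B \<omega> * ?L m \<omega>) = real (Suc m) * (prob B - prob B * expectation (\<lambda>\<omega>. exp (- JS ?g s t \<omega>)))"
      if B: "B \<in> sets (Past s)" for B
    proof -
      have [measurable]: "B \<in> sets M" using B Past_subset[of s] st by auto
      have i1: "integrable M (\<lambda>\<omega>. indicator B \<omega> * exp (- JS ?g s t \<omega>))"
        unfolding JSg using J0 by (intro integrable_const_bound[of _ 1]) (auto simp: indicator_def)
      have "expectation (\<lambda>\<omega>. indicator B \<omega> * ?L m \<omega>) =
          expectation (\<lambda>\<omega>. real (Suc m) * (indicator B \<omega> - indicator B \<omega> * exp (- JS ?g s t \<omega>)))"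
        unfolding JSg by (intro Bochner_Integration.integral_cong) (auto simp: algebra_simps)
      also have "\<dots> = real (Suc m) * (expectation (indicator B) - expectation (\<lambda>\<omega>. indicator B \<omega> * exp (- JS ?g s t \<omega>)))"
        by (subst integral_mult_right_zero, subst Bochner_Integration.integral_diff[OF _ i1]) (auto intro!: integrable_real_indicator simp: emeasure_eq_measure)
      also have "expectation (\<lambda>\<omega>. indicator B \<omega> * exp (- JS ?g s t \<omega>)) = prob B * expectation (\<lambda>\<omega>. exp (- JS ?g s t \<omega>))"
        by (rule laplace_indep[OF gg st B])
      finally show ?thesis by simp
    qed
    have top: "space M \<in> sets (Past s)" using sets.top[of "Past s"] by simp
    show ?thesis unfolding *[OF A] *[OF top] prob_space by (simp only: right_diff_distrib mult_1_left mult_1_right ac_simps)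
  qed
  have "(\<lambda>m. prob A * expectation (\<lambda>\<omega>. indicator (space M) \<omega> * ?L m \<omega>)) \<longlonglongrightarrow>
     prob A * expectation (\<lambda>\<omega>. indicator (space M) \<omega> * JS g s t \<omega>)"
    by (intro tendsto_mult lim tendsto_const) auto
  then have "expectation (\<lambda>\<omega>. indicator A \<omega> * JS g s t \<omega>) = prob A * expectation (\<lambda>\<omega>. indicator (space M) \<omega> * JS g s t \<omega>)"
    using lim[OF AM] unfolding eq by (rule LIMSEQ_unique[rotated])
  also have "expectation (\<lambda>\<omega>. indicator (space M) \<omega> * JS g s t \<omega>) = expectation (JS g s t)"
    by (intro Bochner_Integration.integral_cong) auto
  finally show ?thesis .
qed

lemma mean_indep:
  assumes g: "jump_test g" "\<And>y. g y \<ge> 0" and st: "0 \<le> s" "s \<le> t" "t \<le> Tm" and A: "A \<in> sets (Filt s)"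
    and int: "integrable M (JS g s t)"
  shows "expectation (\<lambda>\<omega>. indicator A \<omega> * JS g s t \<omega>) = prob A * expectation (JS g s t)"
proof -
  obtain B where B: "B \<in> sets (Past s)" "AE \<omega> in M. \<omega> \<in> A \<longleftrightarrow> \<omega> \<in> B"
    using Filt_AE_Past[OF _ _ A] st by auto
  note [measurable] = JS_measurable[OF g(1) st]
  have m[measurable]: "A \<in> sets M" "B \<in> sets M" using A B Past_subset[of s] Filt_le_M[of s] st by auto
  have "prob A = prob B" using B(2) by (intro finite_measure_eq_AE) auto
  moreover have "expectation (\<lambda>\<omega>. indicator A \<omega> * JS g s t \<omega>) = expectation (\<lambda>\<omega>. indicator B \<omega> * JS g s t \<omega>)"
    by (rule integral_cong_AE) (use B(2) in \<open>auto simp: indicator_def\<close>)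
  ultimately show ?thesis using mean_indep_Past[OF g st B(1) int] by simp
qed

text \<open>With extended nonnegative integrals \<open>\<xi>\<close> may be any nonnegative variable
  known at time \<open>s\<close>, so the product needs no integrability in advance. This form serves
  both the second moment of jump sums and the compensation formula.\<close>

lemma nn_mean_indep:
  assumes g: "jump_test g" "\<And>y. g y \<ge> 0" and st: "0 \<le> s" "s \<le> t" "t \<le> Tm"
    and \<xi>: "\<xi> \<in> borel_measurable (Filt s)" and int: "integrable M (JS g s t)"
  shows "(\<integral>\<^sup>+\<omega>. \<xi> \<omega> * ennreal (JS g s t \<omega>) \<partial>M) = (\<integral>\<^sup>+\<omega>. \<xi> \<omega> \<partial>M) * ennreal (expectation (JS g s t))"
proof -
  note [measurable] = JS_measurable[OF g(1) st]
  have J0: "JS g s t \<omega> \<ge> 0" for \<omega> using JS_nonneg g by auto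
  have FM: "f \<in> borel_measurable M" if "f \<in> borel_measurable (Filt s)" for f :: "'a \<Rightarrow> ennreal"
    using Filt_measurable_M[OF _ that] st by auto
  show ?thesis using \<xi>
  proof (induction rule: borel_measurable_induct)
    case (cong f h)
    have "(\<integral>\<^sup>+\<omega>. f \<omega> * ennreal (JS g s t \<omega>) \<partial>M) = (\<integral>\<^sup>+\<omega>. h \<omega> * ennreal (JS g s t \<omega>) \<partial>M)"
       "(\<integral>\<^sup>+\<omega>. f \<omega> \<partial>M) = (\<integral>\<^sup>+\<omega>. h \<omega> \<partial>M)"
      using cong(3) by (auto intro!: nn_integral_cong)
    then show ?case using cong(4) by (simp only:)
  next
    case (set A)
    have [measurable]: "A \<in> sets M" using set Filt_le_M[of s] st by auto
    have i: "integrable M (\<lambda>\<omega>. indicator A \<omega> * JS g s t \<omega>)"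
      using J0 by (intro Bochner_Integration.integrable_bound[OF int]) (auto simp: indicator_def)
    have "(\<integral>\<^sup>+\<omega>. indicator A \<omega> * ennreal (JS g s t \<omega>) \<partial>M) = (\<integral>\<^sup>+\<omega>. ennreal (indicator A \<omega> * JS g s t \<omega>) \<partial>M)"
      by (intro nn_integral_cong) (simp split: split_indicator)
    also have "\<dots> = ennreal (expectation (\<lambda>\<omega>. indicator A \<omega> * JS g s t \<omega>))"
      using J0 by (intro nn_integral_eq_integral i) auto
    also have "\<dots> = ennreal (prob A) * ennreal (expectation (JS g s t))"
      by (subst mean_indep[OF g st set int]) (auto simp: ennreal_mult J0 integral_nonneg_AE)
    finally show ?case by (simp add: emeasure_eq_measure)
  next
    case (mult u c)
    have [measurable]: "u \<in> borel_measurable M" by (rule FM[OF mult(2)])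
    have "(\<integral>\<^sup>+\<omega>. c * u \<omega> * ennreal (JS g s t \<omega>) \<partial>M) = c * (\<integral>\<^sup>+\<omega>. u \<omega> * ennreal (JS g s t \<omega>) \<partial>M)"
      unfolding mult.assoc by (rule nn_integral_cmult) measurable
    also have "\<dots> = c * (\<integral>\<^sup>+\<omega>. u \<omega> \<partial>M) * ennreal (expectation (JS g s t))"
      by (simp only: mult.IH mult.assoc)
    also have "c * (\<integral>\<^sup>+\<omega>. u \<omega> \<partial>M) = (\<integral>\<^sup>+\<omega>. c * u \<omega> \<partial>M)"
      by (rule nn_integral_cmult[symmetric]) measurable
    finally show ?case .
  next
    case (add u v)
    have [measurable]: "u \<in> borel_measurable M" "v \<in> borel_measurable M" by (rule FM[OF add(1)], rule FM[OF add(3)])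
    have "(\<integral>\<^sup>+\<omega>. (v \<omega> + u \<omega>) * ennreal (JS g s t \<omega>) \<partial>M) =
      (\<integral>\<^sup>+\<omega>. v \<omega> * ennreal (JS g s t \<omega>) \<partial>M) + (\<integral>\<^sup>+\<omega>. u \<omega> * ennreal (JS g s t \<omega>) \<partial>M)"
      unfolding distrib_right by (rule nn_integral_add) measurable
    moreover have "(\<integral>\<^sup>+\<omega>. v \<omega> + u \<omega> \<partial>M) = (\<integral>\<^sup>+\<omega>. v \<omega> \<partial>M) + (\<integral>\<^sup>+\<omega>. u \<omega> \<partial>M)"
      by (rule nn_integral_add) measurable
    ultimately show ?case by (simp only: add.IH distrib_right)
  next
    case (seq U)
    have m: "U i \<in> borel_measurable M" for i by (rule FM[OF seq(1)])
    have "(\<integral>\<^sup>+\<omega>. (SUP i. U i) \<omega> * ennreal (JS g s t \<omega>) \<partial>M) = (\<integral>\<^sup>+\<omega>. (SUP i. U i \<omega> * ennreal (JS g s t \<omega>)) \<partial>M)"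
      unfolding SUP_apply SUP_mult_right_ennreal ..
    also have "\<dots> = (SUP i. \<integral>\<^sup>+\<omega>. U i \<omega> * ennreal (JS g s t \<omega>) \<partial>M)"
    proof (rule nn_integral_monotone_convergence_SUP)
      show "incseq (\<lambda>i \<omega>. U i \<omega> * ennreal (JS g s t \<omega>))"
        using seq.hyps(3) unfolding incseq_def le_fun_def by (auto intro!: mult_right_mono)
      show "(\<lambda>\<omega>. U i \<omega> * ennreal (JS g s t \<omega>)) \<in> borel_measurable M" for i
        using m[of i] by measurable
    qed
    also have "\<dots> = (SUP i. (\<integral>\<^sup>+\<omega>. U i \<omega> \<partial>M)) * ennreal (expectation (JS g s t))"
      unfolding seq.IH SUP_mult_right_ennreal ..
    also have "(SUP i. (\<integral>\<^sup>+\<omega>. U i \<omega> \<partial>M)) = (\<integral>\<^sup>+\<omega>. (SUP i. U i) \<omega> \<partial>M)"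
      unfolding SUP_apply by (rule nn_integral_monotone_convergence_SUP[OF seq.hyps(3) m, symmetric])
    finally show ?case .
  qed
qed

end

section \<open>Jump sums of a process with discrete jump sizes\<close>

text \<open>The complement of the support is the union of all open null sets, and by the Lindelof
  property countably many of them have the same union.\<close>

lemma emeasure_compl_support:
  assumes "sets \<nu> = sets borel"
  shows "emeasure \<nu> (- measure_support \<nu>) = 0"
proof -
  let ?F = "{U. open U \<and> emeasure \<nu> U = 0}"
  obtain F' where F': "F' \<subseteq> ?F" "countable F'" "\<Union>F' = \<Union>?F"
    using Lindelof[of ?F] by blast
  have "- measure_support \<nu> = \<Union>?F"
    unfolding measure_support_def by (auto simp: zero_less_iff_neq_zero)
  moreover have "\<Union>F' \<in> null_sets \<nu>"
    using F'(1,2) assms by (intro null_sets_UN'[of F' "\<lambda>U. U", simplified]) (auto simp: null_sets_def)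
  ultimately show ?thesis using F'(3) by (auto simp: null_sets_def)
qed

lemma finite_separated:
  assumes "finite (D :: real set)"
  obtains d where "d > 0" "\<And>r q. r \<in> D \<Longrightarrow> q \<in> D \<Longrightarrow> r \<noteq> q \<Longrightarrow> d \<le> \<bar>r - q\<bar>"
proof
  let ?S = "(\<lambda>(r, q). \<bar>r - q\<bar>) ` {(r, q). (r, q) \<in> D \<times> D \<and> r \<noteq> q}"
  have fin: "finite ?S" using finite_subset[OF _ finite_cartesian_product[OF assms assms], of "{(r, q). (r, q) \<in> D \<times> D \<and> r \<noteq> q}"]
    by auto
  then show "Min (insert 1 ?S) > 0" by auto
  show "Min (insert 1 ?S) \<le> \<bar>r - q\<bar>" if "r \<in> D" "q \<in> D" "r \<noteq> q" for r q
    using that fin by (intro Min_le) auto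
qed

section \<open>Atoms of the Levy measure\<close>

locale discrete_levy = levy_setting M Tm Z \<nu>
  for M :: "'a measure" and Tm Z \<nu> +
  fixes x :: "nat \<Rightarrow> real"
  assumes levy_measure_nu: "levy_measure"
    and x_inj: "inj x" and x_lim: "filterlim (\<lambda>i. \<bar>x i\<bar>) at_top sequentially"
    and nu_support: "measure_support \<nu> = range x"
begin

lemma sets_nu [measurable_cong]: "sets \<nu> = sets borel"
  using levy_measure_nu by (simp add: levy_measure_def)

lemma space_nu [simp]: "space \<nu> = UNIV"
  using sets_eq_imp_space_eq[OF sets_nu] by simp

text \<open>Since the absolute values of the points tend to infinity, only finitely many lie within
  distance 1 of \<open>y\<close>. The point \<open>y\<close> may itself be an atom, so the radius
  isolates atoms as well as points off the support and the origin.\<close>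

lemma isolating_radius:
  obtains \<rho> where "\<rho> > 0" "\<And>j. x j \<noteq> y \<Longrightarrow> \<rho> \<le> \<bar>x j - y\<bar>"
proof -
  have "eventually (\<lambda>i. \<bar>x i\<bar> > \<bar>y\<bar> + 1) sequentially"
    using x_lim by (simp add: filterlim_at_top_dense)
  then obtain n where n: "\<And>i. i \<ge> n \<Longrightarrow> \<bar>x i\<bar> > \<bar>y\<bar> + 1" by (auto simp: eventually_sequentially)
  let ?S = "(\<lambda>j. \<bar>x j - y\<bar>) ` {j. j < n \<and> x j \<noteq> y}"
  show ?thesis
  proof (rule that)
    show "Min (insert 1 ?S) > 0" by auto
    show "Min (insert 1 ?S) \<le> \<bar>x j - y\<bar>" if "x j \<noteq> y" for j
    proof (cases "j < n")
      case True
      then show ?thesis using that by (intro Min_le) auto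
    next
      case False
      then have "1 \<le> \<bar>x j - y\<bar>" using n[of j] by linarith
      moreover have "Min (insert 1 ?S) \<le> 1" by (intro Min_le) auto
      ultimately show ?thesis by linarith
    qed
  qed
qed

lemma range_x_borel [measurable]: "range x \<in> sets borel"
  by (rule sets.countable) auto

lemma AE_range_x: "AE y in \<nu>. y \<in> range x"
  by (rule AE_I[of _ _ "- range x"]) (use emeasure_compl_support[OF sets_nu] nu_support sets_nu in auto)

lemma ball_atom:
  assumes "\<And>j. x j \<noteq> y \<Longrightarrow> \<rho> \<le> \<bar>x j - y\<bar>" "\<rho> > 0" "\<rho>' \<le> \<rho>" "\<rho>' > 0"
  shows "emeasure \<nu> {y - \<rho>' <..< y + \<rho>'} = emeasure \<nu> {y}"
proof (rule emeasure_eq_AE)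
  show "AE z in \<nu>. (z \<in> {y - \<rho>' <..< y + \<rho>'}) = (z \<in> {y})"
    using AE_range_x
  proof eventually_elim
    case (elim z)
    then obtain j where "z = x j" by auto
    then show ?case using assms(1)[of j] assms(2-) by (cases "x j = y") auto
  qed
qed (auto simp: sets_nu)

lemma atom_pos: "emeasure \<nu> {x i} > 0"
proof -
  obtain \<rho> where \<rho>: "\<rho> > 0" "\<And>j. x j \<noteq> x i \<Longrightarrow> \<rho> \<le> \<bar>x j - x i\<bar>" using isolating_radius by blast
  have "x i \<in> measure_support \<nu>" using nu_support by auto
  then have "emeasure \<nu> {x i - \<rho> <..< x i + \<rho>} > 0" using \<rho> unfolding measure_support_def by auto
  then show ?thesis using ball_atom[OF \<rho>(2) \<rho>(1)] \<rho> by simp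
qed

lemma x_nonzero: "x i \<noteq> 0"
proof
  assume "x i = 0"
  then show False using atom_pos[of i] levy_measure_nu by (simp add: levy_measure_def)
qed

text \<open>No atom is 0 because \<open>\<nu>\<close> has no mass there, so the isolating radius of
  0 bounds all atoms from below. Finiteness of \<open>\<nu>\<close>, finiteness of the set of jumps
  and the stabilization of the truncated integrals all rest on this bound.\<close>

lemma min_jump: obtains \<delta> where "\<delta> > 0" "\<delta> \<le> 1" "\<And>i. \<delta> \<le> \<bar>x i\<bar>"
proof -
  obtain \<rho> where "\<rho> > 0" "\<And>j. x j \<noteq> 0 \<Longrightarrow> \<rho> \<le> \<bar>x j - 0\<bar>" using isolating_radius by blast
  then show ?thesis using x_nonzero that[of "min \<rho> 1"] by (auto simp: min_le_iff_disj)
qed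

lemma finite_nu: "finite_measure \<nu>"
proof
  obtain \<delta> where \<delta>: "\<delta> > 0" "\<delta> \<le> 1" "\<And>i. \<delta> \<le> \<bar>x i\<bar>" using min_jump by blast
  \<comment> \<open>The integrand of the Levy condition is at least the square of
    \<open>\<delta>\<close> at every atom, so its finite integral bounds the total mass; this uses
    \<open>\<delta> \<le> 1\<close>.\<close>
  have "ennreal (\<delta>\<^sup>2) * emeasure \<nu> (space \<nu>) = (\<integral>\<^sup>+y. ennreal (\<delta>\<^sup>2) \<partial>\<nu>)" by simp
  also have "\<dots> \<le> (\<integral>\<^sup>+y. ennreal (min (y\<^sup>2) 1) \<partial>\<nu>)"
  proof (rule nn_integral_mono_AE)
    show "AE y in \<nu>. ennreal (\<delta>\<^sup>2) \<le> ennreal (min (y\<^sup>2) 1)"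
      using AE_range_x
    proof eventually_elim
      case (elim y)
      then have "\<delta> \<le> \<bar>y\<bar>" using \<delta> by auto
      then have "\<delta>\<^sup>2 \<le> y\<^sup>2" using \<delta>(1) power_mono[of \<delta> "\<bar>y\<bar>" 2] by simp
      moreover have "\<delta>\<^sup>2 \<le> 1" using \<delta> by (simp add: power_le_one)
      ultimately show ?case by (simp add: ennreal_leI)
    qed
  qed
  also have "\<dots> < \<infinity>" using levy_measure_nu by (simp add: levy_measure_def)
  finally show "emeasure \<nu> (space \<nu>) \<noteq> \<infinity>" using \<delta>(1) by (auto simp: ennreal_mult_eq_top_iff ennreal_mult_less_top)
qed

definition rate :: "nat \<Rightarrow> real" where "rate i = measure \<nu> {x i}"

lemma emeasure_atom: "emeasure \<nu> {x i} = ennreal (rate i)"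
  unfolding rate_def using finite_measure.emeasure_eq_measure[OF finite_nu] by simp

lemma rate_pos: "rate i > 0"
  using atom_pos[of i] unfolding emeasure_atom by simp

section \<open>Jump times of typical paths\<close>

lemma path_jump_jump: "path_jump (\<lambda>t. Z t \<omega>) r = jump \<omega> r"
  by (simp add: jump_def)

lemma jump_0 [simp]: "jump \<omega> 0 = 0"
  by (simp add: jump_def left_lim_def)

lemma emeasure_N_rect:
  assumes "0 \<le> t" "t \<le> Tm" "A \<in> sets borel" "finite {r\<in>{0<..t}. jump \<omega> r \<noteq> 0 \<and> jump \<omega> r \<in> A}"
  shows "emeasure (N \<omega>) ({0..t} \<times> A) = of_nat (card {r\<in>{0<..t}. jump \<omega> r \<noteq> 0 \<and> jump \<omega> r \<in> A})"
proof -
  let ?D = "{s\<in>{0..Tm}. jump \<omega> s \<noteq> 0}"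
  have m: "{0..t} \<times> A \<in> sets borel" using assms(3) by (intro borel_Times) auto
  have "emeasure (N \<omega>) ({0..t} \<times> A) = emeasure (count_space ?D) ((\<lambda>s. (s, jump \<omega> s)) -` ({0..t} \<times> A) \<inter> space (count_space ?D))"
    unfolding N_def by (rule emeasure_distr) (use m in auto)
  also have "(\<lambda>s. (s, jump \<omega> s)) -` ({0..t} \<times> A) \<inter> space (count_space ?D) = {r\<in>{0<..t}. jump \<omega> r \<noteq> 0 \<and> jump \<omega> r \<in> A}"
    using assms(1,2) by (auto simp: less_le)
  finally show ?thesis using assms(2,4) by (subst (asm) emeasure_count_space_finite) auto
qed

text \<open>Paths that jump only by atoms. Almost every path is of this kind, and on such a path
  every jump sum is a sum over one finite set of jump times.\<close>

definition good :: "'a \<Rightarrow> bool" where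
  "good \<omega> \<longleftrightarrow> \<omega> \<in> space M \<and> (\<forall>r\<in>{0<..Tm}. jump \<omega> r \<noteq> 0 \<longrightarrow> jump \<omega> r \<in> range x)"

lemma nn_integral_N_interval:
  assumes t: "t \<in> {0..Tm}" and "p < q" "0 \<notin> {p..q}"
  shows "(\<integral>\<^sup>+\<omega>. emeasure (N \<omega>) ({0..t} \<times> {p<..<q}) \<partial>M) = ennreal t * emeasure \<nu> {p<..<q}"
  using levy_measure_nu assms unfolding levy_measure_def by (auto simp: closure_greaterThanLessThan)

text \<open>The mean number of jumps into the interval is 0, but that number is not known to be
  measurable, so its vanishing integral does not by itself concern almost every path. The jump sum
  of a bump function is a measurable lower bound of the count and is positive as soon as there is
  one such jump.\<close>

lemma no_jumps_off_support:
  assumes pq: "p < q" "0 \<notin> {p..q}" "{p<..<q} \<inter> range x = {}"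
  shows "AE \<omega> in M. \<forall>r\<in>{0<..Tm}. jump \<omega> r \<notin> {p<..<q}"
proof -
  \<comment> \<open>Positive exactly on the interval and capped at 1, so that its jump sum stays
    below the number of jumps.\<close>
  define g where "g y = min 1 (max 0 ((y - p) * (q - y)))" for y
  have g0: "g y = 0 \<longleftrightarrow> y \<notin> {p<..<q}" for y
  proof -
    have "0 < (y - p) * (q - y) \<longleftrightarrow> y \<in> {p<..<q}" using pq by (auto simp: zero_less_mult_iff)
    then show ?thesis by (auto simp: g_def min_def max_def)
  qed
  have g: "jump_test g" unfolding jump_test_def
  proof
    show "continuous_on UNIV g" unfolding g_def by (intro continuous_intros)
    show "\<exists>\<delta>>0. \<forall>y. \<bar>y\<bar> < \<delta> \<longrightarrow> g y = 0"
      using pq by (intro exI[of _ "min \<bar>p\<bar> \<bar>q\<bar>"]) (auto simp: g0)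
  qed
  have gb: "0 \<le> g y" "g y \<le> 1" for y by (auto simp: g_def)
  have "(\<integral>\<^sup>+\<omega>. ennreal (JS g 0 Tm \<omega>) \<partial>M) \<le> (\<integral>\<^sup>+\<omega>. emeasure (N \<omega>) ({0..Tm} \<times> {p<..<q}) \<partial>M)"
  proof (rule nn_integral_mono)
    fix \<omega> assume \<omega>: "\<omega> \<in> space M"
    have eq: "{r\<in>{0<..Tm}. jump \<omega> r \<noteq> 0 \<and> jump \<omega> r \<in> {p<..<q}} = {r\<in>{0<..Tm}. g (jump \<omega> r) \<noteq> 0}"
      using pq by (auto simp: g0)
    have fin: "finite {r\<in>{0<..Tm}. g (jump \<omega> r) \<noteq> 0}"
      using jump_test_finite[OF g path_cadlag[OF \<omega>] Tm_pos, of 0 Tm] by (simp add: path_jump_jump)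
    have "JS g 0 Tm \<omega> \<le> (\<Sum>r\<in>{r\<in>{0<..Tm}. g (jump \<omega> r) \<noteq> 0}. 1)"
      unfolding JS_def jump_sum_def path_jump_jump using gb by (intro sum_mono) auto
    then show "ennreal (JS g 0 Tm \<omega>) \<le> emeasure (N \<omega>) ({0..Tm} \<times> {p<..<q})"
      using emeasure_N_rect[of Tm "{p<..<q}" \<omega>] fin Tm_pos unfolding eq
      by (simp add: ennreal_of_nat_eq_real_of_nat ennreal_leI)
  qed
  also have "\<dots> = ennreal Tm * emeasure \<nu> {p<..<q}" using Tm_pos pq by (intro nn_integral_N_interval) auto
  also have "emeasure \<nu> {p<..<q} = 0"
    using pq(3) emeasure_compl_support[OF sets_nu] emeasure_mono[of "{p<..<q}" "- range x" \<nu>]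
    by (auto simp: nu_support sets_nu)
  finally have "(\<integral>\<^sup>+\<omega>. ennreal (JS g 0 Tm \<omega>) \<partial>M) = 0" by simp
  then have "AE \<omega> in M. ennreal (JS g 0 Tm \<omega>) = 0"
    using JS_measurable[OF g, of 0 Tm] Tm_pos by (subst (asm) nn_integral_0_iff_AE) auto
  with AE_space show ?thesis
  proof eventually_elim
    case (elim \<omega>)
    have fin: "finite {r\<in>{0<..Tm}. g (jump \<omega> r) \<noteq> 0}"
      using jump_test_finite[OF g path_cadlag[OF elim(1)] Tm_pos, of 0 Tm] by (simp add: path_jump_jump)
    have "JS g 0 Tm \<omega> = 0" using elim(2) JS_nonneg[of g 0 Tm \<omega>] gb by simp
    then have "\<forall>r\<in>{r\<in>{0<..Tm}. g (jump \<omega> r) \<noteq> 0}. g (jump \<omega> r) = 0"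
      unfolding JS_def jump_sum_def path_jump_jump by (subst (asm) sum_nonneg_eq_0_iff[OF fin]) (use gb in auto)
    then show ?case using g0 by auto
  qed
qed

text \<open>A nonzero jump size off the support lies in an interval with rational ends that avoids
  both the atoms and a neighbourhood of 0. There are only countably many such intervals, so their
  exceptional events can be united.\<close>

lemma AE_good: "AE \<omega> in M. good \<omega>"
proof -
  let ?I = "{(p, q). p \<in> \<rat> \<and> q \<in> \<rat> \<and> p < q \<and> 0 \<notin> {p..q} \<and> {p<..<q} \<inter> range x = {}}"
  have "countable ?I" by (rule countable_subset[OF _ countable_SIGMA[OF countable_rat, of "\<lambda>_. \<rat>"]]) (auto simp: countable_rat)
  then have "AE \<omega> in M. \<forall>I\<in>?I. \<forall>r\<in>{0<..Tm}. jump \<omega> r \<notin> {fst I<..<snd I}"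
    unfolding AE_ball_countable[OF \<open>countable ?I\<close>]
  proof (intro ballI)
    show "AE \<omega> in M. \<forall>r\<in>{0<..Tm}. jump \<omega> r \<notin> {fst I<..<snd I}" if "I \<in> ?I" for I
      using that by (intro no_jumps_off_support) auto
  qed
  with AE_space show ?thesis
  proof eventually_elim
    case (elim \<omega>)
    show ?case unfolding good_def
    proof (intro conjI ballI impI elim(1), rule ccontr)
      fix r assume r: "r \<in> {0<..Tm}" "jump \<omega> r \<noteq> 0" "jump \<omega> r \<notin> range x"
      let ?y = "jump \<omega> r"
      obtain \<rho> where \<rho>: "\<rho> > 0" "\<And>j. x j \<noteq> ?y \<Longrightarrow> \<rho> \<le> \<bar>x j - ?y\<bar>" using isolating_radius by blast
      \<comment> \<open>The radius \<open>\<rho>\<close> keeps the interval off the atoms, the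
        distance to 0 keeps its closure off 0.\<close>
      define m where "m = min \<rho> \<bar>?y\<bar>"
      have m: "m > 0" "m \<le> \<rho>" "m \<le> \<bar>?y\<bar>" using \<rho>(1) r by (auto simp: m_def)
      obtain p where p: "p \<in> \<rat>" "?y - m < p" "p < ?y" using Rats_dense_in_real[of "?y - m" ?y] m by auto
      obtain q where q: "q \<in> \<rat>" "?y < q" "q < ?y + m" using Rats_dense_in_real[of ?y "?y + m"] m by auto
      have "(p, q) \<in> ?I"
      proof -
        have "0 \<notin> {p..q}" using p q m(3) by (auto simp: abs_if split: if_splits)
        moreover have "{p<..<q} \<inter> range x = {}"
        proof -
          have "x j \<notin> {p<..<q}" for j
          proof -
            have "x j \<noteq> ?y" using r(3) by (metis rangeI)
            then have "m \<le> \<bar>x j - ?y\<bar>" using \<rho>(2)[of j] m(2) by linarith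
            then show ?thesis using p q by auto
          qed
          then show ?thesis by auto
        qed
        ultimately show ?thesis using p q by auto
      qed
      then have "?y \<notin> {fst (p, q)<..<snd (p, q)}" using elim(2) r(1) by blast
      then show False using p q by simp
    qed
  qed
qed

lemma good_finite:
  assumes "good \<omega>"
  shows "finite {r\<in>{0<..Tm}. jump \<omega> r \<noteq> 0}"
proof -
  obtain \<delta> where \<delta>: "\<delta> > 0" "\<delta> \<le> 1" "\<And>i. \<delta> \<le> \<bar>x i\<bar>" using min_jump by blast
  have "finite {r\<in>{0<..Tm}. \<bar>path_jump (\<lambda>t. Z t \<omega>) r\<bar> \<ge> \<delta>}"
    using assms \<delta> Tm_pos by (intro finite_big_jumps path_cadlag) (auto simp: good_def)
  then show ?thesis unfolding path_jump_jump
    by (rule rev_finite_subset) (use assms \<delta> in \<open>auto simp: good_def\<close>)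
qed

lemma JS_good:
  assumes "good \<omega>" "g 0 = 0" "0 \<le> s" "t \<le> Tm"
  shows "JS g s t \<omega> = (\<Sum>r\<in>{r\<in>{0<..Tm}. jump \<omega> r \<noteq> 0} \<inter> {s<..t}. g (jump \<omega> r))"
  unfolding JS_def using good_finite[OF assms(1)] assms(2-)
  by (subst jump_sum_eq[of "{r\<in>{0<..Tm}. jump \<omega> r \<noteq> 0}"]) (auto simp: path_jump_jump)

section \<open>Jumps sorted by atoms, and mean values\<close>

lemma jump_test_0: "jump_test g \<Longrightarrow> g 0 = 0"
  by (auto simp: jump_test_def)

text \<open>A tent around the atom stands in for the indicator of \<open>{x i}\<close>, which is not
  continuous and hence no \<open>jump_test\<close>. The accompanying interval is the set for which
  the mean of \<open>N\<close> will be evaluated.\<close>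

lemma ex_hat:
  "\<exists>g. jump_test g \<and> (\<forall>y. g y \<ge> 0) \<and> (\<forall>j. g (x j) = (if j = i then 1 else 0)) \<and>
     (\<exists>p q. p < q \<and> 0 \<notin> {p..q} \<and> (\<forall>j. x j \<in> {p<..<q} \<longleftrightarrow> j = i) \<and> emeasure \<nu> {p<..<q} = ennreal (rate i))"
proof -
  obtain \<rho> where \<rho>: "\<rho> > 0" "\<And>j. x j \<noteq> x i \<Longrightarrow> \<rho> \<le> \<bar>x j - x i\<bar>" using isolating_radius by blast
  \<comment> \<open>Half the distance to 0 makes the tent vanish for all \<open>y\<close> with
    absolute value below \<open>d\<close>; the bound by \<open>\<rho>\<close> excludes the other
    atoms.\<close>
  define d where "d = min \<rho> (\<bar>x i\<bar> / 2)"
  have d: "d > 0" "d \<le> \<rho>" "d \<le> \<bar>x i\<bar> / 2" using \<rho>(1) x_nonzero[of i] by (auto simp: d_def)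
  define g where "g y = max 0 (1 - \<bar>y - x i\<bar> / d)" for y
  have iso: "\<bar>x j - x i\<bar> < d \<longleftrightarrow> j = i" for j
  proof (cases "j = i")
    case False
    then have "x j \<noteq> x i" using injD[OF x_inj] by blast
    then have "\<rho> \<le> \<bar>x j - x i\<bar>" by (rule \<rho>(2))
    then show ?thesis using False d by auto
  qed (use d in auto)
  have g0: "g y = 0" if "d \<le> \<bar>y - x i\<bar>" for y using that d by (simp add: g_def)
  have "jump_test g" unfolding jump_test_def
  proof
    show "continuous_on UNIV g" unfolding g_def using d by (intro continuous_intros) auto
    show "\<exists>\<delta>>0. \<forall>y. \<bar>y\<bar> < \<delta> \<longrightarrow> g y = 0"
      using d by (intro exI[of _ d] conjI allI impI g0) auto
  qed
  moreover have "g (x j) = (if j = i then 1 else 0)" for j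
    using iso[of j] g0[of "x j"] by (auto simp: g_def not_less)
  moreover have "x i - d < x i + d" "0 \<notin> {x i - d..x i + d}" using d by (auto simp: abs_if split: if_splits)
  moreover have "x j \<in> {x i - d<..<x i + d} \<longleftrightarrow> j = i" for j using iso[of j] by auto
  moreover have "emeasure \<nu> {x i - d<..<x i + d} = ennreal (rate i)"
    using ball_atom[OF \<rho>(2) \<rho>(1) d(2,1)] emeasure_atom by simp
  moreover have "g y \<ge> 0" for y by (simp add: g_def)
  ultimately show ?thesis by metis
qed

definition hat :: "nat \<Rightarrow> real \<Rightarrow> real" where
  "hat i = (SOME g. jump_test g \<and> (\<forall>y. g y \<ge> 0) \<and> (\<forall>j. g (x j) = (if j = i then 1 else 0)) \<and>
     (\<exists>q r. q < r \<and> 0 \<notin> {q..r} \<and> (\<forall>j. x j \<in> {q<..<r} \<longleftrightarrow> j = i) \<and> emeasure \<nu> {q<..<r} = ennreal (rate i)))"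

lemma hat_props: "jump_test (hat i) \<and> (\<forall>y. hat i y \<ge> 0) \<and> (\<forall>j. hat i (x j) = (if j = i then 1 else 0)) \<and>
     (\<exists>q r. q < r \<and> 0 \<notin> {q..r} \<and> (\<forall>j. x j \<in> {q<..<r} \<longleftrightarrow> j = i) \<and> emeasure \<nu> {q<..<r} = ennreal (rate i))"
  unfolding hat_def by (rule someI_ex[OF ex_hat])

lemma hat: "jump_test (hat i)" "hat i y \<ge> 0" "hat i (x j) = (if j = i then 1 else 0)"
  using hat_props[of i] by auto

lemma JS_hat:
  assumes "good \<omega>" "0 \<le> s" "t \<le> Tm"
  shows "JS (hat i) s t \<omega> = real (card {r\<in>{s<..t}. jump \<omega> r = x i})"
proof -
  let ?D = "{r\<in>{0<..Tm}. jump \<omega> r \<noteq> 0}"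
  have "JS (hat i) s t \<omega> = (\<Sum>r\<in>?D \<inter> {s<..t}. hat i (jump \<omega> r))"
    using assms by (intro JS_good jump_test_0 hat)
  also have "\<dots> = (\<Sum>r\<in>?D \<inter> {s<..t}. if jump \<omega> r = x i then 1 else 0)"
  proof (rule sum.cong)
    fix r assume "r \<in> ?D \<inter> {s<..t}"
    then obtain j where "jump \<omega> r = x j" using assms(1) by (auto simp: good_def)
    then show "hat i (jump \<omega> r) = (if jump \<omega> r = x i then 1 else 0)" using hat(3)[of i j] injD[OF x_inj, of j i] by auto
  qed simp
  also have "\<dots> = real (card {r\<in>?D \<inter> {s<..t}. jump \<omega> r = x i})"
    using good_finite[OF assms(1)] by (subst sum.inter_filter[symmetric]) auto
  also have "{r\<in>?D \<inter> {s<..t}. jump \<omega> r = x i} = {r\<in>{s<..t}. jump \<omega> r = x i}"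
    using assms x_nonzero by auto
  finally show ?thesis .
qed

lemma nn_integral_JS_hat:
  assumes t: "t \<in> {0..Tm}"
  shows "(\<integral>\<^sup>+\<omega>. ennreal (JS (hat i) 0 t \<omega>) \<partial>M) = ennreal t * ennreal (rate i)"
proof -
  obtain q r where qr: "q < r" "0 \<notin> {q..r}" "\<And>j. x j \<in> {q<..<r} \<longleftrightarrow> j = i" "emeasure \<nu> {q<..<r} = ennreal (rate i)"
    using hat_props[of i] by blast
  have "(\<integral>\<^sup>+\<omega>. ennreal (JS (hat i) 0 t \<omega>) \<partial>M) = (\<integral>\<^sup>+\<omega>. emeasure (N \<omega>) ({0..t} \<times> {q<..<r}) \<partial>M)"
  proof (rule nn_integral_cong_AE)
    show "AE \<omega> in M. ennreal (JS (hat i) 0 t \<omega>) = emeasure (N \<omega>) ({0..t} \<times> {q<..<r})"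
      using AE_good
    proof eventually_elim
      case (elim \<omega>)
      have eq: "{u\<in>{0<..t}. jump \<omega> u \<noteq> 0 \<and> jump \<omega> u \<in> {q<..<r}} = {u\<in>{0<..t}. jump \<omega> u = x i}"
      proof (intro Collect_cong conj_cong refl iffI)
        fix u assume u: "u \<in> {0<..t}" "jump \<omega> u \<noteq> 0 \<and> jump \<omega> u \<in> {q<..<r}"
        then obtain j where j: "jump \<omega> u = x j" using elim t by (force simp: good_def)
        then have "j = i" using qr(3)[of j] u by simp
        then show "jump \<omega> u = x i" using j by simp
      next
        fix u assume "jump \<omega> u = x i"
        then show "jump \<omega> u \<noteq> 0 \<and> jump \<omega> u \<in> {q<..<r}" using qr(3)[of i] x_nonzero[of i] by simp
      qed
      have "finite {u\<in>{0<..t}. jump \<omega> u \<noteq> 0 \<and> jump \<omega> u \<in> {q<..<r}}"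
        by (rule finite_subset[OF _ good_finite[OF elim]]) (use t in auto)
      then show ?case
        using t elim emeasure_N_rect[of t "{q<..<r}" \<omega>] unfolding eq
        by (simp add: JS_hat ennreal_of_nat_eq_real_of_nat)
    qed
  qed
  also have "\<dots> = ennreal t * ennreal (rate i)" using nn_integral_N_interval[OF t qr(1,2)] qr(4) by simp
  finally show ?thesis .
qed

text \<open>At each jump exactly one tent has value 1 and the others are 0. Sorting the jumps by
  size thus reduces the mean of a jump sum to the counts \<open>JS (hat i)\<close>, whose means the
  Levy measure provides.\<close>

lemma JS_atoms:
  assumes "good \<omega>" "jump_test g" "\<And>y. g y \<ge> 0" "0 \<le> s" "t \<le> Tm"
  shows "ennreal (JS g s t \<omega>) = (\<Sum>i. ennreal (g (x i)) * ennreal (JS (hat i) s t \<omega>))"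
proof -
  let ?D = "{r\<in>{0<..Tm}. jump \<omega> r \<noteq> 0} \<inter> {s<..t}"
  have one: "(\<Sum>i. ennreal (g (x i)) * ennreal (hat i (jump \<omega> r))) = ennreal (g (jump \<omega> r))" if "r \<in> ?D" for r
  proof -
    have "jump \<omega> r \<in> range x" using that assms(1) by (simp add: good_def)
    then obtain j where j: "jump \<omega> r = x j" by blast
    have "(\<Sum>i. ennreal (g (x i)) * ennreal (hat i (x j))) = (\<Sum>i\<in>{j}. ennreal (g (x i)) * ennreal (hat i (x j)))"
      by (rule suminf_finite) (auto simp: hat)
    then show ?thesis by (simp add: j hat)
  qed
  have "ennreal (JS g s t \<omega>) = (\<Sum>r\<in>?D. ennreal (g (jump \<omega> r)))"
    using assms by (subst JS_good) (auto simp: jump_test_0 sum_ennreal)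
  also have "\<dots> = (\<Sum>r\<in>?D. \<Sum>i. ennreal (g (x i)) * ennreal (hat i (jump \<omega> r)))"
    using one by (intro sum.cong) auto
  also have "\<dots> = (\<Sum>i. \<Sum>r\<in>?D. ennreal (g (x i)) * ennreal (hat i (jump \<omega> r)))"
    by (rule suminf_sum[symmetric]) (rule summableI)
  also have "(\<lambda>i. \<Sum>r\<in>?D. ennreal (g (x i)) * ennreal (hat i (jump \<omega> r))) = (\<lambda>i. ennreal (g (x i)) * ennreal (JS (hat i) s t \<omega>))"
    using assms by (simp add: sum_distrib_left[symmetric] JS_good jump_test_0 hat sum_ennreal)
  finally show ?thesis .
qed

text \<open>The Levy measure prescribes means for time intervals starting at 0. The formula is
  therefore proved there by summing over atoms, and a general interval is a difference of two of
  these.\<close>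

lemma JS_mean:
  assumes g: "jump_test g" "\<And>y. g y \<ge> 0" and sm: "summable (\<lambda>i. g (x i) * rate i)"
    and st: "0 \<le> s" "s \<le> t" "t \<le> Tm"
  shows "integrable M (JS g s t)" and "expectation (JS g s t) = (t - s) * (\<Sum>i. g (x i) * rate i)"
proof -
  have rate0: "rate i \<ge> 0" for i using rate_pos[of i] by simp
  have *: "integrable M (JS g 0 t) \<and> expectation (JS g 0 t) = t * (\<Sum>i. g (x i) * rate i)" if t: "t \<in> {0..Tm}" for t
  proof -
    note [measurable] = JS_measurable[OF g(1), of 0 t] JS_measurable[OF hat(1), of 0 t]
    have "(\<integral>\<^sup>+\<omega>. ennreal (JS g 0 t \<omega>) \<partial>M) = (\<integral>\<^sup>+\<omega>. (\<Sum>i. ennreal (g (x i)) * ennreal (JS (hat i) 0 t \<omega>)) \<partial>M)"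
    proof (rule nn_integral_cong_AE)
      show "AE \<omega> in M. ennreal (JS g 0 t \<omega>) = (\<Sum>i. ennreal (g (x i)) * ennreal (JS (hat i) 0 t \<omega>))"
        using AE_good by eventually_elim (use t g in \<open>intro JS_atoms; auto\<close>)
    qed
    also have "\<dots> = (\<Sum>i. \<integral>\<^sup>+\<omega>. ennreal (g (x i)) * ennreal (JS (hat i) 0 t \<omega>) \<partial>M)"
      using t by (intro nn_integral_suminf) measurable
    also have "\<dots> = (\<Sum>i. ennreal (t * (g (x i) * rate i)))"
      using t g rate0 by (subst nn_integral_cmult) (auto simp: nn_integral_JS_hat ennreal_mult' ac_simps)
    also have "\<dots> = ennreal (t * (\<Sum>i. g (x i) * rate i))"
      using t g rate0 sm by (subst suminf_ennreal2) (auto simp: suminf_mult intro!: mult_nonneg_nonneg summable_mult)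
    finally have e: "(\<integral>\<^sup>+\<omega>. ennreal (JS g 0 t \<omega>) \<partial>M) = ennreal (t * (\<Sum>i. g (x i) * rate i))" .
    have n: "t * (\<Sum>i. g (x i) * rate i) \<ge> 0" using t g rate0 sm by (auto intro!: mult_nonneg_nonneg suminf_nonneg)
    have m: "JS g 0 t \<in> borel_measurable M" using JS_measurable[OF g(1), of 0 t] t by simp
    have "integrable M (JS g 0 t)"
      using e m t JS_nonneg[OF g(2)] by (intro integrableI_nonneg) auto
    moreover have "expectation (JS g 0 t) = t * (\<Sum>i. g (x i) * rate i)"
      using e n m JS_nonneg[OF g(2)] by (subst integral_eq_nn_integral) auto
    ultimately show ?thesis by simp
  qed
  have s: "s \<in> {0..Tm}" "t \<in> {0..Tm}" using st by auto
  have eq: "JS g s t \<omega> = JS g 0 t \<omega> - JS g 0 s \<omega>" if "\<omega> \<in> space M" for \<omega>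
    using JS_add[OF g(1) that, of 0 s t] st by simp
  have int: "integrable M (\<lambda>\<omega>. JS g 0 t \<omega> - JS g 0 s \<omega>)" using *[OF s(1)] *[OF s(2)] by auto
  then show "integrable M (JS g s t)" by (subst Bochner_Integration.integrable_cong[OF refl eq]) auto
  have "expectation (JS g s t) = expectation (\<lambda>\<omega>. JS g 0 t \<omega> - JS g 0 s \<omega>)"
    by (rule Bochner_Integration.integral_cong[OF refl eq]) auto
  also have "\<dots> = (t - s) * (\<Sum>i. g (x i) * rate i)" using *[OF s(1)] *[OF s(2)] by (simp add: left_diff_distrib)
  finally show "expectation (JS g s t) = (t - s) * (\<Sum>i. g (x i) * rate i)" .
qed

lemma JS_hat_mean:
  assumes st: "0 \<le> s" "s \<le> t" "t \<le> Tm"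
  shows "integrable M (JS (hat i) s t)" and "expectation (JS (hat i) s t) = (t - s) * rate i"
proof -
  have s: "(\<lambda>j. hat i (x j) * rate j) sums (\<Sum>j\<in>{i}. hat i (x j) * rate j)"
    by (rule sums_finite) (auto simp: hat)
  show "integrable M (JS (hat i) s t)" using JS_mean(1)[OF hat(1,2) sums_summable[OF s] st] .
  show "expectation (JS (hat i) s t) = (t - s) * rate i"
    using JS_mean(2)[OF hat(1,2) sums_summable[OF s] st] sums_unique[OF s] by (simp add: hat)
qed

text \<open>Once the mesh is below the least distance between jump times, a block contains at most
  one jump, so the square of its jump sum is the jump sum of the square. Adding block after block
  leaves the mixed terms of past and block. The threshold for \<open>n\<close> depends on the
  path.\<close>

lemma JS_square:
  assumes g: "jump_test g" and \<omega>: "good \<omega>"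
  shows "eventually (\<lambda>n. (JS g 0 Tm \<omega>)\<^sup>2 = JS (\<lambda>y. (g y)\<^sup>2) 0 Tm \<omega> +
     (\<Sum>k<Suc n. 2 * (JS g 0 (grid 0 Tm n k) \<omega> * JS g (grid 0 Tm n k) (grid 0 Tm n (Suc k)) \<omega>))) sequentially"
proof -
  let ?D = "{r\<in>{0<..Tm}. jump \<omega> r \<noteq> 0}"
  have fin: "finite ?D" by (rule good_finite[OF \<omega>])
  obtain d where d: "d > 0" "\<And>r q. r \<in> ?D \<Longrightarrow> q \<in> ?D \<Longrightarrow> r \<noteq> q \<Longrightarrow> d \<le> \<bar>r - q\<bar>"
    by (rule finite_separated[OF fin]) blast
  have \<omega>M: "\<omega> \<in> space M" using \<omega> by (simp add: good_def)
  show ?thesis using grid_mesh_small[OF d(1), of 0 Tm]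
  proof eventually_elim
    case (elim n)
    let ?t = "grid 0 Tm n"
    have rng: "0 \<le> ?t k" "?t k \<le> ?t (Suc k)" "?t (Suc k) \<le> Tm" if "k < Suc n" for k
      using grid_range[of 0 Tm k n] grid_range[of 0 Tm "Suc k" n] grid_mono[of 0 Tm k "Suc k" n] that Tm_pos by auto
    have blk: "(JS g (?t k) (?t (Suc k)) \<omega>)\<^sup>2 = JS (\<lambda>y. (g y)\<^sup>2) (?t k) (?t (Suc k)) \<omega>" if k: "k < Suc n" for k
    proof -
      define B where "B = ?D \<inter> {?t k<..?t (Suc k)}"
      have one: "r = q" if "r \<in> B" "q \<in> B" for r q
      proof (rule ccontr)
        assume "r \<noteq> q"
        then have "d \<le> \<bar>r - q\<bar>" using that by (intro d(2)) (auto simp: B_def)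
        moreover have "\<bar>r - q\<bar> < d" using that elim[rule_format, of k] by (auto simp: B_def)
        ultimately show False by simp
      qed
      have js: "JS f (?t k) (?t (Suc k)) \<omega> = (\<Sum>r\<in>B. f (jump \<omega> r))" if "f 0 = 0" for f
        unfolding B_def using rng[OF k] by (intro JS_good \<omega> that)
      consider "B = {}" | r where "B = {r}" using one by blast
      then show ?thesis using jump_test_0[OF g] by cases (simp_all add: js)
    qed
    have sq: "(JS g 0 (?t m) \<omega>)\<^sup>2 = JS (\<lambda>y. (g y)\<^sup>2) 0 (?t m) \<omega> +
        (\<Sum>k<m. 2 * (JS g 0 (?t k) \<omega> * JS g (?t k) (?t (Suc k)) \<omega>))" if "m \<le> Suc n" for m
      using that
    proof (induction m)
      case 0
      then show ?case by (simp add: JS_def jump_sum_def)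
    next
      case (Suc m)
      have g2: "jump_test (\<lambda>y. (g y)\<^sup>2)" using g unfolding jump_test_def by (auto intro!: continuous_intros)
      have m: "m < Suc n" using Suc by simp
      have "JS g 0 (?t (Suc m)) \<omega> = JS g 0 (?t m) \<omega> + JS g (?t m) (?t (Suc m)) \<omega>"
        using rng[OF m] by (intro JS_add[OF g \<omega>M]) auto
      moreover have "JS (\<lambda>y. (g y)\<^sup>2) 0 (?t (Suc m)) \<omega> = JS (\<lambda>y. (g y)\<^sup>2) 0 (?t m) \<omega> + JS (\<lambda>y. (g y)\<^sup>2) (?t m) (?t (Suc m)) \<omega>"
        using rng[OF m] by (intro JS_add[OF g2 \<omega>M]) auto
      ultimately show ?case using Suc blk[OF m] by (simp add: power2_sum)
    qed
    show ?case using sq[of "Suc n"] by simp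
  qed
qed

text \<open>In each mixed term of \<open>JS_square\<close> the past is independent in mean of the
  block, so the integral is a product of two means; with blocks of length
  \<open>Tm / real (Suc n)\<close> all mixed terms together stay bounded in \<open>n\<close>. Since
  the decomposition holds only from a path-dependent \<open>n\<close> on, the bound reaches the
  square through Fatou's lemma.\<close>

lemma JS_square_integrable:
  assumes g: "jump_test g" "\<And>y. g y \<ge> 0" and sm: "summable (\<lambda>i. g (x i) * rate i)" "summable (\<lambda>i. (g (x i))\<^sup>2 * rate i)"
  shows "integrable M (\<lambda>\<omega>. (JS g 0 Tm \<omega>)\<^sup>2)"
proof -
  let ?g2 = "\<lambda>y. (g y)\<^sup>2"
  define C where "C = (\<Sum>i. g (x i) * rate i)"
  have C0: "C \<ge> 0" unfolding C_def using g rate_pos by (intro suminf_nonneg sm) (auto simp: less_imp_le)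
  have g2: "jump_test ?g2" "\<And>y. ?g2 y \<ge> 0" using g(1) unfolding jump_test_def by (auto intro!: continuous_intros)
  let ?O = "\<lambda>n \<omega>. \<Sum>k<Suc n. 2 * (ennreal (JS g 0 (grid 0 Tm n k) \<omega>) * ennreal (JS g (grid 0 Tm n k) (grid 0 Tm n (Suc k)) \<omega>))"
  let ?F = "\<lambda>n \<omega>. ennreal (JS ?g2 0 Tm \<omega>) + ?O n \<omega>"
  have J0: "JS g s t \<omega> \<ge> 0" "JS ?g2 s t \<omega> \<ge> 0" for s t \<omega> using JS_nonneg g g2 by auto
  have rng: "0 \<le> grid 0 Tm n k" "grid 0 Tm n k \<le> grid 0 Tm n (Suc k)" "grid 0 Tm n (Suc k) \<le> Tm" if "k < Suc n" for k n
    using grid_range[of 0 Tm k n] grid_range[of 0 Tm "Suc k" n] grid_mono[of 0 Tm k "Suc k" n] that Tm_pos by auto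
  have meas: "(\<lambda>\<omega>. ennreal (JS g 0 (grid 0 Tm n k) \<omega>)) \<in> borel_measurable (Filt (grid 0 Tm n k))"
     "(\<lambda>\<omega>. ennreal (JS g 0 (grid 0 Tm n k) \<omega>)) \<in> borel_measurable M"
     "(\<lambda>\<omega>. ennreal (JS g (grid 0 Tm n k) (grid 0 Tm n (Suc k)) \<omega>)) \<in> borel_measurable M" if "k < Suc n" for k n
  proof -
    have "JS g 0 (grid 0 Tm n k) \<in> borel_measurable (Filt (grid 0 Tm n k))"
      using rng[OF that] by (intro Past_measurable_Filt JS_Past g) auto
    then show "(\<lambda>\<omega>. ennreal (JS g 0 (grid 0 Tm n k) \<omega>)) \<in> borel_measurable (Filt (grid 0 Tm n k))" by measurable
    have "JS g 0 (grid 0 Tm n k) \<in> borel_measurable M" "JS g (grid 0 Tm n k) (grid 0 Tm n (Suc k)) \<in> borel_measurable M"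
      using rng[OF that] by (intro JS_measurable g; simp)+
    then show "(\<lambda>\<omega>. ennreal (JS g 0 (grid 0 Tm n k) \<omega>)) \<in> borel_measurable M"
     "(\<lambda>\<omega>. ennreal (JS g (grid 0 Tm n k) (grid 0 Tm n (Suc k)) \<omega>)) \<in> borel_measurable M" by measurable
  qed
  have m2: "(\<lambda>\<omega>. ennreal (JS ?g2 0 Tm \<omega>)) \<in> borel_measurable M" using JS_measurable[OF g2(1), of 0 Tm] Tm_pos by auto
  have mO: "?O n \<in> borel_measurable M" for n
    by (intro borel_measurable_sum borel_measurable_times_ennreal borel_measurable_const meas) auto
  have block: "(\<integral>\<^sup>+\<omega>. 2 * (ennreal (JS g 0 (grid 0 Tm n k) \<omega>) * ennreal (JS g (grid 0 Tm n k) (grid 0 Tm n (Suc k)) \<omega>)) \<partial>M)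
      \<le> ennreal (2 * C\<^sup>2 * Tm * (Tm / real (Suc n)))" if k: "k < Suc n" for n k
  proof -
    let ?u = "grid 0 Tm n k" and ?v = "grid 0 Tm n (Suc k)"
    have "(\<integral>\<^sup>+\<omega>. 2 * (ennreal (JS g 0 ?u \<omega>) * ennreal (JS g ?u ?v \<omega>)) \<partial>M) =
        2 * (\<integral>\<^sup>+\<omega>. ennreal (JS g 0 ?u \<omega>) * ennreal (JS g ?u ?v \<omega>) \<partial>M)"
      by (intro nn_integral_cmult borel_measurable_times_ennreal meas k)
    also have "(\<integral>\<^sup>+\<omega>. ennreal (JS g 0 ?u \<omega>) * ennreal (JS g ?u ?v \<omega>) \<partial>M) =
        (\<integral>\<^sup>+\<omega>. ennreal (JS g 0 ?u \<omega>) \<partial>M) * ennreal (expectation (JS g ?u ?v))"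
      by (rule nn_mean_indep[OF g rng[OF k] meas(1)[OF k] JS_mean(1)[OF g sm(1) rng[OF k]]])
    also have "expectation (JS g ?u ?v) = Tm / real (Suc n) * C"
      unfolding C_def by (subst JS_mean(2)[OF g sm(1) rng[OF k]]) (simp only: grid_diff diff_zero)
    also have "(\<integral>\<^sup>+\<omega>. ennreal (JS g 0 ?u \<omega>) \<partial>M) = ennreal (expectation (JS g 0 ?u))"
      using rng[OF k] J0 by (intro nn_integral_eq_integral JS_mean(1)[OF g sm(1)]) auto
    also have "expectation (JS g 0 ?u) = ?u * C"
      unfolding C_def using rng[OF k] by (subst JS_mean(2)[OF g sm(1)]) auto
    also have "2 * (ennreal (?u * C) * ennreal (Tm / real (Suc n) * C)) = ennreal (2 * (?u * C * (Tm / real (Suc n) * C)))"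
    proof -
      have *: "2 * (ennreal a * ennreal b) = ennreal (2 * (a * b))" if "0 \<le> a" "0 \<le> b" for a b :: real
        using that by (simp add: ennreal_mult)
      show ?thesis using rng[OF k] C0 Tm_pos by (intro *) auto
    qed
    also have "\<dots> \<le> ennreal (2 * C\<^sup>2 * Tm * (Tm / real (Suc n)))"
    proof (rule ennreal_leI)
      have "?u * (2 * C\<^sup>2 * (Tm / real (Suc n))) \<le> Tm * (2 * C\<^sup>2 * (Tm / real (Suc n)))"
        using rng[OF k] Tm_pos by (intro mult_right_mono) auto
      then show "2 * (?u * C * (Tm / real (Suc n) * C)) \<le> 2 * C\<^sup>2 * Tm * (Tm / real (Suc n))"
        by (simp only: power2_eq_square ac_simps)
    qed
    finally show ?thesis .
  qed
  define K where "K = ennreal (expectation (JS ?g2 0 Tm)) + ennreal (2 * C\<^sup>2 * Tm * Tm)"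
  have bnd: "(\<integral>\<^sup>+\<omega>. ?F n \<omega> \<partial>M) \<le> K" for n
  proof -
    have "(\<integral>\<^sup>+\<omega>. ?F n \<omega> \<partial>M) = (\<integral>\<^sup>+\<omega>. ennreal (JS ?g2 0 Tm \<omega>) \<partial>M) + (\<integral>\<^sup>+\<omega>. ?O n \<omega> \<partial>M)"
      by (intro nn_integral_add m2 mO)
    moreover have "(\<integral>\<^sup>+\<omega>. ennreal (JS ?g2 0 Tm \<omega>) \<partial>M) = ennreal (expectation (JS ?g2 0 Tm))"
      using Tm_pos J0 by (intro nn_integral_eq_integral JS_mean(1)[OF g2 sm(2)]) auto
    moreover have "(\<integral>\<^sup>+\<omega>. ?O n \<omega> \<partial>M) \<le> (\<Sum>k<Suc n. ennreal (2 * C\<^sup>2 * Tm * (Tm / real (Suc n))))"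
    proof (subst nn_integral_sum)
      show "(\<lambda>\<omega>. 2 * (ennreal (JS g 0 (grid 0 Tm n k) \<omega>) * ennreal (JS g (grid 0 Tm n k) (grid 0 Tm n (Suc k)) \<omega>)))
          \<in> borel_measurable M" if "k \<in> {..<Suc n}" for k
        using that by (intro borel_measurable_times_ennreal meas) auto
    qed (intro sum_mono block, simp)
    moreover have "(\<Sum>k<Suc n. ennreal (2 * C\<^sup>2 * Tm * (Tm / real (Suc n)))) = ennreal (2 * C\<^sup>2 * Tm * Tm)"
    proof -
      have "real (Suc n) * (2 * C\<^sup>2 * Tm * (Tm / real (Suc n))) = 2 * C\<^sup>2 * Tm * Tm" by simp
      then show ?thesis using Tm_pos by (subst sum_ennreal) (simp_all del: of_nat_Suc sum.lessThan_Suc)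
    qed
    ultimately show ?thesis unfolding K_def by (simp only: add_left_mono)
  qed
  have "(\<integral>\<^sup>+\<omega>. ennreal ((JS g 0 Tm \<omega>)\<^sup>2) \<partial>M) \<le> (\<integral>\<^sup>+\<omega>. liminf (\<lambda>n. ?F n \<omega>) \<partial>M)"
  proof (rule nn_integral_mono_AE)
    show "AE \<omega> in M. ennreal ((JS g 0 Tm \<omega>)\<^sup>2) \<le> liminf (\<lambda>n. ?F n \<omega>)"
      using AE_good
    proof eventually_elim
      case (elim \<omega>)
      have "eventually (\<lambda>n. ennreal ((JS g 0 Tm \<omega>)\<^sup>2) \<le> ?F n \<omega>) sequentially"
        using JS_square[OF g(1) elim]
      proof eventually_elim
        case (elim n)
        have "?O n \<omega> = ennreal (\<Sum>k<Suc n. 2 * (JS g 0 (grid 0 Tm n k) \<omega> * JS g (grid 0 Tm n k) (grid 0 Tm n (Suc k)) \<omega>))"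
          using J0 by (subst sum_ennreal[symmetric]) (auto simp: ennreal_mult' simp del: sum.lessThan_Suc)
        then show ?case unfolding elim using J0
          by (subst ennreal_plus) (auto intro!: sum_nonneg simp del: sum.lessThan_Suc ennreal_plus)
      qed
      then show ?case by (rule Liminf_bounded)
    qed
  qed
  also have "\<dots> \<le> liminf (\<lambda>n. \<integral>\<^sup>+\<omega>. ?F n \<omega> \<partial>M)"
    by (intro nn_integral_liminf borel_measurable_add m2 mO)
  also have "\<dots> \<le> K" using bnd by (intro Liminf_le) (auto simp del: sum.lessThan_Suc)
  also have "K < \<infinity>" by (simp add: K_def)
  finally show ?thesis using JS_measurable[OF g(1), of 0 Tm] Tm_pos by (intro integrableI_nonneg) auto
qed

end

section \<open>Compensation formula\<close>

text \<open>For each tolerance the exceptional events have probabilities tending to 0, so almost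
  every path escapes one of them beyond \<open>n0\<close>. This gives uniform convergence along a
  path-dependent subsequence, which preserves continuity. Subtracting \<open>J\<close> makes the
  argument available for processes whose jumps agree with those of \<open>J\<close> from
  \<open>n0\<close> on.\<close>

lemma ucp_limit_continuous:
  assumes M: "prob_space M" and ucp: "ucp_tendsto M Tm X Y"
    and cont: "\<And>n. n \<ge> n0 \<Longrightarrow> AE \<omega> in M. continuous_on {0..Tm} (\<lambda>t. X n t \<omega> - J t \<omega>)"
  shows "AE \<omega> in M. continuous_on {0..Tm} (\<lambda>t. Y t \<omega> - J t \<omega>)"
proof -
  interpret prob_space M by fact
  have "\<exists>E. (\<forall>n. E n \<in> sets M) \<and> (\<lambda>n. prob (E n)) \<longlonglongrightarrow> 0 \<and>
        (\<forall>n. \<forall>\<omega>\<in>space M - E n. \<forall>t\<in>{0..Tm}. \<bar>X n t \<omega> - Y t \<omega>\<bar> \<le> 1 / real (Suc m))" for m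
    using ucp unfolding ucp_tendsto_def by (meson of_nat_0_less_iff zero_less_Suc zero_less_divide_1_iff)
  then obtain E where E: "\<And>m n. E m n \<in> sets M" "\<And>m. (\<lambda>n. prob (E m n)) \<longlonglongrightarrow> 0"
    "\<And>m n \<omega> t. \<omega> \<in> space M - E m n \<Longrightarrow> t \<in> {0..Tm} \<Longrightarrow> \<bar>X n t \<omega> - Y t \<omega>\<bar> \<le> 1 / real (Suc m)"
    by metis
  have "AE \<omega> in M. \<forall>m. \<exists>n\<ge>n0. \<omega> \<notin> E m n"
    unfolding AE_all_countable
  proof
    fix m
    have "prob (\<Inter>n\<in>{n0..}. E m n) \<le> 0"
    proof (rule LIMSEQ_le_const[OF E(2)], intro exI allI impI)
      show "prob (\<Inter>n\<in>{n0..}. E m n) \<le> prob (E m n)" if "n0 \<le> n" for n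
        using that E(1) by (intro finite_measure_mono) auto
    qed
    then have "prob (\<Inter>n\<in>{n0..}. E m n) = 0" using measure_nonneg[of M "\<Inter>n\<in>{n0..}. E m n"] by linarith
    then have "(\<Inter>n\<in>{n0..}. E m n) \<in> null_sets M"
      using E(1) by (auto simp: null_sets_def emeasure_eq_measure intro!: sets.countable_INT'')
    then have "AE \<omega> in M. \<omega> \<notin> (\<Inter>n\<in>{n0..}. E m n)" by (rule AE_not_in)
    then show "AE \<omega> in M. \<exists>n\<ge>n0. \<omega> \<notin> E m n" by eventually_elim auto
  qed
  moreover have "AE \<omega> in M. \<forall>n. n \<ge> n0 \<longrightarrow> continuous_on {0..Tm} (\<lambda>t. X n t \<omega> - J t \<omega>)"
    unfolding AE_all_countable using cont by auto
  ultimately show ?thesis using AE_space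
  proof eventually_elim
    case (elim \<omega>)
    obtain n where n: "\<And>m. n m \<ge> n0" "\<And>m. \<omega> \<notin> E m (n m)" using elim(1) by metis
    show ?case
    proof (rule uniform_limit_theorem[where F = sequentially and f = "\<lambda>m t. X (n m) t \<omega> - J t \<omega>"])
      show "\<forall>\<^sub>F m in sequentially. continuous_on {0..Tm} (\<lambda>t. X (n m) t \<omega> - J t \<omega>)"
        using elim(2) n(1) by auto
      show "uniform_limit {0..Tm} (\<lambda>m t. X (n m) t \<omega> - J t \<omega>) (\<lambda>t. Y t \<omega> - J t \<omega>) sequentially"
      proof (rule uniform_limitI)
        fix e :: real assume "e > 0"
        have "(\<lambda>m. 1 / real (Suc m)) \<longlonglongrightarrow> 0" by (intro LIMSEQ_Suc[OF lim_const_over_n])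
        then have "\<forall>\<^sub>F m in sequentially. 1 / real (Suc m) < e" using \<open>e > 0\<close> by (rule order_tendstoD)
        then show "\<forall>\<^sub>F m in sequentially. \<forall>t\<in>{0..Tm}. dist (X (n m) t \<omega> - J t \<omega>) (Y t \<omega> - J t \<omega>) < e"
        proof eventually_elim
          case (elim m)
          show ?case
          proof
            fix t assume "t \<in> {0..Tm}"
            then have "\<bar>X (n m) t \<omega> - Y t \<omega>\<bar> \<le> 1 / real (Suc m)"
              using n(2)[of m] \<open>\<omega> \<in> space M\<close> by (intro E(3)) auto
            then show "dist (X (n m) t \<omega> - J t \<omega>) (Y t \<omega> - J t \<omega>) < e" using elim by (simp add: dist_real_def)
          qed
        qed
      qed
    qed simp
  qed
qed

context levy_setting
begin

text \<open>Integrals of simple integrands are finite combinations of stopped paths of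
  \<open>W\<close>; the limit theorem applies with \<open>J\<close> equal to 0.\<close>

lemma wiener_integral_continuous:
  assumes W: "AE \<omega> in M. continuous_on {0..Tm} (\<lambda>t. W t \<omega>)" and I: "is_wiener_integral W \<phi> I"
  shows "AE \<omega> in M. continuous_on {0..Tm} (\<lambda>t. I t \<omega>)"
proof -
  obtain n \<tau> \<xi> where si: "\<And>k. simple_integrand (n k) (\<tau> k) (\<xi> k)"
    and ucp: "ucp_tendsto M Tm (\<lambda>k. simple_integral W (n k) (\<tau> k) (\<xi> k)) I"
    using I unfolding is_wiener_integral_def by blast
  have "AE \<omega> in M. continuous_on {0..Tm} (\<lambda>t. I t \<omega> - 0)"
  proof (rule ucp_limit_continuous[OF prob_space_axioms ucp])
    fix k
    show "AE \<omega> in M. continuous_on {0..Tm} (\<lambda>t. simple_integral W (n k) (\<tau> k) (\<xi> k) t \<omega> - 0)"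
      using W
    proof eventually_elim
      case (elim \<omega>)
      have c: "continuous_on {0..Tm} (\<lambda>t. W (min t s) \<omega>)" if "s \<in> {0..Tm}" for s
        using that by (intro continuous_on_compose2[OF elim] continuous_intros) auto
      show ?case unfolding simple_integral_def
      proof (intro continuous_intros)
        fix i assume "i \<in> {..<n k}"
        then have "\<tau> k i \<in> {0..Tm}" "\<tau> k (Suc i) \<in> {0..Tm}" using si[of k] by (auto simp: simple_integrand_def)
        then show "continuous_on {0..Tm} (\<lambda>t. W (min t (\<tau> k i)) \<omega>)" "continuous_on {0..Tm} (\<lambda>t. W (min t (\<tau> k (Suc i))) \<omega>)"
          using c by blast+
      qed
    qed
  qed
  then show ?thesis by simp
qed

section \<open>The predictable sigma-field\<close>

definition predictable_gen :: "('a \<times> real) set set" where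
  "predictable_gen = {A \<times> {0} | A. A \<in> sets (Filt 0)} \<union>
      {A \<times> {s<..t} | A s t. 0 \<le> s \<and> s \<le> t \<and> t \<le> Tm \<and> A \<in> sets (Filt s)}"

lemma Filt_into_space: "A \<in> sets (Filt t) \<Longrightarrow> A \<subseteq> space M"
  using sets.sets_into_space[of A "Filt t"] by simp

lemma predictable_gen_cases:
  assumes "Q \<in> predictable_gen"
  obtains (zero) A where "Q = A \<times> {0}" "A \<in> sets (Filt 0)"
    | (interval) A s t where "Q = A \<times> {s<..t}" "0 \<le> s" "s \<le> t" "t \<le> Tm" "A \<in> sets (Filt s)"
  using assms unfolding predictable_gen_def by blast

lemma predictable_gen_Pow: "predictable_gen \<subseteq> Pow (space M \<times> {0..Tm})"
proof
  fix Q assume "Q \<in> predictable_gen"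
  then show "Q \<in> Pow (space M \<times> {0..Tm})"
  proof (cases rule: predictable_gen_cases)
    case (zero A)
    then show ?thesis using Filt_into_space[of A 0] Tm_pos by auto
  next
    case (interval A s t)
    then show ?thesis using Filt_into_space[of A s] by auto
  qed
qed

lemma predictable_sigma_eq: "predictable_sigma = sigma (space M \<times> {0..Tm}) predictable_gen"
  by (simp add: predictable_sigma_def predictable_gen_def)

lemma space_predictable [simp]: "space predictable_sigma = space M \<times> {0..Tm}"
  unfolding predictable_sigma_eq using predictable_gen_Pow by (rule space_measure_of)

lemma sets_predictable: "sets predictable_sigma = sigma_sets (space M \<times> {0..Tm}) predictable_gen"
  unfolding predictable_sigma_eq using predictable_gen_Pow by (rule sets_measure_of)

text \<open>Two rectangles meet in one that starts at the later of the two left ends, where both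
  events are already known. This stability permits the Dynkin induction of the compensation
  formula.\<close>

lemma Int_stable_predictable_gen: "Int_stable predictable_gen"
proof (rule Int_stableI)
  have z: "A \<times> {0} \<in> predictable_gen" if "A \<in> sets (Filt 0)" for A
    using that by (auto simp: predictable_gen_def)
  have i: "A \<times> {s<..t} \<in> predictable_gen" if "0 \<le> s" "s \<le> t" "t \<le> Tm" "A \<in> sets (Filt s)" for A s t
    using that by (auto simp: predictable_gen_def)
  have e: "{} \<in> predictable_gen" using z[of "{}"] by simp
  fix a b assume a: "a \<in> predictable_gen" and b: "b \<in> predictable_gen"
  show "a \<inter> b \<in> predictable_gen"
    using a
  proof (cases rule: predictable_gen_cases)
    case (zero A)
    note A = this
    show ?thesis using b
    proof (cases rule: predictable_gen_cases)
      case (zero A')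
      then have "a \<inter> b = (A \<inter> A') \<times> {0}" using A by auto
      then show ?thesis using z[of "A \<inter> A'"] A zero by auto
    next
      case (interval A' s t)
      then have "a \<inter> b = {}" using A by auto
      then show ?thesis using e by simp
    qed
  next
    case (interval A s t)
    note A = this
    show ?thesis using b
    proof (cases rule: predictable_gen_cases)
      case (zero A')
      then have "a \<inter> b = {}" using A by auto
      then show ?thesis using e by simp
    next
      case (interval A' s' t')
      note A' = this
      have eq: "a \<inter> b = (A \<inter> A') \<times> {max s s'<..min t t'}" unfolding A(1) A'(1) by auto
      show ?thesis
      proof (cases "max s s' \<le> min t t'")
        case True
        have "A \<in> sets (Filt (max s s'))" "A' \<in> sets (Filt (max s s'))"
          using A A' True Filt_mono[of s "max s s'"] Filt_mono[of s' "max s s'"] by auto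
        then show ?thesis unfolding eq using A A' True by (intro i) auto
      next
        case False
        then have "a \<inter> b = {}" unfolding eq by auto
        then show ?thesis using e by simp
      qed
    qed
  qed
qed

lemma predictable_subset: "sets predictable_sigma \<subseteq> sets (M \<Otimes>\<^sub>M lborel)"
proof
  have gen: "Q \<in> sets (M \<Otimes>\<^sub>M lborel)" if "Q \<in> predictable_gen" for Q
    using that
  proof (cases rule: predictable_gen_cases)
    case (zero A)
    then show ?thesis using Filt_le_M[of 0] Tm_pos by auto
  next
    case (interval A s t)
    then show ?thesis using Filt_le_M[of s] by auto
  qed
  fix Q assume "Q \<in> sets predictable_sigma"
  then have "Q \<in> sigma_sets (space M \<times> {0..Tm}) predictable_gen" by (simp add: sets_predictable)
  then show "Q \<in> sets (M \<Otimes>\<^sub>M lborel)"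
  proof induction
    case (Basic a)
    then show ?case by (rule gen)
  next
    case (Compl a)
    then show ?case by (intro sets.Diff) auto
  next
    case (Union a)
    then show ?case by (intro sets.countable_UN) auto
  qed simp
qed

text \<open>Predictable sets live on times in \<open>{0..Tm}\<close>. Clamping the time extends a
  section to the whole line, where Borel measurability and Lebesgue integrals are available, and
  changes nothing at the relevant times.\<close>

lemma predictable_section:
  assumes \<omega>: "\<omega> \<in> space M"
  shows "(\<lambda>s. (\<omega>, max 0 (min Tm s))) \<in> measurable borel predictable_sigma"
  unfolding predictable_sigma_eq
proof (rule measurable_measure_of[OF predictable_gen_Pow])
  show "(\<lambda>s. (\<omega>, max 0 (min Tm s))) \<in> space borel \<rightarrow> space M \<times> {0..Tm}"
    using \<omega> Tm_pos by auto
  fix Q assume "Q \<in> predictable_gen"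
  then obtain A I where Q: "Q = A \<times> I" "I \<in> sets borel"
    by (cases rule: predictable_gen_cases) auto
  have "(\<lambda>s. max 0 (min Tm s)) -` I \<inter> space borel \<in> sets borel"
    by (rule measurable_sets[OF _ Q(2)]) measurable
  moreover have "(\<lambda>s. (\<omega>, max 0 (min Tm s))) -` Q \<inter> space borel =
      (if \<omega> \<in> A then (\<lambda>s. max 0 (min Tm s)) -` I \<inter> space borel else {})"
    unfolding Q by auto
  ultimately show "(\<lambda>s. (\<omega>, max 0 (min Tm s))) -` Q \<inter> space borel \<in> sets borel" by simp
qed

lemma predictable_integrand_section:
  fixes \<psi>' :: "real \<Rightarrow> real \<Rightarrow> 'a \<Rightarrow> real"
  assumes \<psi>': "(\<lambda>((\<omega>, s), x). \<psi>' s x \<omega>) \<in> borel_measurable (predictable_sigma \<Otimes>\<^sub>M borel)"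
    and \<omega>: "\<omega> \<in> space M"
  shows "(\<lambda>q. \<psi>' (max 0 (min Tm (fst q))) (snd q) \<omega>) \<in> borel_measurable (borel \<Otimes>\<^sub>M borel)"
proof -
  have "(\<lambda>q. ((\<omega>, max 0 (min Tm (fst q))), snd q)) \<in> measurable (borel \<Otimes>\<^sub>M borel) (predictable_sigma \<Otimes>\<^sub>M borel)"
    by (intro measurable_Pair measurable_compose[OF measurable_fst predictable_section[OF \<omega>]]) measurable
  from measurable_compose[OF this \<psi>'] show ?thesis by simp
qed

end

section \<open>Counting jumps in predictable sets\<close>

context discrete_levy
begin

text \<open>The number of jumps by \<open>x i\<close> at times in the section of \<open>Q\<close>.
  As a counting measure on the jump times it is countably additive in \<open>Q\<close> for each
  fixed path, whatever the measurability in the sample point.\<close>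

definition jump_count :: "nat \<Rightarrow> ('a \<times> real) set \<Rightarrow> 'a \<Rightarrow> ennreal" where
  "jump_count i Q \<omega> = emeasure (count_space {r\<in>{0<..Tm}. jump \<omega> r = x i}) {r\<in>{0<..Tm}. jump \<omega> r = x i \<and> (\<omega>, r) \<in> Q}"

lemma finite_jumps_at:
  assumes "good \<omega>" shows "finite {r\<in>{0<..Tm}. jump \<omega> r = x i}"
  by (rule finite_subset[OF _ good_finite[OF assms]]) (auto simp: x_nonzero)

lemma jump_count_rectangle:
  assumes "good \<omega>" "0 \<le> s" "t \<le> Tm"
  shows "jump_count i (A \<times> {s<..t}) \<omega> = indicator A \<omega> * ennreal (JS (hat i) s t \<omega>)"
proof (cases "\<omega> \<in> A")
  case True
  have "{r\<in>{0<..Tm}. jump \<omega> r = x i \<and> (\<omega>, r) \<in> A \<times> {s<..t}} = {r\<in>{s<..t}. jump \<omega> r = x i}"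
    using True assms by auto
  moreover have "{r\<in>{s<..t}. jump \<omega> r = x i} \<subseteq> {r\<in>{0<..Tm}. jump \<omega> r = x i}" using assms by auto
  moreover have "finite {r\<in>{s<..t}. jump \<omega> r = x i}"
    by (rule finite_subset[OF calculation(2) finite_jumps_at[OF assms(1)]])
  ultimately show ?thesis using True assms
    by (simp add: jump_count_def JS_hat ennreal_of_nat_eq_real_of_nat)
qed (simp add: jump_count_def)

text \<open>The variable \<open>F\<close> is there because the jump counts need not be measurable off \<open>good\<close>.\<close>

lemma compensation_formula:
  assumes "Q \<in> sets predictable_sigma"
  shows "\<exists>F\<in>borel_measurable M. (AE \<omega> in M. F \<omega> = jump_count i Q \<omega>) \<and>
    (\<integral>\<^sup>+\<omega>. F \<omega> \<partial>M) = ennreal (rate i) * emeasure (M \<Otimes>\<^sub>M lborel) Q"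
  using Int_stable_predictable_gen predictable_gen_Pow assms[unfolded sets_predictable]
proof (induction rule: sigma_sets_induct_disjoint)
  case (basic Q)
  then show ?case
  proof (cases rule: predictable_gen_cases)
    case (zero A)
    note Q = zero(1) and A = zero(2)
    have "A \<in> sets M" using A Filt_le_M[of 0] Tm_pos by auto
    \<comment> \<open>Both sides vanish for a slice at time 0: it is Lebesgue null, and only
      positive times are counted.\<close>
    then have "emeasure (M \<Otimes>\<^sub>M lborel) Q = 0" unfolding Q by (simp add: lborel.emeasure_pair_measure_Times)
    moreover have "jump_count i Q \<omega> = 0" for \<omega>
    proof -
      have "{r\<in>{0<..Tm}. jump \<omega> r = x i \<and> (\<omega>, r) \<in> Q} = {}" unfolding Q by auto
      then show ?thesis by (simp only: jump_count_def emeasure_empty)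
    qed
    ultimately show ?thesis by (intro bexI[of _ "\<lambda>_. 0"]) auto
  next
    case (interval A s t)
    note Q = interval(1) and st = interval(2-4) and A = interval(5)
    have AM[measurable]: "A \<in> sets M" using A Filt_le_M[of s] st by auto
    have J[measurable]: "JS (hat i) s t \<in> borel_measurable M" using st by (intro JS_measurable hat)
    \<comment> \<open>The probabilistic core: \<open>A\<close> is known at time \<open>s\<close>, so
      the mean of the later count factors out and leaves the product measure of the
      rectangle.\<close>
    have "(\<integral>\<^sup>+\<omega>. indicator A \<omega> * ennreal (JS (hat i) s t \<omega>) \<partial>M) = (\<integral>\<^sup>+\<omega>. indicator A \<omega> \<partial>M) * ennreal ((t - s) * rate i)"
      using nn_mean_indep[OF hat(1,2) st borel_measurable_indicator[OF A] JS_hat_mean(1)[OF st]] JS_hat_mean(2)[OF st, of i]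
      by simp
    also have "\<dots> = ennreal (rate i) * emeasure (M \<Otimes>\<^sub>M lborel) Q"
      using st AM rate_pos[of i] unfolding Q by (simp add: lborel.emeasure_pair_measure_Times ennreal_mult' ac_simps)
    finally show ?thesis
      using AE_good st unfolding Q by (intro bexI[of _ "\<lambda>\<omega>. indicator A \<omega> * ennreal (JS (hat i) s t \<omega>)"] conjI)
        (auto elim!: eventually_mono simp: jump_count_rectangle)
  qed
next
  case empty
  show ?case by (intro bexI[of _ "\<lambda>_. 0"]) (auto simp: jump_count_def)
next
  case (compl Q)
  let ?\<Omega> = "space M \<times> {0..Tm}" and ?T = "\<lambda>\<omega>. ennreal (JS (hat i) 0 Tm \<omega>)"
  have Q: "Q \<in> sets (M \<Otimes>\<^sub>M lborel)" "Q \<subseteq> ?\<Omega>"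
    using compl(1) predictable_subset sets.sets_into_space[of Q predictable_sigma] by (auto simp: sets_predictable)
  obtain F where F: "F \<in> borel_measurable M" "AE \<omega> in M. F \<omega> = jump_count i Q \<omega>"
    "(\<integral>\<^sup>+\<omega>. F \<omega> \<partial>M) = ennreal (rate i) * emeasure (M \<Otimes>\<^sub>M lborel) Q" using compl(2) by blast
  have T[measurable]: "?T \<in> borel_measurable M" using JS_measurable[OF hat(1), of 0 Tm i] Tm_pos by simp
  note F(1)[measurable]
  have \<Omega>: "emeasure (M \<Otimes>\<^sub>M lborel) ?\<Omega> = ennreal Tm"
    using Tm_pos emeasure_space_1 by (subst lborel.emeasure_pair_measure_Times) auto
  \<comment> \<open>Complements require subtraction of extended reals, which is sound because the
    total measure is \<open>Tm\<close> and the total count has finite mean.\<close>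
  have Qfin: "emeasure (M \<Otimes>\<^sub>M lborel) Q \<noteq> \<infinity>"
    using emeasure_mono[of Q ?\<Omega> "M \<Otimes>\<^sub>M lborel"] Q(2) \<Omega> by (auto simp: top_unique)
  have Tint: "(\<integral>\<^sup>+\<omega>. ?T \<omega> \<partial>M) = ennreal (rate i) * ennreal Tm"
    using nn_integral_JS_hat[of Tm i] Tm_pos by (simp add: mult.commute)
  have cnt: "AE \<omega> in M. jump_count i (?\<Omega> - Q) \<omega> = ?T \<omega> - jump_count i Q \<omega> \<and> jump_count i Q \<omega> \<le> ?T \<omega>"
    using AE_good
  proof eventually_elim
    case (elim \<omega>)
    let ?R = "{r\<in>{0<..Tm}. jump \<omega> r = x i}"
    let ?RQ = "{r\<in>{0<..Tm}. jump \<omega> r = x i \<and> (\<omega>, r) \<in> Q}"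
    have \<omega>: "\<omega> \<in> space M" using elim by (simp add: good_def)
    have "jump_count i (?\<Omega> - Q) \<omega> = emeasure (count_space ?R) (?R - ?RQ)"
      unfolding jump_count_def using \<omega> by (intro arg_cong2[where f=emeasure]) auto
    also have "\<dots> = emeasure (count_space ?R) ?R - emeasure (count_space ?R) ?RQ"
    proof (rule emeasure_Diff)
      have "finite ?RQ" by (rule finite_subset[OF _ finite_jumps_at[OF elim, of i]]) auto
      then show "emeasure (count_space ?R) ?RQ \<noteq> \<infinity>" by (subst emeasure_count_space_finite) auto
    qed auto
    also have "emeasure (count_space ?R) ?R = ?T \<omega>"
      using finite_jumps_at[OF elim, of i] elim Tm_pos by (subst emeasure_count_space_finite) (auto simp: JS_hat ennreal_of_nat_eq_real_of_nat)
    finally have "jump_count i (?\<Omega> - Q) \<omega> = ?T \<omega> - jump_count i Q \<omega>" by (simp add: jump_count_def)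
    moreover have "jump_count i Q \<omega> \<le> emeasure (count_space ?R) ?R"
      unfolding jump_count_def by (rule emeasure_mono) auto
    ultimately show ?case using \<open>emeasure (count_space ?R) ?R = ?T \<omega>\<close> by simp
  qed
  have "(\<integral>\<^sup>+\<omega>. ?T \<omega> - F \<omega> \<partial>M) = (\<integral>\<^sup>+\<omega>. ?T \<omega> \<partial>M) - (\<integral>\<^sup>+\<omega>. F \<omega> \<partial>M)"
  proof (rule nn_integral_diff)
    show "(\<integral>\<^sup>+\<omega>. F \<omega> \<partial>M) \<noteq> \<infinity>" using F(3) Qfin by (simp add: ennreal_mult_eq_top_iff)
    show "AE \<omega> in M. F \<omega> \<le> ?T \<omega>" using F(2) cnt by eventually_elim auto
  qed auto
  also have "\<dots> = ennreal (rate i) * (emeasure (M \<Otimes>\<^sub>M lborel) ?\<Omega> - emeasure (M \<Otimes>\<^sub>M lborel) Q)"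
    unfolding F(3) Tint \<Omega> by (rule ennreal_right_diff_distrib[symmetric]) simp
  also have "emeasure (M \<Otimes>\<^sub>M lborel) ?\<Omega> - emeasure (M \<Otimes>\<^sub>M lborel) Q = emeasure (M \<Otimes>\<^sub>M lborel) (?\<Omega> - Q)"
    using Q Qfin by (intro emeasure_Diff[symmetric]) auto
  finally show ?case
    using F(2) cnt by (intro bexI[of _ "\<lambda>\<omega>. ?T \<omega> - F \<omega>"] conjI) (auto elim!: eventually_elim2)
next
  case (union Q)
  then obtain F where F: "\<And>j. F j \<in> borel_measurable M" "\<And>j. AE \<omega> in M. F j \<omega> = jump_count i (Q j) \<omega>"
    "\<And>j. (\<integral>\<^sup>+\<omega>. F j \<omega> \<partial>M) = ennreal (rate i) * emeasure (M \<Otimes>\<^sub>M lborel) (Q j)" by metis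
  have Q: "range Q \<subseteq> sets (M \<Otimes>\<^sub>M lborel)" using union(2) predictable_subset by (auto simp: sets_predictable)
  have "AE \<omega> in M. \<forall>j. F j \<omega> = jump_count i (Q j) \<omega>" using F(2) by (simp add: AE_all_countable)
  then have "AE \<omega> in M. (\<Sum>j. F j \<omega>) = jump_count i (\<Union>j. Q j) \<omega>"
  proof eventually_elim
    case (elim \<omega>)
    let ?R = "{r\<in>{0<..Tm}. jump \<omega> r = x i}"
    have "(\<Sum>j. emeasure (count_space ?R) {r\<in>{0<..Tm}. jump \<omega> r = x i \<and> (\<omega>, r) \<in> Q j}) =
      emeasure (count_space ?R) (\<Union>j. {r\<in>{0<..Tm}. jump \<omega> r = x i \<and> (\<omega>, r) \<in> Q j})"
      using union(1) by (intro suminf_emeasure) (auto simp: disjoint_family_on_def)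
    also have "(\<Union>j. {r\<in>{0<..Tm}. jump \<omega> r = x i \<and> (\<omega>, r) \<in> Q j}) = {r\<in>{0<..Tm}. jump \<omega> r = x i \<and> (\<omega>, r) \<in> (\<Union>j. Q j)}"
      by auto
    finally show ?case using elim by (simp add: jump_count_def)
  qed
  moreover have "(\<integral>\<^sup>+\<omega>. (\<Sum>j. F j \<omega>) \<partial>M) = ennreal (rate i) * emeasure (M \<Otimes>\<^sub>M lborel) (\<Union>j. Q j)"
    using F(1,3) suminf_emeasure[OF Q union(1)] by (simp add: nn_integral_suminf)
  ultimately show ?case using F(1) by (intro bexI[of _ "\<lambda>\<omega>. \<Sum>j. F j \<omega>"]) auto
qed

text \<open>If no jump by \<open>x i\<close> ever meets \<open>Q\<close>, its count is almost surely
  0; as the rate of the atom is positive, the compensation formula forces \<open>Q\<close> to be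
  null for the product measure.\<close>

lemma predictable_null:
  assumes Q: "Q \<in> sets predictable_sigma"
    and null: "AE \<omega> in M. \<forall>r\<in>{0<..Tm}. jump \<omega> r = x i \<longrightarrow> (\<omega>, r) \<notin> Q"
  shows "AE \<omega> in M. AE t in lborel. (\<omega>, t) \<notin> Q"
proof -
  obtain F where F: "F \<in> borel_measurable M" "AE \<omega> in M. F \<omega> = jump_count i Q \<omega>"
    "(\<integral>\<^sup>+\<omega>. F \<omega> \<partial>M) = ennreal (rate i) * emeasure (M \<Otimes>\<^sub>M lborel) Q"
    using compensation_formula[OF Q, of i] by blast
  have "AE \<omega> in M. F \<omega> = 0" using F(2) null
  proof eventually_elim
    case (elim \<omega>)
    then have "{r\<in>{0<..Tm}. jump \<omega> r = x i \<and> (\<omega>, r) \<in> Q} = {}" by auto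
    then show ?case using elim(1) by (simp only: jump_count_def emeasure_empty)
  qed
  then have "(\<integral>\<^sup>+\<omega>. F \<omega> \<partial>M) = 0" using F(1) by (subst nn_integral_0_iff_AE) auto
  then have "emeasure (M \<Otimes>\<^sub>M lborel) Q = 0" using F(3) rate_pos[of i] by simp
  then have "AE z in M \<Otimes>\<^sub>M lborel. z \<notin> Q"
    using Q predictable_subset by (intro AE_not_in) (auto simp: null_sets_def)
  interpret pair_sigma_finite M lborel ..
  show ?thesis using AE_pair[OF \<open>AE z in M \<Otimes>\<^sub>M lborel. z \<notin> Q\<close>] .
qed

end

section \<open>Jump integrands of replicating strategies\<close>

context discrete_levy
begin

text \<open>The terminal value splits into the jump sum up to \<open>s\<close>, known at
  \<open>s\<close>, and the later one, which is independent in mean of every event of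
  \<open>Filt s\<close>. Testing against these events identifies the conditional expectation. The
  exceptional event may depend on \<open>s\<close>.\<close>

lemma martingale_value:
  assumes h: "jump_test h" "\<And>y. h y \<ge> 0" and sm: "summable (\<lambda>i. h (x i) * rate i)"
    and V: "is_martingale V" and X: "AE \<omega> in M. JS h 0 Tm \<omega> = x0 + V Tm \<omega>" and s: "s \<in> {0..Tm}"
  shows "AE \<omega> in M. V s \<omega> = JS h 0 s \<omega> + ((Tm - s) * (\<Sum>i. h (x i) * rate i) - x0)"
proof -
  interpret F: finite_measure_subalgebra M "Filt s"
    using Filt_le_M[of s] s by unfold_locales (auto simp: subalgebra_def)
  define c where "c = (Tm - s) * (\<Sum>i. h (x i) * rate i)"
  have st: "0 \<le> s" "s \<le> Tm" "Tm \<le> Tm" using s by auto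
  have i1: "integrable M (JS h 0 s)" using st by (intro JS_mean h sm) auto
  have i2: "integrable M (JS h s Tm)" using st by (intro JS_mean h sm)
  have e2: "expectation (JS h s Tm) = c" unfolding c_def using JS_mean(2)[OF h sm st] .
  have VT: "integrable M (V Tm)" using V Tm_pos unfolding is_martingale_def by auto
  have "AE \<omega> in M. real_cond_exp M (Filt s) (V Tm) \<omega> = JS h 0 s \<omega> + (c - x0)"
  proof (rule F.real_cond_exp_charact)
    fix A assume A: "A \<in> sets (Filt s)"
    then have AM[measurable]: "A \<in> sets M" using Filt_le_M[of s] s by auto
    have iA: "integrable M (\<lambda>\<omega>. indicator A \<omega> * f \<omega> :: real)" if "integrable M f" for f
      using integrable_mult_indicator[OF AM that] by simp
    have iA1: "integrable M (\<lambda>\<omega>. indicator A \<omega> * c' :: real)" for c' by (rule iA) simp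
    have "(LINT \<omega>:A|M. V Tm \<omega>) = (\<integral>\<omega>. indicator A \<omega> * JS h 0 s \<omega> + indicator A \<omega> * JS h s Tm \<omega> - indicator A \<omega> * x0 \<partial>M)"
      unfolding set_lebesgue_integral_def
    proof (rule integral_cong_AE)
      show "AE \<omega> in M. indicator A \<omega> *\<^sub>R V Tm \<omega> = indicator A \<omega> * JS h 0 s \<omega> + indicator A \<omega> * JS h s Tm \<omega> - indicator A \<omega> * x0"
        using X AE_space
      proof eventually_elim
        case (elim \<omega>)
        have "JS h 0 Tm \<omega> = JS h 0 s \<omega> + JS h s Tm \<omega>" using st by (intro JS_add h elim) auto
        then show ?case using elim(1) by (simp add: algebra_simps split: split_indicator)
      qed
    qed (use i1 i2 VT in measurable)
    also have "\<dots> = (\<integral>\<omega>. indicator A \<omega> * JS h 0 s \<omega> \<partial>M) + prob A * c - prob A * x0"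
      using iA[OF i1] iA[OF i2] iA1[of x0] mean_indep[OF h st A i2] e2
      by (simp add: Bochner_Integration.integral_diff Bochner_Integration.integral_add)
    also have "\<dots> = (\<integral>\<omega>. indicator A \<omega> * JS h 0 s \<omega> + indicator A \<omega> * (c - x0) \<partial>M)"
      by (subst Bochner_Integration.integral_add[OF iA[OF i1] iA1], subst integral_mult_left_zero) (simp add: right_diff_distrib)
    also have "\<dots> = (LINT \<omega>:A|M. JS h 0 s \<omega> + (c - x0))"
      unfolding set_lebesgue_integral_def by (intro Bochner_Integration.integral_cong) (auto simp: algebra_simps)
    finally show "(LINT \<omega>:A|M. V Tm \<omega>) = (LINT \<omega>:A|M. JS h 0 s \<omega> + (c - x0))" .
  next
    have "JS h 0 s \<in> borel_measurable (Filt s)" using st by (intro Past_measurable_Filt JS_Past h) auto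
    then show "(\<lambda>\<omega>. JS h 0 s \<omega> + (c - x0)) \<in> borel_measurable (Filt s)" by measurable
  qed (use VT i1 in auto)
  moreover have "AE \<omega> in M. real_cond_exp M (Filt s) (V Tm) \<omega> = V s \<omega>"
    using V s unfolding is_martingale_def by auto
  ultimately show ?thesis unfolding c_def by eventually_elim simp
qed

text \<open>At a truncation level below all atoms no jump is discarded, so the pathwise integral is
  the full sum over jumps and no longer depends on the level.\<close>

lemma compensated_jump_part:
  fixes \<psi>' :: "real \<Rightarrow> real \<Rightarrow> 'a \<Rightarrow> real"
  assumes \<omega>: "good \<omega>" and eq: "\<forall>s\<in>{0..Tm}. \<forall>y. \<psi> s y \<omega> = \<psi>' s y \<omega>"
    and \<psi>': "(\<lambda>((\<omega>, s), x). \<psi>' s x \<omega>) \<in> borel_measurable (predictable_sigma \<Otimes>\<^sub>M borel)"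
    and t: "t \<in> {0..Tm}" and d: "\<And>i. d \<le> \<bar>x i\<bar>"
  shows "(LINT q:{0..t} \<times> {y. d \<le> \<bar>y\<bar>}|N \<omega>. \<psi> (fst q) (snd q) \<omega>) =
    (\<Sum>r\<in>{r\<in>{0<..Tm}. jump \<omega> r \<noteq> 0} \<inter> {0<..t}. \<psi> r (jump \<omega> r) \<omega>)"
proof -
  let ?S = "{0..t} \<times> {y::real. d \<le> \<bar>y\<bar>}" and ?D = "{s\<in>{0..Tm}. jump \<omega> s \<noteq> 0}"
  \<comment> \<open>\<open>N \<omega>\<close> is an image measure, and moving the integral to the
    jump times requires a Borel function on the whole plane; the clamped predictable version
    provides one.\<close>
  define F where "F q = indicator ?S q * \<psi>' (max 0 (min Tm (fst q))) (snd q) \<omega>" for q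
  have \<omega>M: "\<omega> \<in> space M" using \<omega> by (simp add: good_def)
  have cl: "max 0 (min Tm s) = s" if "s \<in> {0..t}" for s using that t by auto
  have Seq: "indicator ?S q *\<^sub>R \<psi> (fst q) (snd q) \<omega> = F q" for q
    using eq cl t by (auto simp: F_def split: split_indicator)
  have "?S \<in> sets (borel \<Otimes>\<^sub>M borel)" by (intro pair_measureI) auto
  then have "F \<in> borel_measurable (borel \<Otimes>\<^sub>M borel)"
    unfolding F_def using predictable_integrand_section[OF \<psi>' \<omega>M] by (intro borel_measurable_times borel_measurable_indicator)
  then have Fm: "F \<in> borel_measurable borel" by (simp add: borel_prod)
  have Deq: "?D = {r\<in>{0<..Tm}. jump \<omega> r \<noteq> 0}" by (auto simp: less_le)
  have fin: "finite ?D" unfolding Deq by (rule good_finite[OF \<omega>])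
  have "(LINT q:?S|N \<omega>. \<psi> (fst q) (snd q) \<omega>) = (LINT q|N \<omega>. F q)"
    unfolding set_lebesgue_integral_def Seq ..
  also have "\<dots> = (LINT s|count_space ?D. F (s, jump \<omega> s))"
    unfolding N_def by (rule integral_distr) (use Fm in auto)
  also have "\<dots> = (\<Sum>s\<in>?D. F (s, jump \<omega> s))" by (rule lebesgue_integral_count_space_finite[OF fin])
  also have "\<dots> = (\<Sum>s\<in>?D. if s \<in> {0<..t} then \<psi> s (jump \<omega> s) \<omega> else 0)"
  proof (rule sum.cong)
    fix s assume s: "s \<in> ?D"
    then have "jump \<omega> s \<in> range x" using \<omega> unfolding Deq by (auto simp: good_def)
    then have "d \<le> \<bar>jump \<omega> s\<bar>" using d by auto
    moreover have "s \<noteq> 0" using s by auto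
    ultimately show "F (s, jump \<omega> s) = (if s \<in> {0<..t} then \<psi> s (jump \<omega> s) \<omega> else 0)"
      unfolding Seq[symmetric] using s by (auto split: split_indicator)
  qed simp
  also have "\<dots> = (\<Sum>r\<in>?D \<inter> {0<..t}. \<psi> r (jump \<omega> r) \<omega>)"
    by (rule sum.inter_restrict[OF fin, symmetric])
  finally show ?thesis unfolding Deq .
qed

text \<open>On the finite measure \<open>\<nu>\<close> the bound of an absolute value by
  \<open>1 + min (z^2) \<bar>z\<bar>\<close> turns the condition of \<open>Psi12\<close> into
  integrability in time of the inner integrals. An indefinite integral is continuous.\<close>

lemma compensator_continuous:
  fixes \<psi>' :: "real \<Rightarrow> real \<Rightarrow> 'a \<Rightarrow> real"
  assumes \<omega>: "\<omega> \<in> space M" and eq: "\<forall>s\<in>{0..Tm}. \<forall>y. \<psi> s y \<omega> = \<psi>' s y \<omega>"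
    and \<psi>': "(\<lambda>((\<omega>, s), x). \<psi>' s x \<omega>) \<in> borel_measurable (predictable_sigma \<Otimes>\<^sub>M borel)"
    and fin: "(\<integral>\<^sup>+s\<in>{0..Tm}. (\<integral>\<^sup>+y. ennreal (min ((\<psi> s y \<omega>)\<^sup>2) \<bar>\<psi> s y \<omega>\<bar>) \<partial>\<nu>) \<partial>lborel) < \<infinity>"
    and B[measurable]: "B \<in> sets borel"
  shows "continuous_on {0..Tm} (\<lambda>t. LINT s:{0..t}|lborel. (LINT y:B|\<nu>. \<psi> s y \<omega>))"
proof -
  interpret nu: finite_measure \<nu> by (rule finite_nu)
  let ?cl = "\<lambda>s. max 0 (min Tm s)"
  let ?f = "\<lambda>s y. \<psi>' (?cl s) y \<omega>"
  define k where "k s = (LINT y:B|\<nu>. ?f s y)" for s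
  have "(\<lambda>q. ?f (fst q) (snd q)) \<in> borel_measurable (borel \<Otimes>\<^sub>M borel)"
    using predictable_integrand_section[OF \<psi>' \<omega>] .
  also have "borel_measurable (borel \<Otimes>\<^sub>M borel) = borel_measurable (borel \<Otimes>\<^sub>M \<nu>)"
    by (intro measurable_cong_sets sets_pair_measure_cong) (auto simp: sets_nu)
  finally have fm[measurable]: "(\<lambda>q. ?f (fst q) (snd q)) \<in> borel_measurable (borel \<Otimes>\<^sub>M \<nu>)" .
  have B'[measurable]: "B \<in> sets \<nu>" by (simp add: sets_nu)
  have fsec[measurable]: "?f s \<in> borel_measurable \<nu>" for s
    using measurable_compose[OF measurable_Pair1'[of s borel \<nu>] fm] by simp
  have km[measurable]: "k \<in> borel_measurable borel"
    unfolding k_def set_lebesgue_integral_def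
  proof (rule nu.borel_measurable_lebesgue_integral)
    have "(\<lambda>q. indicator B (snd q) *\<^sub>R ?f (fst q) (snd q)) \<in> borel_measurable (borel \<Otimes>\<^sub>M \<nu>)" by measurable
    then show "(\<lambda>(s, y). indicator B y *\<^sub>R ?f s y) \<in> borel_measurable (borel \<Otimes>\<^sub>M \<nu>)" by (simp add: case_prod_unfold)
  qed
  let ?m = "\<lambda>s. \<integral>\<^sup>+y. ennreal (min ((?f s y)\<^sup>2) \<bar>?f s y\<bar>) \<partial>\<nu>"
  have mm[measurable]: "?m \<in> borel_measurable borel"
  proof (rule nu.borel_measurable_nn_integral)
    have "(\<lambda>q. ennreal (min ((?f (fst q) (snd q))\<^sup>2) \<bar>?f (fst q) (snd q)\<bar>)) \<in> borel_measurable (borel \<Otimes>\<^sub>M \<nu>)" by measurable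
    then show "(\<lambda>(s, y). ennreal (min ((?f s y)\<^sup>2) \<bar>?f s y\<bar>)) \<in> borel_measurable (borel \<Otimes>\<^sub>M \<nu>)" by (simp add: case_prod_unfold)
  qed
  have kb: "ennreal (norm (k s)) \<le> emeasure \<nu> (space \<nu>) + ?m s" for s
  proof -
    have "ennreal (norm (k s)) \<le> (\<integral>\<^sup>+y. ennreal (norm (indicator B y *\<^sub>R ?f s y)) \<partial>\<nu>)"
    proof (cases "integrable \<nu> (\<lambda>y. indicator B y *\<^sub>R ?f s y)")
      case True
      then show ?thesis unfolding k_def set_lebesgue_integral_def by (rule integral_norm_bound_ennreal)
    next
      \<comment> \<open>The Bochner integral of a function that is not integrable is 0, so the bound
        persists.\<close>
      case False
      then show ?thesis unfolding k_def set_lebesgue_integral_def by (simp add: not_integrable_integral_eq)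
    qed
    also have "\<dots> \<le> (\<integral>\<^sup>+y. 1 + ennreal (min ((?f s y)\<^sup>2) \<bar>?f s y\<bar>) \<partial>\<nu>)"
    proof (rule nn_integral_mono)
      fix y
      have *: "\<bar>z\<bar> \<le> 1 + min (z\<^sup>2) \<bar>z\<bar>" for z :: real
      proof (cases "\<bar>z\<bar> \<le> 1")
        case False
        then have "\<bar>z\<bar> * 1 \<le> \<bar>z\<bar> * \<bar>z\<bar>" by (intro mult_left_mono) auto
        then show ?thesis by (simp add: power2_eq_square)
      qed (simp add: add_increasing2)
      have "norm (indicator B y *\<^sub>R ?f s y) \<le> 1 + min ((?f s y)\<^sup>2) \<bar>?f s y\<bar>"
        using *[of "?f s y"] by (cases "y \<in> B") auto
      then have "ennreal (norm (indicator B y *\<^sub>R ?f s y)) \<le> ennreal (1 + min ((?f s y)\<^sup>2) \<bar>?f s y\<bar>)" by (rule ennreal_leI)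
      also have "\<dots> = 1 + ennreal (min ((?f s y)\<^sup>2) \<bar>?f s y\<bar>)" by (subst ennreal_plus) auto
      finally show "ennreal (norm (indicator B y *\<^sub>R ?f s y)) \<le> 1 + ennreal (min ((?f s y)\<^sup>2) \<bar>?f s y\<bar>)" .
    qed
    also have "\<dots> = emeasure \<nu> (space \<nu>) + ?m s"
      by (subst nn_integral_add) auto
    finally show ?thesis .
  qed
  have "(\<integral>\<^sup>+s. ennreal (norm (indicator {0..Tm} s *\<^sub>R k s)) \<partial>lborel) \<le>
      (\<integral>\<^sup>+s. emeasure \<nu> (space \<nu>) * indicator {0..Tm} s + ?m s * indicator {0..Tm} s \<partial>lborel)"
  proof (rule nn_integral_mono)
    fix s
    show "ennreal (norm (indicator {0..Tm} s *\<^sub>R k s)) \<le>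
        emeasure \<nu> (space \<nu>) * indicator {0..Tm} s + ?m s * indicator {0..Tm} s"
      using kb[of s] by (cases "s \<in> {0..Tm}") simp_all
  qed
  also have "\<dots> = emeasure \<nu> (space \<nu>) * ennreal Tm + (\<integral>\<^sup>+s\<in>{0..Tm}. ?m s \<partial>lborel)"
    using Tm_pos by (subst nn_integral_add) (auto simp: nn_integral_cmult)
  also have "(\<integral>\<^sup>+s\<in>{0..Tm}. ?m s \<partial>lborel) = (\<integral>\<^sup>+s\<in>{0..Tm}. (\<integral>\<^sup>+y. ennreal (min ((\<psi> s y \<omega>)\<^sup>2) \<bar>\<psi> s y \<omega>\<bar>) \<partial>\<nu>) \<partial>lborel)"
    using eq by (intro nn_integral_cong) (auto split: split_indicator)
  also have "emeasure \<nu> (space \<nu>) * ennreal Tm + \<dots> < \<infinity>"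
    using fin by (simp add: nu.emeasure_eq_measure ennreal_mult_less_top)
  finally have "set_integrable lborel {0..Tm} k"
    unfolding set_integrable_def by (intro integrableI_bounded) auto
  have keq: "(LINT s:{0..t}|lborel. (LINT y:B|\<nu>. \<psi> s y \<omega>)) = integral {0..t} k" if t: "t \<in> {0..Tm}" for t
  proof -
    have "(LINT s:{0..t}|lborel. (LINT y:B|\<nu>. \<psi> s y \<omega>)) = (LINT s:{0..t}|lborel. k s)"
      unfolding k_def using eq t by (intro set_lebesgue_integral_cong) auto
    also have "\<dots> = integral {0..t} k"
      using t by (intro set_borel_integral_eq_integral(2) set_integrable_subset[OF \<open>set_integrable lborel {0..Tm} k\<close>]) auto
    finally show ?thesis .
  qed
  have "continuous_on {0..Tm} (\<lambda>t. integral {0..t} k)"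
    by (intro indefinite_integral_continuous_1 set_borel_integral_eq_integral(1) \<open>set_integrable lborel {0..Tm} k\<close>)
  then show ?thesis using keq by (subst continuous_on_cong[OF refl keq]) auto
qed

text \<open>From some truncation index on, every approximation contains all jumps, hence differs
  from the same jump sum by a continuous compensator; the ucp limit keeps this property.\<close>

lemma compensated_integral_jumps:
  assumes K: "is_compensated_integral \<psi> K"
  shows "AE \<omega> in M. continuous_on {0..Tm}
    (\<lambda>t. K t \<omega> - (\<Sum>r\<in>{r\<in>{0<..Tm}. jump \<omega> r \<noteq> 0} \<inter> {0<..t}. \<psi> r (jump \<omega> r) \<omega>))"
proof -
  have Psi: "\<psi> \<in> Psi12" and ucp: "ucp_tendsto M Tm (compensated_trunc \<psi>) K"
    using K by (auto simp: is_compensated_integral_def)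
  obtain \<psi>' where \<psi>': "(\<lambda>((\<omega>, s), x). \<psi>' s x \<omega>) \<in> borel_measurable (predictable_sigma \<Otimes>\<^sub>M borel)"
    and eq: "AE \<omega> in M. \<forall>s\<in>{0..Tm}. \<forall>y. \<psi> s y \<omega> = \<psi>' s y \<omega>"
    and fin: "AE \<omega> in M. (\<integral>\<^sup>+s\<in>{0..Tm}. (\<integral>\<^sup>+y. ennreal (min ((\<psi> s y \<omega>)\<^sup>2) \<bar>\<psi> s y \<omega>\<bar>) \<partial>\<nu>) \<partial>lborel) < \<infinity>"
    using Psi unfolding Psi12_def by blast
  obtain \<delta> where \<delta>: "\<delta> > 0" "\<And>i. \<delta> \<le> \<bar>x i\<bar>" using min_jump by blast
  have "(\<lambda>n. 1 / real (Suc n)) \<longlonglongrightarrow> 0" by (intro LIMSEQ_Suc[OF lim_const_over_n])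
  then have "\<forall>\<^sub>F n in sequentially. 1 / real (Suc n) < \<delta>" using \<delta>(1) by (rule order_tendstoD)
  then obtain n0 where n0: "\<And>n. n \<ge> n0 \<Longrightarrow> 1 / real (Suc n) < \<delta>" by (auto simp: eventually_sequentially)
  show ?thesis
  proof (rule ucp_limit_continuous[OF prob_space_axioms ucp, of n0])
    fix n assume "n0 \<le> n"
    then have d: "1 / real (Suc n) \<le> \<bar>x i\<bar>" for i using n0[of n] \<delta>(2)[of i] by linarith
    show "AE \<omega> in M. continuous_on {0..Tm} (\<lambda>t. compensated_trunc \<psi> n t \<omega> -
        (\<Sum>r\<in>{r\<in>{0<..Tm}. jump \<omega> r \<noteq> 0} \<inter> {0<..t}. \<psi> r (jump \<omega> r) \<omega>))"
      using AE_good eq fin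
    proof eventually_elim
      case (elim \<omega>)
      have \<omega>: "\<omega> \<in> space M" using elim(1) by (simp add: good_def)
      let ?B = "{y. 1 / real (Suc n) \<le> \<bar>y\<bar>}"
      have B: "?B \<in> sets borel" by measurable
      have "continuous_on {0..Tm} (\<lambda>t. - (LINT s:{0..t}|lborel. (LINT y:?B|\<nu>. \<psi> s y \<omega>)))"
        by (intro continuous_on_minus compensator_continuous[where \<psi> = \<psi>, OF \<omega> elim(2) \<psi>' elim(3) B])
      then show ?case
      proof (rule continuous_on_eq)
        fix t assume "t \<in> {0..Tm}"
        then show "- (LINT s:{0..t}|lborel. (LINT y:?B|\<nu>. \<psi> s y \<omega>)) = compensated_trunc \<psi> n t \<omega> -
          (\<Sum>r\<in>{r\<in>{0<..Tm}. jump \<omega> r \<noteq> 0} \<inter> {0<..t}. \<psi> r (jump \<omega> r) \<omega>)"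
          unfolding compensated_trunc_def using compensated_jump_part[where \<psi> = \<psi>, OF elim(1,2) \<psi>' _ d] by simp
      qed
    qed
  qed
qed

lemma integrand_at_jumps:
  assumes h: "jump_test h" "\<And>y. h y \<ge> 0" and sm: "summable (\<lambda>i. h (x i) * rate i)"
    and V: "is_martingale V" and X: "AE \<omega> in M. JS h 0 Tm \<omega> = x0 + V Tm \<omega>"
    and I: "AE \<omega> in M. continuous_on {0..Tm} (\<lambda>t. I t \<omega>)"
    and K: "is_compensated_integral \<psi> K"
    and VIK: "AE \<omega> in M. \<forall>t\<in>{0..Tm}. V t \<omega> = I t \<omega> + K t \<omega>"
  shows "AE \<omega> in M. \<forall>r\<in>{0<..Tm}. jump \<omega> r \<noteq> 0 \<longrightarrow> \<psi> r (jump \<omega> r) \<omega> = h (jump \<omega> r)"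
proof -
  \<comment> \<open>The value of \<open>V\<close> is known almost surely at each single time; a
    countable dense set of times, together with the endpoint, allows one exceptional event for
    all.\<close>
  let ?T = "{t\<in>{0..Tm}. t \<in> \<rat> \<or> t = Tm}"
  let ?c = "\<lambda>t. (Tm - t) * (\<Sum>i. h (x i) * rate i) - x0"
  have "countable ?T" by (rule countable_subset[of _ "insert Tm \<rat>"]) (auto simp: countable_rat)
  then have "AE \<omega> in M. \<forall>t\<in>?T. V t \<omega> = JS h 0 t \<omega> + ?c t"
    by (subst AE_ball_countable) (auto intro!: martingale_value[OF h sm V X])
  with AE_good I VIK compensated_integral_jumps[OF K] show ?thesis
  proof eventually_elim
    case (elim \<omega>)
    let ?D = "{r\<in>{0<..Tm}. jump \<omega> r \<noteq> 0}"
    let ?S = "\<lambda>t. \<Sum>r\<in>?D \<inter> {0<..t}. \<psi> r (jump \<omega> r) \<omega>"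
    have "\<psi> r (jump \<omega> r) \<omega> - h (jump \<omega> r) = 0" if r: "r \<in> ?D" for r
    \<comment> \<open>The two expressions for \<open>V\<close> are subtracted: the Wiener integral,
      the compensator and the deterministic term form the continuous part, and the two jump sums
      combine into steps of height \<open>\<psi> - h\<close>.\<close>
    proof (rule continuous_part_no_jumps[where C = "\<lambda>t. I t \<omega> + (K t \<omega> - ?S t) - ?c t" and D = ?D and Tm = Tm
          and a = "\<lambda>r. \<psi> r (jump \<omega> r) \<omega> - h (jump \<omega> r)" and d = r])
      show "continuous_on {0..Tm} (\<lambda>t. I t \<omega> + (K t \<omega> - ?S t) - ?c t)"
        by (intro continuous_on_diff[OF continuous_on_add[OF elim(2,4)]] continuous_intros)
      show "finite ?D" by (rule good_finite[OF elim(1)])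
      show "?D \<subseteq> {0<..Tm}" "r \<in> ?D" using r by auto
      fix t assume t: "t \<in> {0..Tm}" "t \<in> \<rat> \<or> t = Tm"
      have "JS h 0 t \<omega> = (\<Sum>r\<in>?D \<inter> {0<..t}. h (jump \<omega> r))"
        using t by (intro JS_good elim jump_test_0 h) auto
      moreover have "V t \<omega> = JS h 0 t \<omega> + ?c t" using elim(5) t by blast
      moreover have "V t \<omega> = I t \<omega> + K t \<omega>" using elim(3) t by blast
      ultimately show "I t \<omega> + (K t \<omega> - ?S t) - ?c t + (\<Sum>r\<in>?D \<inter> {0<..t}. \<psi> r (jump \<omega> r) \<omega> - h (jump \<omega> r)) = 0"
        by (simp add: sum_subtractf)
    qed
    then show ?case by auto
  qed
qed

text \<open>The set \<open>Q i\<close> on which the equation fails at \<open>x i\<close> is avoided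
  by all jumps of that size, so \<open>predictable_null\<close> applies to it. The version
  \<open>\<psi>'\<close> is needed to make \<open>Q i\<close> predictable. Countably many atoms cost
  one common null set.\<close>

lemma integrand_at_atoms:
  assumes \<psi>: "\<psi> \<in> Psi12"
    and jumps: "AE \<omega> in M. \<forall>r\<in>{0<..Tm}. jump \<omega> r \<noteq> 0 \<longrightarrow> \<psi> r (jump \<omega> r) \<omega> = h (jump \<omega> r)"
  shows "AE \<omega> in M. AE t in lborel. t \<in> {0..Tm} \<longrightarrow> (\<forall>i. \<psi> t (x i) \<omega> = h (x i))"
proof -
  obtain \<psi>' where \<psi>': "(\<lambda>((\<omega>, s), x). \<psi>' s x \<omega>) \<in> borel_measurable (predictable_sigma \<Otimes>\<^sub>M borel)"
    and eq: "AE \<omega> in M. \<forall>s\<in>{0..Tm}. \<forall>y. \<psi> s y \<omega> = \<psi>' s y \<omega>"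
    using \<psi> unfolding Psi12_def by blast
  define Q where "Q i = {z \<in> space predictable_sigma. \<psi>' (snd z) (x i) (fst z) \<noteq> h (x i)}" for i
  have "AE \<omega> in M. AE t in lborel. (\<omega>, t) \<notin> Q i" for i
  proof (rule predictable_null)
    have "(\<lambda>z. (z, x i)) \<in> measurable predictable_sigma (predictable_sigma \<Otimes>\<^sub>M borel)" by measurable
    from measurable_compose[OF this \<psi>']
    have [measurable]: "(\<lambda>z. \<psi>' (snd z) (x i) (fst z)) \<in> borel_measurable predictable_sigma" by (simp add: case_prod_unfold)
    show "Q i \<in> sets predictable_sigma" unfolding Q_def by measurable
    show "AE \<omega> in M. \<forall>r\<in>{0<..Tm}. jump \<omega> r = x i \<longrightarrow> (\<omega>, r) \<notin> Q i"
      using jumps eq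
    proof eventually_elim
      case (elim \<omega>)
      show ?case
      proof (intro ballI impI)
        fix r assume r: "r \<in> {0<..Tm}" "jump \<omega> r = x i"
        then have "\<psi> r (x i) \<omega> = h (x i)" using elim(1) x_nonzero[of i] by metis
        moreover have "\<psi> r (x i) \<omega> = \<psi>' r (x i) \<omega>" using elim(2) r by auto
        ultimately show "(\<omega>, r) \<notin> Q i" by (simp add: Q_def)
      qed
    qed
  qed
  then have "AE \<omega> in M. \<forall>i. AE t in lborel. (\<omega>, t) \<notin> Q i" by (simp add: AE_all_countable)
  then show ?thesis using eq AE_space
  proof eventually_elim
    case (elim \<omega>)
    have "AE t in lborel. \<forall>i. (\<omega>, t) \<notin> Q i" using elim(1) by (simp add: AE_all_countable)
    then show ?case
    proof eventually_elim
      case e: (elim t)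
      show ?case using e elim(2,3) by (auto simp: Q_def)
    qed
  qed
qed

end

text \<open>The factor \<open>2 * c * exp (Gt * \<bar>y\<bar>)\<close> bounds the price terms for
  all maturities at once, so absolute summability of \<open>u\<close> controls the pairing. Apart
  from the exponential, the bound does not depend on the jump size \<open>y\<close>.\<close>

lemma pairing_exponential_bound:
  fixes u P \<Gamma> :: "nat \<Rightarrow> real"
  assumes u: "summable (\<lambda>j. \<bar>u j\<bar>)" and P: "\<And>j. \<bar>P j\<bar> \<le> c" and G: "\<And>j. \<bar>\<Gamma> j\<bar> \<le> Gt"
  shows "\<bar>\<Sum>j. u j * (P j * (exp (y * \<Gamma> j) - 1))\<bar> \<le> (\<Sum>j. \<bar>u j\<bar>) * (2 * c) * exp (Gt * \<bar>y\<bar>)"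
proof -
  let ?K = "2 * c * exp (Gt * \<bar>y\<bar>)"
  have c: "c \<ge> 0" using P[of 0] by linarith
  have b: "\<bar>u j * (P j * (exp (y * \<Gamma> j) - 1))\<bar> \<le> \<bar>u j\<bar> * ?K" for j
  proof -
    have yG: "\<bar>y * \<Gamma> j\<bar> \<le> Gt * \<bar>y\<bar>" using mult_right_mono[OF G[of j], of "\<bar>y\<bar>"] by (simp add: abs_mult mult.commute)
    have "exp (y * \<Gamma> j) \<le> exp (Gt * \<bar>y\<bar>)" "1 \<le> exp (Gt * \<bar>y\<bar>)" using yG by auto
    then have "\<bar>exp (y * \<Gamma> j) - 1\<bar> \<le> 2 * exp (Gt * \<bar>y\<bar>)" using exp_gt_zero[of "y * \<Gamma> j"] by linarith
    then have "\<bar>P j\<bar> * \<bar>exp (y * \<Gamma> j) - 1\<bar> \<le> c * (2 * exp (Gt * \<bar>y\<bar>))" using P[of j] c by (intro mult_mono) auto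
    from mult_left_mono[OF this abs_ge_zero[of "u j"]] show ?thesis by (simp add: abs_mult ac_simps)
  qed
  have s: "summable (\<lambda>j. \<bar>u j\<bar> * ?K)" using u by (rule summable_mult2)
  have s2: "summable (\<lambda>j. \<bar>u j * (P j * (exp (y * \<Gamma> j) - 1))\<bar>)"
    by (rule summable_comparison_test'[OF s]) (use b in auto)
  have "\<bar>\<Sum>j. u j * (P j * (exp (y * \<Gamma> j) - 1))\<bar> \<le> (\<Sum>j. \<bar>u j * (P j * (exp (y * \<Gamma> j) - 1))\<bar>)"
    by (rule summable_rabs[OF s2])
  also have "\<dots> \<le> (\<Sum>j. \<bar>u j\<bar> * ?K)" by (rule suminf_le[OF b s2 s])
  also have "\<dots> = (\<Sum>j. \<bar>u j\<bar>) * ?K" by (rule suminf_mult2[symmetric, OF u])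
  finally show ?thesis by (simp add: mult.assoc)
qed

theorem theorem4p17:
  fixes M :: "'a measure" and Tm a b Gtilde \<epsilon> :: real
    and Z W bank :: "real \<Rightarrow> 'a \<Rightarrow> real"
    and \<nu> :: "real measure"
    and mat x :: "nat \<Rightarrow> real"
    and f \<alpha> \<sigma> g :: "real \<Rightarrow> real \<Rightarrow> 'a \<Rightarrow> real"
    and \<gamma> :: "real \<Rightarrow> real \<Rightarrow> real \<Rightarrow> 'a \<Rightarrow> real"
  assumes market: "bond_market M Tm Z \<nu> a b W mat f \<alpha> \<sigma> \<gamma> bank"
    and points: "inj x" "filterlim (\<lambda>i. \<bar>x i\<bar>) at_top sequentially"
    and support: "measure_support \<nu> = range x"
    and gamma_linear: "\<And>t y T \<omega>. t \<in> {0..Tm} \<Longrightarrow> T \<in> {0..Tm} \<Longrightarrow> \<omega> \<in> space M \<Longrightarrow>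
                         \<gamma> t y T \<omega> = g t T \<omega> * y"
    and Gtilde_pos: "Gtilde > 0"
    and positive_measure:
      "emeasure (M \<Otimes>\<^sub>M restrict_space lborel {0..Tm})
         {(\<omega>, t). \<omega> \<in> space M \<and> t \<in> {0..Tm} \<and>
            (SUP T\<in>range mat. ereal \<bar>- (LBINT s=ereal t..ereal T. g t s \<omega>)\<bar>) \<le> ereal Gtilde} > 0"
    and eps_pos: "\<epsilon> > 0"
    and exp_moment: "summable (\<lambda>i. exp (2 * (Gtilde + \<epsilon>) * \<bar>x i\<bar>) * measure \<nu> {x i})"
  shows "\<not> bond_market_data.L2_complete M Tm Z \<nu> W mat f \<sigma> \<gamma> bank"
proof
  interpret bond_market M Tm Z \<nu> a b W mat f \<alpha> \<sigma> \<gamma> bank by (rule market)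
  interpret D: discrete_levy M Tm Z \<nu> x
    by unfold_locales (use levy_measure points support in auto)
  assume complete: "L2_complete"
  let ?c = "Gtilde + \<epsilon>"
  have c: "?c > 0" using Gtilde_pos eps_pos by simp
  obtain \<delta> where \<delta>: "\<delta> > 0" "\<And>i. \<delta> \<le> \<bar>x i\<bar>" using D.min_jump by blast
  \<comment> \<open>The second factor is 0 for absolute values up to \<open>\<delta> / 2\<close> and
    1 from \<open>\<delta>\<close> on: \<open>h\<close> becomes a \<open>jump_test\<close> and still
    equals the exponential at every atom.\<close>
  define h where "h y = exp (?c * \<bar>y\<bar>) * min 1 (max 0 (2 * \<bar>y\<bar> / \<delta> - 1))" for y
  have h: "jump_test h" unfolding jump_test_def
  proof
    show "continuous_on UNIV h" unfolding h_def using \<delta>(1) by (intro continuous_intros) auto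
    show "\<exists>\<delta>>0. \<forall>y. \<bar>y\<bar> < \<delta> \<longrightarrow> h y = 0"
      using \<delta>(1) by (intro exI[of _ "\<delta> / 2"]) (auto simp: h_def field_simps)
  qed
  have h0: "h y \<ge> 0" for y by (simp add: h_def)
  have hx: "h (x i) = exp (?c * \<bar>x i\<bar>)" for i
    using \<delta>(1) \<delta>(2)[of i] by (simp add: h_def field_simps min_def)
  \<comment> \<open>Squaring doubles the exponent to \<open>2 * (Gtilde + \<epsilon>)\<close>,
    exactly the order of the assumed moment.\<close>
  have sm2: "summable (\<lambda>i. (h (x i))\<^sup>2 * D.rate i)"
  proof -
    have "(h (x i))\<^sup>2 = exp (2 * (Gtilde + \<epsilon>) * \<bar>x i\<bar>)" for i
      unfolding hx exp_double[symmetric] by (simp only: mult.assoc)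
    then show ?thesis using exp_moment by (simp only: D.rate_def)
  qed
  have sm: "summable (\<lambda>i. h (x i) * D.rate i)"
  proof (rule summable_comparison_test'[OF sm2])
    fix i
    have "1 \<le> h (x i)" using c by (simp add: hx)
    then have "h (x i) * 1 \<le> h (x i) * h (x i)" using h0 by (intro mult_left_mono) auto
    then have "h (x i) \<le> (h (x i))\<^sup>2" by (simp add: power2_eq_square)
    then show "norm (h (x i) * D.rate i) \<le> (h (x i))\<^sup>2 * D.rate i"
      using h0[of "x i"] D.rate_pos[of i] by (simp add: abs_mult mult_right_mono)
  qed
  have "JS h 0 Tm \<in> borel_measurable (Filt Tm)"
    using Tm_pos by (intro Past_measurable_Filt JS_Past h) auto
  moreover have "integrable M (\<lambda>\<omega>. (JS h 0 Tm \<omega>)\<^sup>2)"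
    by (rule D.JS_square_integrable[OF h h0 sm sm2])
  ultimately have "replicable (JS h 0 Tm)" using complete unfolding L2_complete_def by blast
  then obtain x0 \<phi> V where PI: "is_price_integral \<phi> V" and V: "is_martingale V"
    and X: "AE \<omega> in M. JS h 0 Tm \<omega> = x0 + V Tm \<omega>"
    unfolding replicable_def by blast
  then obtain I K where pi: "price_integrable \<phi>" and I: "is_wiener_integral W (wiener_integrand \<phi>) I"
    and K: "is_compensated_integral (jump_integrand \<phi>) K"
    and VIK: "AE \<omega> in M. \<forall>t\<in>{0..Tm}. V t \<omega> = I t \<omega> + K t \<omega>"
    unfolding is_price_integral_def by blast
  have Wc: "AE \<omega> in M. continuous_on {0..Tm} (\<lambda>t. W t \<omega>)"
    using wiener unfolding wiener_process_def by auto
  have at_jumps: "AE \<omega> in M. \<forall>r\<in>{0<..Tm}. jump \<omega> r \<noteq> 0 \<longrightarrow> jump_integrand \<phi> r (jump \<omega> r) \<omega> = h (jump \<omega> r)"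
    by (rule D.integrand_at_jumps[OF h h0 sm V X wiener_integral_continuous[OF Wc I] K VIK])
  have "jump_integrand \<phi> \<in> Psi12" using pi by (simp add: price_integrable_def)
  \<comment> \<open>Wherever the integrand has the prescribed values at all atoms and the prices are
    bounded, the bound on the volatilities must fail; hence almost every section of the set in
    question is null.\<close>
  from D.integrand_at_atoms[OF this at_jumps] bounded_sequences AE_space
  have small: "AE \<omega> in M. AE t in lborel. t \<in> {0..Tm} \<longrightarrow>
      \<not> (SUP T\<in>range mat. ereal \<bar>- (LBINT s=ereal t..ereal T. g t s \<omega>)\<bar>) \<le> ereal Gtilde"
  proof eventually_elim
    case (elim \<omega>)
    from elim(1,2) show ?case
    proof eventually_elim
      case e: (elim t)
      show ?case
      proof (intro impI notI)
        assume t: "t \<in> {0..Tm}"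
          and le: "(SUP T\<in>range mat. ereal \<bar>- (LBINT s=ereal t..ereal T. g t s \<omega>)\<bar>) \<le> ereal Gtilde"
        define \<Gamma> where "\<Gamma> j = - (LBINT s=ereal t..ereal (mat j). g t s \<omega>)" for j
        have \<Gamma>: "\<bar>\<Gamma> j\<bar> \<le> Gtilde" for j
        proof -
          have "ereal \<bar>\<Gamma> j\<bar> \<le> (SUP T\<in>range mat. ereal \<bar>- (LBINT s=ereal t..ereal T. g t s \<omega>)\<bar>)"
            unfolding \<Gamma>_def by (rule SUP_upper) auto
          then show ?thesis using le order_trans by fastforce
        qed
        have G: "G t y (mat j) \<omega> = y * \<Gamma> j" for y j
        proof -
          have mj: "mat j \<in> {0..Tm}" using subsetD[OF mat(1) rangeI[of mat j]] .
          have "(LBINT s=ereal t..ereal (mat j). \<gamma> t y s \<omega>) = (LBINT s=ereal t..ereal (mat j). y * g t s \<omega>)"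
          proof (rule interval_integral_cong)
            fix s assume "s \<in> einterval (min (ereal t) (ereal (mat j))) (max (ereal t) (ereal (mat j)))"
            then have "s \<in> {0..Tm}" using t mj by (auto simp: einterval_def min_def max_def split: if_splits)
            then show "\<gamma> t y s \<omega> = y * g t s \<omega>" using gamma_linear[OF t _ elim(3)] by (simp add: mult.commute)
          qed
          then show ?thesis unfolding G_def \<Gamma>_def by simp
        qed
        obtain C where C: "\<And>j. \<bar>disc_price_left t (mat j) \<omega>\<bar> \<le> C"
          using e(2) t unfolding bounded_iff by auto
        have u: "summable (\<lambda>j. \<bar>\<phi> t \<omega> j\<bar>)"
          using pi elim(3) t unfolding price_integrable_def strategy_def by blast
        define L where "L = (\<Sum>j. \<bar>\<phi> t \<omega> j\<bar>) * (2 * C)"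
        \<comment> \<open>Cancelling \<open>exp (Gtilde * \<bar>x i\<bar>)\<close> leaves
          \<open>exp (\<epsilon> * \<bar>x i\<bar>)\<close> below \<open>L\<close>, which does not
          depend on \<open>i\<close>; the inequality \<open>1 + z \<le> exp z\<close> then bounds
          the atoms themselves.\<close>
        have bd: "\<epsilon> * \<bar>x i\<bar> < L" for i
        proof -
          have "exp (?c * \<bar>x i\<bar>) = jump_integrand \<phi> t (x i) \<omega>" using e(1) t by (simp add: hx)
          also have "\<dots> \<le> L * exp (Gtilde * \<bar>x i\<bar>)"
            using pairing_exponential_bound[where P = "\<lambda>j. disc_price_left t (mat j) \<omega>" and \<Gamma> = \<Gamma>, OF u C \<Gamma>, of "x i"]
            unfolding jump_integrand_def pairing_def G L_def by linarith
          finally have "exp (\<epsilon> * \<bar>x i\<bar>) * exp (Gtilde * \<bar>x i\<bar>) \<le> L * exp (Gtilde * \<bar>x i\<bar>)"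
            by (simp add: exp_add[symmetric] algebra_simps)
          then have "exp (\<epsilon> * \<bar>x i\<bar>) \<le> L" by simp
          then show ?thesis using exp_ge_add_one_self[of "\<epsilon> * \<bar>x i\<bar>"] by linarith
        qed
        have "\<forall>\<^sub>F i in sequentially. L / \<epsilon> < \<bar>x i\<bar>" using points(2) by (simp add: filterlim_at_top_dense)
        then obtain i where "L / \<epsilon> < \<bar>x i\<bar>" by (auto simp: eventually_sequentially)
        then show False using bd[of i] eps_pos by (simp add: field_simps)
      qed
    qed
  qed
  let ?R = "restrict_space lborel {0..Tm}"
  let ?A = "{(\<omega>, t). \<omega> \<in> space M \<and> t \<in> {0..Tm} \<and>
            (SUP T\<in>range mat. ereal \<bar>- (LBINT s=ereal t..ereal T. g t s \<omega>)\<bar>) \<le> ereal Gtilde}"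
  \<comment> \<open>Measurability comes from the positive measure: \<open>emeasure\<close> is 0 on
    every set that is not measurable.\<close>
  have A: "?A \<in> sets (M \<Otimes>\<^sub>M ?R)"
  proof (rule ccontr)
    assume "?A \<notin> sets (M \<Otimes>\<^sub>M ?R)"
    then have "emeasure (M \<Otimes>\<^sub>M ?R) ?A = 0" by (rule emeasure_notin_sets)
    then show False using positive_measure by (simp only: less_irrefl)
  qed
  interpret R: finite_measure ?R
    using Tm_pos by (intro finite_measure_restrict_space finite_measureI) (auto simp: emeasure_restrict_space space_restrict_space)
  have "emeasure (M \<Otimes>\<^sub>M ?R) ?A = (\<integral>\<^sup>+\<omega>. emeasure ?R (Pair \<omega> -` ?A) \<partial>M)"
    by (rule R.emeasure_pair_measure_alt[OF A])
  also have "\<dots> = (\<integral>\<^sup>+\<omega>. 0 \<partial>M)"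
  proof (rule nn_integral_cong_AE)
    show "AE \<omega> in M. emeasure ?R (Pair \<omega> -` ?A) = 0"
      using small
    proof eventually_elim
      case (elim \<omega>)
      define B where "B = Pair \<omega> -` ?A"
      have "B \<in> sets ?R" unfolding B_def by (rule sets_Pair1[OF A])
      then have B: "B \<in> sets lborel" "B \<subseteq> {0..Tm}"
        by (auto simp: sets_restrict_space_iff)
      have "AE t in lborel. t \<notin> B"
        using elim
      proof eventually_elim
        case e: (elim t)
        show ?case
        proof
          assume "t \<in> B"
          then have "t \<in> {0..Tm}" "(SUP T\<in>range mat. ereal \<bar>- (LBINT s=ereal t..ereal T. g t s \<omega>)\<bar>) \<le> ereal Gtilde"
            unfolding B_def by (simp_all only: vimage_eq mem_Collect_eq prod.case)
          with e show False by (simp only: simp_thms)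
        qed
      qed
      then have "emeasure lborel B = 0" using AE_iff_measurable[OF B(1), of "\<lambda>t. t \<notin> B"] by auto
      then have "emeasure ?R B = 0" using B by (subst emeasure_restrict_space) auto
      then show ?case unfolding B_def .
    qed
  qed
  finally show False using positive_measure by simp
qed

end
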